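(* Let $k\ge2$ and $\mu=k-1$ (smoothest B-splines). Write $$F_k(t)=\mathcal F^{k}(L_1)(t)=\sum_{j\in\mathcal U_k\setminus\{0\}}\gamma_jL_j(t).$$ Then the leading-order coefficients $\{c_j\}_{j\in\mathcal U_k}$ (for even $k$), respectively $\{c_j\}_{j\in\mathcal U_k\setminus\{0\}}$ (for odd $k$), of the error $e=u-u_h$ satisfy $$\frac{c_j}{c_{k+1}}=\frac{\gamma_j}{\gamma_{k+1}},\qquad j\in\mathcal U_k\setminus\{0,k+1\},$$ up to $O(h^{k+2})$ remainders, i.e. $c_j=\frac{\gamma_j}{\gamma_{k+1}}c_{k+1}+O(h^{k+2})$.
   Context: $L_j$ is the Legendre polynomial of degree $j$; $\mathcal U_k=\{0\le j\le k+1:\ j\equiv k+1\ (\mathrm{mod}\ 2)\}$. The linear operator $\mathcal F$ on $\operatorname{span}\{L_1,L_2,\dots\}$ is $\mathcal F(L_1)=\frac13L_2$, $\mathcal F(L_j)=\frac1{2j+1}(L_{j+1}-L_{j-1})$ for $j\ge2$; $\mathcal F^k$ is its $k$-fold iterate. Setting. $\Omega=(a,b)$; $u$ (sufficiently smooth) solves $-u''=f$ in $\Omega$, $u(a)=u(b)=0$; $a=x_1<\dots<x_{N+1}=b$ is a quasi-uniform family of partitions, $h=\max_i(x_{i+1}-x_i)$, $I_i=[x_i,x_{i+1}]$; $S_h^{k,\mu}(\Omega)=\{\chi\in C^\mu(\Omega):\chi|_{I_i}\in\mathcal P_k(I_i)\ \forall i\}$; $V_h=S_h^{k,\mu}(\Omega)\cap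 H_0^1(\Omega)$; $u_h\in V_h$ satisfies $\int_\Omega(u-u_h)'\chi'\,dx=0$ for all $\chi\in V_h$. Fix $x_0\in\Omega$ such that the mesh is uniform (elements of length $h$) within $B_d(x_0)\subset\Omega$, a union of whole elements centered at $x_0$ of size $d=C^*h|\ln h|$, $C^*$ a sufficiently large constant. For elements $I_i$ with midpoints $x_{i+1/2}$ satisfying $|x_{i+1/2}-x_0|=O(h)$, put $t=2(x-x_{i+1/2})/h$ and $c_{j,i}=\frac{2j+1}{2}\int_{-1}^1e|_{I_i}(t)L_j(t)\,dt$. The leading-order coefficients $c_j$ are numbers independent of $i$ with $c_{j,i}=c_j+O(h^{k+2})$ for all such elements. $A=O(h^m)$ means $|A|\le Ch^m$ with $C$ independent of $h$. *)

theory Defs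
  imports "HOL-Analysis.Analysis" "HOL-Computational_Algebra.Polynomial"
begin

subsection \<open>Legendre polynomials and the operator F\<close>

text \<open>Rodrigues' formula.\<close>

definition legendre :: "nat \<Rightarrow> real poly" where
  "legendre j = smult (1 / (2 ^ j * fact j)) ((pderiv ^^ j) ([:-1, 0, 1:] ^ j))"

definition \<U> :: "nat \<Rightarrow> nat set" where
  "\<U> k = {j. j \<le> k + 1 \<and> j mod 2 = (k + 1) mod 2}"

interpretation poly_vs: vector_space_pair
  "smult :: real \<Rightarrow> real poly \<Rightarrow> real poly" "smult :: real \<Rightarrow> real poly \<Rightarrow> real poly"
  by unfold_locales (simp_all add: smult_add_left smult_add_right)

text \<open>The linear extension of the prescribed values on the basis
  \<open>legendre ` {1..}\<close>.  As \<open>legendre j\<close> has degree \<open>j\<close>, the value on a basis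
  polynomial can be given in terms of its degree; see \<open>calF_legendre_1\<close> and \<open>calF_legendre\<close>.
  Outside the span of the basis, the values of \<open>calF\<close> are irrelevant.\<close>

definition calF_basis :: "nat \<Rightarrow> real poly" where
  "calF_basis j = (if j = 1 then smult (1 / 3) (legendre 2)
     else smult (1 / (2 * real j + 1)) (legendre (j + 1) - legendre (j - 1)))"

definition calF :: "real poly \<Rightarrow> real poly" where
  "calF = poly_vs.construct (legendre ` {1..}) (\<lambda>p. calF_basis (degree p))"

lemma degree_legendre [simp]: "degree (legendre j) = j"
proof -
  have "degree ((pderiv ^^ n) p) = degree p - n" for n and p :: "real poly"
    by (induction n) (simp_all add: degree_pderiv)
  moreover have "degree ([:-1, 0, 1:] ^ j :: real poly) = 2 * j"
    by (simp add: degree_power_eq)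
  ultimately show ?thesis
    by (simp add: legendre_def)
qed

lemma legendre_nonzero [simp]: "legendre j \<noteq> 0"
proof (cases "j = 0")
  case True
  then show ?thesis by (simp add: legendre_def)
next
  case False
  then show ?thesis by (metis degree_0 degree_legendre)
qed

lemma inj_legendre: "inj_on legendre A"
  by (metis degree_legendre inj_onI)

lemma independent_legendre: "poly_vs.vs1.independent (legendre ` A)"
  unfolding poly_vs.vs1.independent_explicit_module
proof (intro allI impI, rule ccontr)
  fix T c v
  assume T: "finite T" "T \<subseteq> legendre ` A" "(\<Sum>p\<in>T. smult (c p) p) = 0" "v \<in> T" "c v \<noteq> 0"
  define S where "S = {p \<in> T. c p \<noteq> 0}"
  have S: "finite S" "S \<noteq> {}" using T by (auto simp: S_def)
  then have "Max (degree ` S) \<in> degree ` S" by (intro Max_in) auto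
  then obtain q where q: "q \<in> S" "degree q = Max (degree ` S)" by auto
  then have max: "degree p \<le> degree q" if "p \<in> S" for p using S that by auto
  have "coeff (smult (c p) p) (degree q) = 0" if "p \<in> T - {q}" for p
  proof (cases "p \<in> S")
    case True
    have "p \<in> legendre ` A" "q \<in> legendre ` A" using that T(2) q by (auto simp: S_def)
    then obtain i j where ij: "p = legendre i" "q = legendre j" by (elim imageE)
    with that max[OF True] have "i < j" by (metis DiffD2 degree_legendre le_neq_implies_less singletonI)
    then show ?thesis by (simp add: ij coeff_eq_0)
  next
    case False
    then show ?thesis using that by (auto simp: S_def)
  qed
  then have "(\<Sum>p\<in>T - {q}. coeff (smult (c p) p) (degree q)) = 0"
    by (intro sum.neutral) auto
  then have "coeff (\<Sum>p\<in>T. smult (c p) p) (degree q) = c q * lead_coeff q"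
    using T q by (subst coeff_sum, subst sum.remove[of _ q]) (auto simp: S_def)
  then have "lead_coeff q = 0" using T(3) q(1) by (simp add: S_def)
  moreover have "q \<in> legendre ` A" using q(1) T(2) by (auto simp: S_def)
  ultimately show False by auto
qed

lemma linear_calF: "Vector_Spaces.linear smult smult calF"
  unfolding calF_def by (rule poly_vs.linear_construct[OF independent_legendre])

lemma calF_legendre_1: "calF (legendre 1) = smult (1 / 3) (legendre 2)"
  unfolding calF_def
  by (subst poly_vs.construct_basis[OF independent_legendre]) (auto simp: calF_basis_def)

lemma calF_legendre:
  "j \<ge> 2 \<Longrightarrow> calF (legendre j) = smult (1 / (2 * real j + 1)) (legendre (j + 1) - legendre (j - 1))"
  unfolding calF_def
  by (subst poly_vs.construct_basis[OF independent_legendre]) (auto simp: calF_basis_def)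

lemma mem_U_iff: "j \<in> \<U> k \<longleftrightarrow> j \<le> k + 1 \<and> (even j \<longleftrightarrow> odd k)"
  unfolding \<U>_def mem_Collect_eq even_iff_mod_2_eq_zero by (metis Suc_eq_plus1 even_Suc even_iff_mod_2_eq_zero not_mod_2_eq_0_eq_1)

text \<open>The coefficients \<open>\<gamma>\<close> of the iterates exist (uniquely on \<open>\<U> k - {0}\<close>, by
  \<open>independent_legendre\<close>), and the leading one does not vanish.\<close>

lemma calF_iterate_expansion:
  "\<exists>\<gamma>. (calF ^^ k) (legendre 1) = (\<Sum>j\<in>\<U> k - {0}. smult (\<gamma> j) (legendre j)) \<and> \<gamma> (k + 1) \<noteq> 0"
proof -
  interpret F: Vector_Spaces.linear smult smult calF by (rule linear_calF)
  let ?span = poly_vs.vs1.span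
  have mem: "smult c (legendre j) \<in> ?span (legendre ` A)" if "j \<in> A" for c j A
    using that by (intro poly_vs.vs1.span_scale poly_vs.vs1.span_base) auto
  have "\<exists>g q. g \<noteq> 0 \<and> q \<in> ?span (legendre ` (\<U> k - {0, k + 1})) \<and>
          (calF ^^ k) (legendre 1) = smult g (legendre (k + 1)) + q"
  proof (induction k)
    case 0
    show ?case by (rule exI[of _ 1], rule exI[of _ 0]) (simp add: poly_vs.vs1.span_zero)
  next
    case (Suc k)
    then obtain g q where g: "g \<noteq> 0" and q: "q \<in> ?span (legendre ` (\<U> k - {0, k + 1}))"
      and eq: "(calF ^^ k) (legendre 1) = smult g (legendre (k + 1)) + q"
      by (elim exE conjE) (rule that)
    let ?A = "legendre ` (\<U> (Suc k) - {0, Suc k + 1})"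
    have *: "calF (legendre j) \<in> ?span ?A" if "j \<in> \<U> k - {0, k + 1}" for j
    proof (cases "j = 1")
      case True
      have "even k" using that True by (auto simp: mem_U_iff)
      moreover have "k \<noteq> 0" using that True by auto
      ultimately have "2 \<in> \<U> (Suc k) - {0, Suc k + 1}" by (simp add: mem_U_iff)
      then show ?thesis unfolding True calF_legendre_1 by (rule mem)
    next
      case False
      with that have "j \<ge> 2" by auto
      then have "j + 1 \<in> \<U> (Suc k) - {0, Suc k + 1}" "j - 1 \<in> \<U> (Suc k) - {0, Suc k + 1}"
        using that by (auto simp: mem_U_iff)
      then have "smult (1 / (2 * real j + 1)) (legendre (j + 1)) - smult (1 / (2 * real j + 1)) (legendre (j - 1)) \<in> ?span ?A"
        by (intro poly_vs.vs1.span_diff mem)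
      with \<open>j \<ge> 2\<close> show ?thesis
        by (simp only: calF_legendre smult_diff_right)
    qed
    have "calF ` ?span (legendre ` (\<U> k - {0, k + 1})) \<subseteq> ?span ?A"
      unfolding F.span_image[symmetric]
      using * by (intro poly_vs.vs1.span_minimal) auto
    with q have Fq: "calF q \<in> ?span ?A" by blast
    show ?case
    proof (cases "k = 0")
      case True
      have "(calF ^^ Suc k) (legendre 1) = smult (g / 3) (legendre (Suc k + 1)) + calF q"
        using calF_legendre_1
        by (simp only: funpow.simps o_apply eq F.add F.scale) (simp add: True numeral_2_eq_2)
      then show ?thesis using g Fq by (intro exI[of _ "g / 3"] exI[of _ "calF q"]) auto
    next
      case False
      let ?g = "g / (2 * real (k + 1) + 1)"
      have "k \<in> \<U> (Suc k) - {0, Suc k + 1}"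
        using False by (auto simp: \<U>_def)
      then have "calF q - smult ?g (legendre k) \<in> ?span ?A"
        using Fq by (intro poly_vs.vs1.span_diff mem)
      moreover have "(calF ^^ Suc k) (legendre 1) =
          smult ?g (legendre (Suc k + 1)) + (calF q - smult ?g (legendre k))"
        using False calF_legendre[of "k + 1"]
        by (simp only: funpow.simps o_apply eq F.add F.scale) (simp add: smult_diff_right)
      moreover have "?g \<noteq> 0" using g by (simp add: add_nonneg_eq_0_iff)
      ultimately show ?thesis by (intro exI conjI)
    qed
  qed
  then obtain g q where g: "g \<noteq> 0" and q: "q \<in> ?span (legendre ` (\<U> k - {0, k + 1}))"
    and eq: "(calF ^^ k) (legendre 1) = smult g (legendre (k + 1)) + q"
    by (elim exE conjE) (rule that)
  have fin: "finite (\<U> k)" by (auto simp: \<U>_def)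
  with q obtain r where r: "q = (\<Sum>p\<in>legendre ` (\<U> k - {0, k + 1}). smult (r p) p)"
    by (subst (asm) poly_vs.vs1.span_finite) auto
  let ?\<gamma> = "\<lambda>j. if j = k + 1 then g else r (legendre j)"
  have "q = (\<Sum>j\<in>\<U> k - {0, k + 1}. smult (?\<gamma> j) (legendre j))"
    unfolding r by (subst sum.reindex[OF inj_legendre]) (auto intro!: sum.cong)
  moreover have "\<U> k - {0} - {k + 1} = \<U> k - {0, k + 1}" by auto
  moreover have "k + 1 \<in> \<U> k - {0}" by (auto simp: \<U>_def)
  ultimately have "(calF ^^ k) (legendre 1) = (\<Sum>j\<in>\<U> k - {0}. smult (?\<gamma> j) (legendre j))"
    using fin eq by (subst sum.remove[of _ "k + 1"]) auto
  then show ?thesis using g by (intro exI[of _ ?\<gamma>]) auto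
qed


subsection \<open>Function spaces\<close>

text \<open>\<open>n\<close> times continuously differentiable on \<open>S\<close>, one-sided at boundary points contained
  in \<open>S\<close>; \<open>D i\<close> is the \<open>i\<close>-th derivative.\<close>

definition C_space :: "nat \<Rightarrow> real set \<Rightarrow> (real \<Rightarrow> real) set" where
  "C_space n S = {f. \<exists>D. (\<forall>s\<in>S. D 0 s = f s) \<and>
     (\<forall>i<n. \<forall>s\<in>S. (D i has_real_derivative D (Suc i) s) (at s within S)) \<and>
     (\<forall>i\<le>n. continuous_on S (D i))}"

text \<open>The Sobolev space \<open>H\<^sub>0\<^sup>1(a,b)\<close>, each class being identified with its absolutely continuous
  representative on \<open>[a,b]\<close>: the primitives \<open>v(s) = \<integral>\<^sub>a\<^sup>s g\<close> of square integrable
  functions \<open>g\<close> with \<open>v(b) = 0\<close>.\<close>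

definition H10 :: "real \<Rightarrow> real \<Rightarrow> (real \<Rightarrow> real) set" where
  "H10 a b = {v. (\<exists>g. g \<in> borel_measurable (lebesgue_on {a..b}) \<and>
       (\<lambda>s. (g s)\<^sup>2) integrable_on {a..b} \<and>
       (\<forall>s\<in>{a..b}. v s = integral {a..s} g)) \<and> v b = 0}"


subsection \<open>Meshes and splines\<close>

text \<open>A mesh is given by its number \<open>N\<close> of elements and its nodes \<open>x 1, \<dots>, x (N + 1)\<close>.\<close>

definition is_mesh :: "real \<Rightarrow> real \<Rightarrow> nat \<Rightarrow> (nat \<Rightarrow> real) \<Rightarrow> bool" where
  "is_mesh a b N x \<longleftrightarrow> N \<ge> 1 \<and> x 1 = a \<and> x (N + 1) = b \<and> (\<forall>i\<in>{1..N}. x i < x (i + 1))"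

definition elem :: "(nat \<Rightarrow> real) \<Rightarrow> nat \<Rightarrow> real set" where
  "elem x i = {x i..x (i + 1)}"

definition midpt :: "(nat \<Rightarrow> real) \<Rightarrow> nat \<Rightarrow> real" where
  "midpt x i = (x i + x (i + 1)) / 2"

definition meshsize :: "nat \<Rightarrow> (nat \<Rightarrow> real) \<Rightarrow> real" where
  "meshsize N x = Max ((\<lambda>i. x (i + 1) - x i) ` {1..N})"

text \<open>Quasi-uniformity of a family of meshes means that this holds for all its members with the
  same \<open>\<sigma>\<close>.\<close>

definition quasi_uniform :: "real \<Rightarrow> nat \<Rightarrow> (nat \<Rightarrow> real) \<Rightarrow> bool" where
  "quasi_uniform \<sigma> N x \<longleftrightarrow> (\<forall>i\<in>{1..N}. meshsize N x \<le> \<sigma> * (x (i + 1) - x i))"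

text \<open>The ball of radius \<open>d\<close> about \<open>x0\<close> lies in \<open>(a,b)\<close> and is (up to its boundary points) a union
  of whole elements, all of length \<open>h\<close>.\<close>

definition locally_uniform ::
    "real \<Rightarrow> real \<Rightarrow> nat \<Rightarrow> (nat \<Rightarrow> real) \<Rightarrow> real \<Rightarrow> real \<Rightarrow> bool" where
  "locally_uniform a b N x x0 d \<longleftrightarrow> ball x0 d \<subseteq> {a<..<b} \<and>
     (\<exists>J\<subseteq>{1..N}. cball x0 d = (\<Union>i\<in>J. elem x i) \<and>
        (\<forall>i\<in>J. x (i + 1) - x i = meshsize N x))"

definition spline_space ::
    "real \<Rightarrow> real \<Rightarrow> nat \<Rightarrow> (nat \<Rightarrow> real) \<Rightarrow> nat \<Rightarrow> nat \<Rightarrow> (real \<Rightarrow> real) set" where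
  "spline_space a b N x k \<mu> = {v \<in> C_space \<mu> {a<..<b}.
     \<forall>i\<in>{1..N}. \<exists>p :: real poly. degree p \<le> k \<and> (\<forall>s\<in>elem x i. v s = poly p s)}"

definition V_space ::
    "real \<Rightarrow> real \<Rightarrow> nat \<Rightarrow> (nat \<Rightarrow> real) \<Rightarrow> nat \<Rightarrow> nat \<Rightarrow> (real \<Rightarrow> real) set" where
  "V_space a b N x k \<mu> = spline_space a b N x k \<mu> \<inter> H10 a b"

text \<open>For \<open>\<mu> \<ge> 1\<close> and \<open>u\<close> continuously differentiable, the derivatives below exist in the classical
  sense at every point of \<open>(a,b)\<close>.\<close>

definition galerkin_solution ::
    "real \<Rightarrow> real \<Rightarrow> nat \<Rightarrow> (nat \<Rightarrow> real) \<Rightarrow> nat \<Rightarrow> nat \<Rightarrow> (real \<Rightarrow> real) \<Rightarrow> (real \<Rightarrow> real) \<Rightarrow> bool" where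
  "galerkin_solution a b N x k \<mu> u uh \<longleftrightarrow> uh \<in> V_space a b N x k \<mu> \<and>
     (\<forall>v\<in>V_space a b N x k \<mu>.
        integral {a<..<b} (\<lambda>s. deriv (\<lambda>y. u y - uh y) s * deriv v s) = 0)"


subsection \<open>Legendre coefficients of the error\<close>

text \<open>On an element of length \<open>h\<close>, the local coordinate \<open>t = 2 (s - midpt x i) / h\<close> is inverted by
  \<open>s = midpt x i + h t / 2\<close>.\<close>

definition elem_coeff :: "(real \<Rightarrow> real) \<Rightarrow> nat \<Rightarrow> (nat \<Rightarrow> real) \<Rightarrow> nat \<Rightarrow> nat \<Rightarrow> real" where
  "elem_coeff e N x j i = (2 * real j + 1) / 2 *
     integral {-1..1} (\<lambda>t. e (midpt x i + meshsize N x * t / 2) * poly (legendre j) t)"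

text \<open>For a family of meshes indexed by \<open>m\<close>, with errors \<open>e m\<close>, the numbers \<open>c m\<close> are leading-order
  coefficients of degree \<open>j\<close>.  The elements with midpoints at distance \<open>O(h)\<close> from \<open>x0\<close> are those
  with distance at most \<open>R h\<close>, where \<open>R\<close> is arbitrary but fixed and the constant \<open>C\<close> may depend on
  \<open>R\<close>.  They lie in the ball of radius \<open>d\<close> as soon as \<open>h\<close> is small, depending on \<open>R\<close>; this is
  required explicitly since otherwise their length need not be \<open>h\<close>.\<close>

definition leading_coeff ::
    "('m \<Rightarrow> nat) \<Rightarrow> ('m \<Rightarrow> nat \<Rightarrow> real) \<Rightarrow> real \<Rightarrow> ('m \<Rightarrow> real) \<Rightarrow> ('m \<Rightarrow> real \<Rightarrow> real) \<Rightarrow>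
     nat \<Rightarrow> nat \<Rightarrow> ('m \<Rightarrow> real) \<Rightarrow> bool" where
  "leading_coeff N x x0 d e k j c \<longleftrightarrow>
     (\<forall>R>0. \<exists>C. \<forall>m. \<forall>i\<in>{1..N m}.
        elem (x m) i \<subseteq> cball x0 (d m) \<longrightarrow>
        \<bar>midpt (x m) i - x0\<bar> \<le> R * meshsize (N m) (x m) \<longrightarrow>
        \<bar>elem_coeff (e m) (N m) (x m) j i - c m\<bar> \<le> C * meshsize (N m) (x m) ^ (k + 2))"

end

theory Submission
  imports Defs
begin

text \<open>
  The operator \<open>\<F>\<close> integrates and then removes the mean value, so \<open>F\<^sub>k = \<F>\<^sup>k(L\<^sub>1)\<close> is, up to
  normalization, a Bernoulli polynomial of degree \<open>k + 1\<close> on \<open>[-1,1]\<close>: its derivatives of order less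
  than \<open>k\<close> take equal values at both ends.  It also has the parity of \<open>k + 1\<close>.  In that parity these
  end conditions determine a polynomial of degree \<open>k + 1\<close> up to a factor and an additive constant
  (\<open>proportional_to_calF_iterate\<close>).  It is therefore enough to prove the same end conditions, up to
  \<open>O(h\<^bsup>k+2\<^esup>)\<close>, for the leading-order error \<open>E = \<Sum> c\<^sub>j L\<^sub>j\<close>, the sum being over
  \<open>j \<in> \<U>\<^sub>k - {0}\<close>.

  They follow from the behavior of the error on \<open>k + 2\<close> consecutive elements near \<open>x0\<close>.  On each of
  them, replace \<open>u\<close> by its Taylor polynomial of degree \<open>k + 1\<close>; the error becomes a polynomial \<open>q\<^sub>i\<close>,
  and these polynomials have exactly the smoothness of splines at the nodes, while their part in the
  span of \<open>L\<^sub>j\<close>, \<open>j \<in> \<U>\<^sub>k - {0}\<close>, hardly depends on \<open>i\<close>.  The rest of \<open>q\<^sub>i\<close> has, apart from a constant,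
  the opposite parity, and by the smoothness it changes sign from one element to the next, up to terms of degree at most 1.
  So in \<open>q\<^sub>i' + q\<^bsub>i+1\<^esub>'\<close> only \<open>2 E'\<close> and a constant \<open>s\<^sub>i\<close> survive.  Comparing
  neighbors at a node gives the periodicity of the derivatives of \<open>E'\<close> of order at least 1, and shows
  that \<open>s\<^sub>i\<close> is an arithmetic progression in \<open>i\<close>.

  Smoothness alone says no more: a global linear or quadratic term in the error is compatible with
  it.  This is where the Galerkin equations enter.  They make the derivative of the error orthogonal
  to B-splines of degree \<open>k - 1\<close>, whose translates sum to a constant.  Testing with three consecutive
  B-splines shows that \<open>s\<^sub>i\<close> does not depend on \<open>i\<close> and that \<open>2 E' + s\<^sub>i\<close> has mean zero, which gives
  the missing end condition (\<open>error_pattern_proportional\<close>).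

  The remainders are handled by linear algebra: a linear functional that vanishes where finitely many
  others vanish is a linear combination of them.  Hence the conclusion holds up to \<open>O(h\<^bsup>k+2\<^esup>)\<close> if all
  the hypotheses do (\<open>error_pattern_almost_proportional\<close>), and the hypotheses hold to that order by
  Taylor's formula and the definition of the \<open>c\<^sub>j\<close> (\<open>local_error_pattern\<close>).

  The argument is local.  The size of \<open>d\<close> only has to guarantee \<open>k + 2\<close> consecutive elements of
  length \<open>h\<close>, beginning with the one that contains \<open>x0\<close>, which it does if \<open>\<bar>ln h\<bar> \<ge> 1\<close>.  For the other meshes \<open>h\<close> is bounded below,
  and it suffices that the error is bounded, by the energy estimate.
\<close>

section \<open>Linear functionals on coordinate spaces\<close>

definition linear_functional :: "(('i \<Rightarrow> real) \<Rightarrow> real) \<Rightarrow> bool" where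
  "linear_functional f \<longleftrightarrow> (\<forall>x y c. f (\<lambda>i. x i + c * y i) = f x + c * f y)"

lemma linear_functionalD:
  "linear_functional f \<Longrightarrow> f (\<lambda>i. x i + c * y i) = f x + c * f y"
  by (simp add: linear_functional_def)

lemma linear_functional_add_mult:
  "linear_functional f \<Longrightarrow> linear_functional g \<Longrightarrow> linear_functional (\<lambda>x. f x + c * g x)"
  unfolding linear_functional_def by (simp add: algebra_simps)

lemma linear_functional_diff:
  "linear_functional f \<Longrightarrow> linear_functional g \<Longrightarrow> linear_functional (\<lambda>x. f x - g x)"
  unfolding linear_functional_def by (simp add: algebra_simps)

lemma linear_functional_sum:
  "(\<And>a. a \<in> A \<Longrightarrow> linear_functional (f a)) \<Longrightarrow> linear_functional (\<lambda>x. \<Sum>a\<in>A. f a x)"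
  unfolding linear_functional_def by (simp add: sum.distrib sum_distrib_left)

lemma linear_functional_coord: "linear_functional (\<lambda>x. x i)"
  unfolding linear_functional_def by simp

text \<open>An implication between exact linear equations becomes an estimate: if \<open>\<phi>\<close> vanishes wherever
  the \<open>L a\<close> do, then \<open>\<bar>\<phi> x\<bar>\<close> is at most a constant times the largest \<open>\<bar>L a x\<bar>\<close>, with no bound on \<open>x\<close>.
  By induction: a vector on which only the last functional does not vanish allows to
  subtract from \<open>\<phi>\<close> the right multiple of that functional.\<close>

lemma functional_in_span_if_kernel_subset:
  assumes "finite A"
    and "\<And>a. a \<in> A \<Longrightarrow> linear_functional (L a)"
    and "linear_functional \<phi>"
    and "\<And>x. (\<And>a. a \<in> A \<Longrightarrow> L a x = 0) \<Longrightarrow> \<phi> x = 0"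
  shows "\<exists>\<alpha>. \<forall>x. \<phi> x = (\<Sum>a\<in>A. \<alpha> a * L a x)"
  using assms
proof (induction A arbitrary: \<phi> rule: finite_induct)
  case empty
  then show ?case by simp
next
  case (insert b A)
  have b: "linear_functional (L b)" using insert.prems(1) by simp
  show ?case
  proof (cases "\<forall>z. (\<forall>a\<in>A. L a z = 0) \<longrightarrow> L b z = 0")
    case True
    have "\<exists>\<alpha>. \<forall>x. \<phi> x = (\<Sum>a\<in>A. \<alpha> a * L a x)"
      using insert.prems True by (intro insert.IH) auto
    then obtain \<alpha> where \<alpha>: "\<And>x. \<phi> x = (\<Sum>a\<in>A. \<alpha> a * L a x)" by auto
    have "(\<Sum>a\<in>insert b A. (\<alpha>(b := 0)) a * L a x) = (\<Sum>a\<in>A. \<alpha> a * L a x)" for x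
      using insert.hyps by (auto intro!: sum.cong)
    then show ?thesis using \<alpha> by (intro exI[of _ "\<alpha>(b := 0)"]) simp
  next
    case False
    then obtain z where z: "\<And>a. a \<in> A \<Longrightarrow> L a z = 0" "L b z \<noteq> 0" by auto
    let ?r = "\<phi> z / L b z"
    have "\<exists>\<alpha>. \<forall>x. \<phi> x + (- ?r) * L b x = (\<Sum>a\<in>A. \<alpha> a * L a x)"
    proof (rule insert.IH)
      show "linear_functional (\<lambda>x. \<phi> x + (- ?r) * L b x)"
        using insert.prems(2) b by (rule linear_functional_add_mult)
      fix x assume x: "\<And>a. a \<in> A \<Longrightarrow> L a x = 0"
      \<comment> \<open>Subtracting the right multiple of \<open>z\<close> moves \<open>x\<close> into the kernel of \<open>L b\<close> as well.\<close>
      let ?y = "\<lambda>i. x i + (- (L b x / L b z)) * z i"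
      have "\<phi> ?y = 0"
      proof (rule insert.prems(3))
        fix a assume "a \<in> insert b A"
        then have "linear_functional (L a)" and a: "a = b \<or> a \<in> A" using insert.prems(1) by auto
        then have "L a ?y = L a x + (- (L b x / L b z)) * L a z" by (intro linear_functionalD)
        then show "L a ?y = 0" using a x z by auto
      qed
      then show "\<phi> x + (- ?r) * L b x = 0"
        using linear_functionalD[OF insert.prems(2), of x "- (L b x / L b z)" z] by simp
    qed (use insert.prems(1) in auto)
    then obtain \<alpha> where \<alpha>: "\<And>x. \<phi> x + (- ?r) * L b x = (\<Sum>a\<in>A. \<alpha> a * L a x)" by auto
    have sum: "(\<Sum>a\<in>insert b A. (\<alpha>(b := ?r)) a * L a x) = ?r * L b x + (\<Sum>a\<in>A. \<alpha> a * L a x)" for x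
      using insert.hyps by (auto intro!: sum.cong)
    have "\<phi> x = ?r * L b x + (\<Sum>a\<in>A. \<alpha> a * L a x)" for x
      using \<alpha>[of x] by linarith
    from trans[OF this sum[symmetric]] show ?thesis by blast
  qed
qed


section \<open>Parity of polynomials\<close>

text \<open>Only the residue of \<open>r\<close> modulo 2 matters.  As \<open>r\<close> is a number, the degree of a Legendre
  polynomial can serve as its parity, and differentiation simply increases \<open>r\<close>.\<close>

definition has_parity :: "nat \<Rightarrow> real poly \<Rightarrow> bool" where
  "has_parity r p \<longleftrightarrow> (\<forall>n. coeff p n \<noteq> 0 \<longrightarrow> even (n + r))"

lemma higher_pderiv_diff: "(pderiv ^^ n) (p - q) = (pderiv ^^ n) p - (pderiv ^^ n) q" for p q :: "real poly"
  by (induction n) (simp_all add: pderiv_diff)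

lemma has_parity_cong: "has_parity r p \<Longrightarrow> even (r + s) \<Longrightarrow> has_parity s p"
  unfolding has_parity_def by auto

lemma has_parity_add: "has_parity r p \<Longrightarrow> has_parity r q \<Longrightarrow> has_parity r (p + q)"
  unfolding has_parity_def by (metis add.right_neutral coeff_add)

lemma has_parity_smult: "has_parity r p \<Longrightarrow> has_parity r (smult c p)"
  unfolding has_parity_def by auto

lemma has_parity_sum: "(\<And>a. a \<in> A \<Longrightarrow> has_parity r (f a)) \<Longrightarrow> has_parity r (sum f A)"
  by (induction A rule: infinite_finite_induct)
    (auto intro: has_parity_add simp: has_parity_def[of _ 0])

lemma has_parity_mult:
  assumes "has_parity r p" "has_parity s q"
  shows "has_parity (r + s) (p * q)"
  unfolding has_parity_def
proof (intro allI impI)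
  fix n assume "coeff (p * q) n \<noteq> 0"
  then obtain i where i: "i \<le> n" "coeff p i * coeff q (n - i) \<noteq> 0"
    unfolding coeff_mult by (metis (no_types, lifting) atMost_iff sum.neutral)
  then have "even (i + r)" "even (n - i + s)" using assms by (auto simp: has_parity_def)
  then have "even ((i + r) + (n - i + s))" by simp
  also have "(i + r) + (n - i + s) = n + (r + s)" using i(1) by simp
  finally show "even (n + (r + s))" .
qed

lemma has_parity_pderiv: "has_parity r p \<Longrightarrow> has_parity (Suc r) (pderiv p)"
  unfolding has_parity_def by (auto simp: coeff_pderiv)

lemma has_parity_higher_pderiv: "has_parity r p \<Longrightarrow> has_parity (r + l) ((pderiv ^^ l) p)"
  by (induction l) (auto dest: has_parity_pderiv)

lemma poly_uminus_if_parity: "has_parity r p \<Longrightarrow> poly p (- t) = (- 1) ^ r * poly p t"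
proof -
  assume p: "has_parity r p"
  have "coeff p n * (- t) ^ n = (- 1) ^ r * (coeff p n * t ^ n)" for n
  proof (cases "coeff p n = 0")
    case False
    then have "even (n + r)" using p by (auto simp: has_parity_def)
    then have "(- 1 :: real) ^ n = (- 1) ^ r" by (cases "even n") auto
    then show ?thesis by (simp add: power_minus[of t])
  qed simp
  then show ?thesis unfolding poly_altdef sum_distrib_left by (intro sum.cong refl)
qed

text \<open>If all coefficients of \<open>p\<close> beyond the \<open>n\<close>-th vanish, then \<open>D\<^bsup>n-1\<^esup> p\<close> is linear, and by parity
  it has no constant term: its value at 1 sees the \<open>n\<close>-th coefficient alone.  So the
  coefficients of a polynomial of given parity can be recovered one by one, from the top, from
  derivatives at 1.\<close>

lemma coeffs_eq_0_if_derivs_at_1_eq_0: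
  assumes p: "has_parity r p"
    and D: "\<And>n. n \<ge> 1 \<Longrightarrow> n \<le> degree p \<Longrightarrow> even (n + r) \<Longrightarrow> poly ((pderiv ^^ (n - 1)) p) 1 = 0"
  shows "degree p = 0"
proof (rule ccontr)
  let ?n = "degree p"
  assume n: "?n \<noteq> 0"
  then have lead: "coeff p ?n \<noteq> 0" by auto
  then have even: "even (?n + r)" using p by (auto simp: has_parity_def)
  have "odd (?n - 1 + r)" using even n by (cases ?n) auto
  then have 0: "coeff p (?n - 1) = 0" using p by (auto simp: has_parity_def)
  let ?q = "(pderiv ^^ (?n - 1)) p"
  have "degree ?q = 1" using n by (simp add: degree_higher_pderiv)
  then have "poly ?q 1 = coeff ?q 0 + coeff ?q 1"
    by (simp add: poly_altdef)
  also have "\<dots> = pochhammer 2 (?n - 1) * coeff p ?n"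
    using n 0 by (simp add: coeff_higher_pderiv)
  also have "\<dots> \<noteq> 0" using lead by (simp add: pochhammer_eq_0_iff)
  finally show False using D[of ?n] n even by auto
qed


section \<open>Legendre polynomials\<close>

definition defint :: "real poly \<Rightarrow> real" where
  "defint p = integral {-1..1} (poly p)"

lemma poly_integrable: "poly p integrable_on {a..b}" for p :: "real poly"
  by (intro integrable_continuous_real continuous_intros)

lemma defint_add: "defint (p + q) = defint p + defint q"
  unfolding defint_def poly_add by (intro integral_add poly_integrable)

lemma defint_smult: "defint (smult c p) = c * defint p"
  unfolding defint_def poly_smult by (rule integral_mult_right)

lemma defint_const: "defint [:c:] = 2 * c"
proof -
  have "poly [:c:] = (\<lambda>_. c)" by auto
  then show ?thesis by (simp add: defint_def)
qed

lemma defint_0 [simp]: "defint 0 = 0"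
  using defint_const[of 0] by simp

lemma defint_sum: "defint (sum f A) = (\<Sum>a\<in>A. defint (f a))"
  by (induction A rule: infinite_finite_induct) (auto simp: defint_add defint_0)

lemma defint_pderiv: "defint (pderiv p) = poly p 1 - poly p (-1)"
proof -
  have "(poly (pderiv p) has_integral poly p 1 - poly p (-1)) {-1..1}"
    by (intro fundamental_theorem_of_calculus)
      (auto intro!: DERIV_subset[OF poly_DERIV] simp flip: has_real_derivative_iff_has_vector_derivative)
  then show ?thesis by (simp add: defint_def integral_unique)
qed

lemma legendre_parity: "has_parity j (legendre j)"
proof -
  have "has_parity 0 ([:-1, 0, 1:] ^ j)"
  proof (induction j)
    case 0
    then show ?case by (simp add: has_parity_def)
  next
    case (Suc j)
    have "has_parity 0 [:-1, 0, 1:]"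
      by (auto simp: has_parity_def coeff_pCons split: nat.splits)
    from has_parity_mult[OF this Suc] show ?case by simp
  qed
  from has_parity_higher_pderiv[OF this, of j] show ?thesis
    unfolding legendre_def by (intro has_parity_smult) simp
qed

lemma pderiv_linear_power_mult:
  "pderiv ([:- a, 1:] ^ Suc j * q) = [:- a, 1:] ^ j * (smult (real (Suc j)) q + [:- a, 1:] * pderiv q)"
  by (simp add: pderiv_mult pderiv_power_Suc pderiv_pCons algebra_simps del: power_Suc)
    (simp add: algebra_simps)

lemma higher_pderiv_at_root:
  "l < j \<Longrightarrow> poly ((pderiv ^^ l) ([:- a, 1:] ^ j * q)) a = 0" for a :: real
proof (induction j arbitrary: q l)
  case (Suc j)
  show ?case
  proof (cases l)
    case 0
    then show ?thesis by simp
  next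
    case (Suc l')
    then show ?thesis
      using Suc.IH[of l'] Suc.prems
      by (simp del: funpow.simps power_Suc add: funpow_Suc_right pderiv_linear_power_mult)
  qed
qed simp

lemma higher_pderiv_at_root_eq:
  "poly ((pderiv ^^ j) ([:- a, 1:] ^ j * q)) a = fact j * poly q a" for a :: real
proof (induction j arbitrary: q)
  case (Suc j)
  have "poly ((pderiv ^^ Suc j) ([:- a, 1:] ^ Suc j * q)) a
      = poly ((pderiv ^^ j) ([:- a, 1:] ^ j * (smult (real (Suc j)) q + [:- a, 1:] * pderiv q))) a"
    by (simp only: funpow_Suc_right o_apply pderiv_linear_power_mult)
  also have "\<dots> = fact (Suc j) * poly q a"
    by (simp only: Suc.IH) (simp add: algebra_simps)
  finally show ?case .
qed simp

lemma rodrigues_factor: "[:-1, 0, 1:] = [:- 1, 1:] * [:- (- 1), 1 :: real:]"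
  by simp

lemma legendre_at_1 [simp]: "poly (legendre j) 1 = 1"
proof -
  have "poly ((pderiv ^^ j) ([:- 1, 1:] ^ j * [:- (- 1), 1:] ^ j)) 1 = fact j * poly ([:- (- 1), 1:] ^ j) (1 :: real)"
    by (rule higher_pderiv_at_root_eq)
  then show ?thesis
    unfolding legendre_def rodrigues_factor power_mult_distrib by simp
qed

lemma legendre_at_minus_1: "poly (legendre j) (- 1) = (- 1) ^ j"
  using poly_uminus_if_parity[OF legendre_parity, of j 1] by simp

lemma defint_by_parts:
  assumes "\<And>l. l < j \<Longrightarrow> poly ((pderiv ^^ l) f) 1 = 0 \<and> poly ((pderiv ^^ l) f) (- 1) = 0"
  shows "defint (p * (pderiv ^^ j) f) = (- 1) ^ j * defint ((pderiv ^^ j) p * f)"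
  using assms
proof (induction j arbitrary: p)
  case (Suc j)
  let ?g = "(pderiv ^^ j) f"
  have "defint (pderiv (p * ?g)) = 0"
    using Suc.prems[of j] by (subst defint_pderiv) simp
  then have "defint (p * pderiv ?g) = - defint (pderiv p * ?g)"
    by (simp add: pderiv_mult defint_add mult.commute)
  also have "\<dots> = (- 1) ^ Suc j * defint ((pderiv ^^ Suc j) p * f)"
    using Suc by (simp del: funpow.simps add: funpow_Suc_right)
  finally show ?case by simp
qed simp

lemma legendre_orthogonal_lower_degree:
  assumes "degree p < j"
  shows "defint (p * legendre j) = 0"
proof -
  let ?f = "[:-1, 0, 1:] ^ j :: real poly"
  have "poly ((pderiv ^^ l) ?f) 1 = 0 \<and> poly ((pderiv ^^ l) ?f) (- 1) = 0" if "l < j" for l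
    using higher_pderiv_at_root[OF that, of 1 "[:- (- 1), 1:] ^ j"]
      higher_pderiv_at_root[OF that, of "- 1" "[:- 1, 1:] ^ j"]
    unfolding rodrigues_factor power_mult_distrib by (simp add: mult.commute)
  then have "defint (p * (pderiv ^^ j) ?f) = (- 1) ^ j * defint ((pderiv ^^ j) p * ?f)"
    by (rule defint_by_parts)
  also have "(pderiv ^^ j) p = 0"
  proof (rule poly_eqI)
    show "coeff ((pderiv ^^ j) p) n = coeff 0 n" for n
      using assms by (simp add: coeff_higher_pderiv coeff_eq_0)
  qed
  finally show ?thesis
    by (simp add: legendre_def defint_smult)
qed

lemma legendre_orthogonal: "i \<noteq> j \<Longrightarrow> defint (legendre i * legendre j) = 0"
  using legendre_orthogonal_lower_degree[of "legendre i" j]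
    legendre_orthogonal_lower_degree[of "legendre j" i]
  by (cases "i < j") (auto simp: mult.commute)

text \<open>Integrating the derivative of \<open>t L\<^sub>j\<^sup>2\<close> gives \<open>2 = \<integral> L\<^sub>j\<^sup>2 + 2 \<integral> t L\<^sub>j' L\<^sub>j\<close>; and \<open>t L\<^sub>j' - j L\<^sub>j\<close> has
  degree less than \<open>j\<close>, so that it is orthogonal to \<open>L\<^sub>j\<close>.\<close>

lemma legendre_norm: "defint (legendre j * legendre j) = 2 / (2 * real j + 1)"
proof -
  let ?L = "legendre j" and ?X = "[:0, 1:] :: real poly"
  let ?r = "?X * pderiv ?L - smult (real j) ?L"
  have coeff_r: "coeff ?r n = (real n - real j) * coeff ?L n" for n
    by (cases n) (auto simp: coeff_pderiv algebra_simps)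
  have "defint (?r * ?L) = 0"
  proof (cases "?r = 0")
    case True
    then show ?thesis by simp
  next
    case False
    then have lead: "coeff ?r (degree ?r) \<noteq> 0" by (rule leading_coeff_neq_0)
    then have "degree ?r \<noteq> j" "coeff ?L (degree ?r) \<noteq> 0" unfolding coeff_r by auto
    then have "degree ?r < j" using le_degree[of ?L "degree ?r"] by simp
    then show ?thesis by (rule legendre_orthogonal_lower_degree)
  qed
  moreover have "defint (pderiv (?X * ?L * ?L)) = 2"
    by (subst defint_pderiv) (simp add: legendre_at_minus_1 flip: power_mult_distrib)
  moreover have "pderiv (?X * ?L * ?L) = smult (2 * real j + 1) (?L * ?L) + smult 2 (?r * ?L)"
    by (rule poly_ext) (simp add: pderiv_mult pderiv_pCons algebra_simps)
  ultimately have "(2 * real j + 1) * defint (?L * ?L) = 2"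
    by (simp only: defint_add defint_smult)
  moreover have "2 * real j + 1 \<noteq> 0" by linarith
  ultimately show ?thesis by (metis nonzero_mult_div_cancel_left)
qed

definition legendre_sum :: "nat \<Rightarrow> (nat \<Rightarrow> real) \<Rightarrow> real poly" where
  "legendre_sum n y = (\<Sum>j\<le>n. smult (y j) (legendre j))"

lemma defint_legendre_sum_mult:
  assumes "finite A" "i \<in> A"
  shows "defint ((\<Sum>j\<in>A. smult (y j) (legendre j)) * legendre i) = 2 / (2 * real i + 1) * y i"
proof -
  have "defint ((\<Sum>j\<in>A. smult (y j) (legendre j)) * legendre i)
      = (\<Sum>j\<in>A. y j * defint (legendre j * legendre i))"
    by (simp add: sum_distrib_right defint_sum defint_smult)
  also have "\<dots> = y i * defint (legendre i * legendre i)"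
    using assms by (subst sum.remove[of _ i]) (auto simp: legendre_orthogonal intro!: sum.neutral)
  finally show ?thesis by (simp add: legendre_norm)
qed

lemma legendre_expansion:
  "degree p \<le> n \<Longrightarrow> \<exists>y. p = legendre_sum n y"
proof (induction n arbitrary: p)
  case 0
  then obtain c where "p = [:c:]" by (meson degree_eq_zeroE le_zero_eq)
  then show ?case by (intro exI[of _ "\<lambda>_. c"]) (simp add: legendre_sum_def legendre_def)
next
  case (Suc n)
  let ?c = "coeff p (Suc n) / coeff (legendre (Suc n)) (Suc n)"
  let ?q = "p - smult ?c (legendre (Suc n))"
  have lead: "coeff (legendre (Suc n)) (Suc n) \<noteq> 0"
    using legendre_nonzero[of "Suc n"] degree_legendre[of "Suc n"] by (metis leading_coeff_0_iff)
  have "degree ?q \<le> n"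
  proof (rule degree_le, intro allI impI)
    fix i assume "n < i"
    then show "coeff ?q i = 0"
      using lead Suc.prems by (cases "i = Suc n") (auto simp: coeff_eq_0)
  qed
  then obtain y where "?q = legendre_sum n y" using Suc.IH by blast
  then have "p = legendre_sum n y + smult ?c (legendre (Suc n))" by (simp add: algebra_simps)
  then show ?case
    by (intro exI[of _ "y(Suc n := ?c)"]) (simp add: legendre_sum_def)
qed

text \<open>With \<open>w = t\<^sup>2 - 1\<close>, the second derivative of \<open>w\<^bsup>j+1\<^esup>\<close> is a combination of \<open>w\<^sup>j\<close> and
  \<open>w\<^bsup>j-1\<^esup>\<close>, since the factor \<open>t\<^sup>2\<close> that it contains equals \<open>w + 1\<close>.  Differentiated \<open>j\<close> more times, the
  two terms are \<open>L\<^sub>j\<close> and \<open>L\<^bsub>j-1\<^esub>'\<close> by Rodrigues' formula.\<close>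

lemma legendre_derivative_identity:
  assumes "j \<ge> 1"
  shows "pderiv (legendre (j + 1)) - pderiv (legendre (j - 1)) = smult (2 * real j + 1) (legendre j)"
proof -
  obtain i where j: "j = Suc i" using assms by (cases j) auto
  let ?w = "[:-1, 0, 1:] :: real poly"
  have *: "pderiv (pderiv (?w ^ Suc (Suc i)))
      = smult (2 * (real i + 2) * (2 * real i + 3)) (?w ^ Suc i) + smult (4 * (real i + 1) * (real i + 2)) (?w ^ i)"
    by (rule poly_ext)
      (simp add: pderiv_power_Suc pderiv_mult pderiv_smult pderiv_pCons del: power_Suc,
        simp add: algebra_simps)
  have f: "fact (Suc (Suc i)) = (real i + 2) * (real i + 1) * fact i" "fact (Suc i) = (real i + 1) * fact i"
    by (simp_all add: algebra_simps)
  have "pderiv (legendre (Suc (Suc i)))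
      = smult (1 / (2 ^ Suc (Suc i) * fact (Suc (Suc i)))) ((pderiv ^^ Suc i) (pderiv (pderiv (?w ^ Suc (Suc i)))))"
    unfolding legendre_def pderiv_smult by (simp only: funpow_swap1 funpow.simps o_apply)
  also have "\<dots> = smult ((2 * real i + 3) / (2 ^ Suc i * fact (Suc i))) ((pderiv ^^ Suc i) (?w ^ Suc i))
      + smult (1 / (2 ^ i * fact i)) (pderiv ((pderiv ^^ i) (?w ^ i)))"
    unfolding * higher_pderiv_add higher_pderiv_smult smult_add_right smult_smult f
    by (intro arg_cong2[of _ _ _ _ "(+)"] arg_cong2[of _ _ _ _ smult])
      (simp_all add: divide_simps add_nonneg_eq_0_iff, simp_all add: algebra_simps)
  also have "\<dots> = smult (2 * real j + 1) (legendre j) + pderiv (legendre (j - 1))"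
    by (simp add: legendre_def pderiv_smult j algebra_simps)
  finally show ?thesis by (simp add: j)
qed


lemma finite_U [simp]: "finite (\<U> k)"
  by (rule finite_subset[of _ "{..k + 1}"]) (auto simp: \<U>_def)

lemma U_sum_parity: "has_parity (k + 1) (\<Sum>j\<in>\<U> k - {0}. smult (y j) (legendre j))"
proof (intro has_parity_sum has_parity_smult)
  fix j assume "j \<in> \<U> k - {0}"
  then show "has_parity (k + 1) (legendre j)"
    by (intro has_parity_cong[OF legendre_parity]) (auto simp: mem_U_iff)
qed


section \<open>The iterates of \<open>\<F>\<close>\<close>

lemma pderiv_calF_legendre:
  assumes "j \<ge> 1"
  shows "pderiv (calF (legendre j)) = legendre j"
proof (cases "j = 1")
  case True
  have "pderiv (legendre 0) = 0" by (simp add: pderiv_eq_0_iff)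
  then have "pderiv (legendre 2) = smult 3 (legendre 1)"
    using legendre_derivative_identity[of 1] by (simp add: numeral_2_eq_2)
  then show ?thesis unfolding True calF_legendre_1 pderiv_smult by simp
next
  case False
  then have "pderiv (calF (legendre j)) = smult (1 / (2 * real j + 1)) (smult (2 * real j + 1) (legendre j))"
    using assms legendre_derivative_identity[of j]
    by (simp only: calF_legendre pderiv_smult pderiv_diff)
  then show ?thesis by (simp add: add_nonneg_eq_0_iff)
qed

abbreviation (input) calF_iterate :: "nat \<Rightarrow> real poly" where
  "calF_iterate k \<equiv> (calF ^^ k) (legendre 1)"

text \<open>\<open>\<F>\<close> is a right inverse of differentiation on the span of the \<open>L\<^sub>j\<close>, \<open>j \<ge> 1\<close>, and its values
  again have mean zero.\<close>

lemma pderiv_calF_iterate: "pderiv (calF_iterate (Suc k)) = calF_iterate k"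
proof -
  interpret F: Vector_Spaces.linear smult smult calF by (rule linear_calF)
  obtain \<gamma> where *: "calF_iterate k = (\<Sum>j\<in>\<U> k - {0}. smult (\<gamma> j) (legendre j))"
    using calF_iterate_expansion[of k] by blast
  have "pderiv (calF_iterate (Suc k)) = (\<Sum>j\<in>\<U> k - {0}. smult (\<gamma> j) (pderiv (calF (legendre j))))"
    by (simp only: funpow.simps o_apply * F.sum F.scale)
      (simp add: pderiv_smult higher_pderiv_sum[of 1, simplified])
  also have "\<dots> = calF_iterate k"
    unfolding * by (intro sum.cong refl arg_cong[where f = "smult _"] pderiv_calF_legendre) auto
  finally show ?thesis .
qed

lemma higher_pderiv_calF_iterate: "(pderiv ^^ l) (calF_iterate (l + k)) = calF_iterate k"
proof (induction l)
  case (Suc l)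
  have "(pderiv ^^ Suc l) (calF_iterate (Suc l + k)) = (pderiv ^^ l) (pderiv (calF_iterate (Suc (l + k))))"
    by (simp only: funpow_Suc_right o_apply add_Suc)
  also have "\<dots> = calF_iterate k" by (simp only: pderiv_calF_iterate Suc)
  finally show ?case .
qed simp

lemma defint_calF_iterate: "defint (calF_iterate k) = 0"
proof -
  obtain \<gamma> where *: "calF_iterate k = (\<Sum>j\<in>\<U> k - {0}. smult (\<gamma> j) (legendre j))"
    using calF_iterate_expansion[of k] by blast
  have "defint (legendre j) = 0" if "j \<in> \<U> k - {0}" for j
    using legendre_orthogonal_lower_degree[of 1 j] that by auto
  then show ?thesis unfolding * defint_sum defint_smult by (intro sum.neutral) auto
qed

lemma calF_iterate_parity: "has_parity (k + 1) (calF_iterate k)"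
proof -
  obtain \<gamma> where *: "calF_iterate k = (\<Sum>j\<in>\<U> k - {0}. smult (\<gamma> j) (legendre j))"
    using calF_iterate_expansion[of k] by blast
  show ?thesis unfolding * by (rule U_sum_parity)
qed

text \<open>The difference of the end values of \<open>F\<^sub>k\<^sup>(\<^sup>l\<^sup>)\<close> is the integral of \<open>F\<^bsub>k-l-1\<^esub>\<close>, which is zero.
  If the derivative is an odd function, its equal end values are also opposite.\<close>

lemma calF_iterate_derivs_at_1:
  assumes "l < k" "even (k + l)"
  shows "poly ((pderiv ^^ l) (calF_iterate k)) 1 = 0"
proof -
  obtain r where k: "k = l + Suc r" using assms(1) less_iff_Suc_add by auto
  have eq: "(pderiv ^^ l) (calF_iterate k) = calF_iterate (Suc r)"
    unfolding k by (rule higher_pderiv_calF_iterate)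
  have "poly (calF_iterate (Suc r)) 1 = poly (calF_iterate (Suc r)) (- 1)"
    using defint_pderiv[of "calF_iterate (Suc r)"] unfolding pderiv_calF_iterate defint_calF_iterate by simp
  moreover have "odd (Suc r + 1)" using assms(2) k by auto
  ultimately show ?thesis
    unfolding eq using poly_uminus_if_parity[OF calF_iterate_parity, of "Suc r" 1] by simp
qed

lemma coeff_U_sum_top:
  "coeff (\<Sum>j\<in>\<U> k - {0}. smult (y j) (legendre j)) (k + 1) = y (k + 1) * coeff (legendre (k + 1)) (k + 1)"
proof -
  have "coeff (legendre j) (k + 1) = 0" if "j \<in> \<U> k - {0} - {k + 1}" for j
    using that by (intro coeff_eq_0) (auto simp: \<U>_def)
  moreover have "k + 1 \<in> \<U> k - {0}" by (auto simp: \<U>_def)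
  ultimately show ?thesis
    unfolding coeff_sum by (subst sum.remove[of _ "k + 1"]) (simp_all add: sum.neutral)
qed

lemma calF_iterate_top_coeff_nonzero:
  assumes "calF_iterate k = (\<Sum>j\<in>\<U> k - {0}. smult (\<gamma> j) (legendre j))"
  shows "\<gamma> (k + 1) \<noteq> 0"
proof
  assume "\<gamma> (k + 1) = 0"
  then have "coeff (calF_iterate k) (k + 1) = 0" unfolding assms coeff_U_sum_top by simp
  then have "coeff ((pderiv ^^ k) (calF_iterate k)) 1 = 0" by (simp add: coeff_higher_pderiv)
  then have "coeff (legendre 1) 1 = 0" using higher_pderiv_calF_iterate[of k 0] by simp
  then show False using degree_legendre[of 1] legendre_nonzero[of 1] by (metis leading_coeff_0_iff)
qed

text \<open>Subtracting the multiple of \<open>F\<^sub>k\<close> with the same leading coefficient leaves a polynomial of degree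
  at most \<open>k\<close> to which \<open>coeffs_eq_0_if_derivs_at_1_eq_0\<close> applies.  What remains is a constant, to which
  the \<open>L\<^sub>j\<close> with \<open>j \<ge> 1\<close> are orthogonal.\<close>

lemma proportional_to_calF_iterate:
  fixes y \<gamma> :: "nat \<Rightarrow> real" and k :: nat
  defines "E \<equiv> \<Sum>j\<in>\<U> k - {0}. smult (y j) (legendre j)"
  assumes F: "calF_iterate k = (\<Sum>j\<in>\<U> k - {0}. smult (\<gamma> j) (legendre j))"
    and E: "\<And>l. l < k \<Longrightarrow> even (k + l) \<Longrightarrow> poly ((pderiv ^^ l) E) 1 = 0"
    and j: "j \<in> \<U> k - {0}"
  shows "y j = \<gamma> j / \<gamma> (k + 1) * y (k + 1)"
proof -
  let ?r = "y (k + 1) / \<gamma> (k + 1)"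
  define G where "G = (\<Sum>j\<in>\<U> k - {0}. smult (y j - ?r * \<gamma> j) (legendre j))"
  have G: "G = E - smult ?r (calF_iterate k)"
    unfolding F G_def E_def by (simp add: poly_vs.vs1.scale_sum_right sum_subtractf smult_diff_left)
  have "coeff G i = 0" if "k < i" for i
  proof (cases "i = k + 1")
    case True
    then show ?thesis
      unfolding G_def using coeff_U_sum_top[of "\<lambda>j. y j - ?r * \<gamma> j" k] calF_iterate_top_coeff_nonzero[OF F] by simp
  next
    case False
    then show ?thesis
      using that unfolding G_def by (auto simp: coeff_sum \<U>_def intro!: sum.neutral coeff_eq_0)
  qed
  then have deg: "degree G \<le> k" by (intro degree_le) auto
  have "degree G = 0"
  proof (rule coeffs_eq_0_if_derivs_at_1_eq_0)
    show "has_parity (k + 1) G" unfolding G_def by (rule U_sum_parity)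
    fix n assume n: "n \<ge> 1" "n \<le> degree G" "even (n + (k + 1))"
    then have "n - 1 < k" "even (k + (n - 1))" using deg by (cases n; simp)+
    then show "poly ((pderiv ^^ (n - 1)) G) 1 = 0"
      unfolding G using E[of "n - 1"] calF_iterate_derivs_at_1[of "n - 1" k]
      by (simp add: higher_pderiv_diff higher_pderiv_smult)
  qed
  then have "defint (G * legendre j) = 0"
    using j by (intro legendre_orthogonal_lower_degree) auto
  moreover have "defint (G * legendre j) = 2 / (2 * real j + 1) * (y j - ?r * \<gamma> j)"
    unfolding G_def using j by (intro defint_legendre_sum_mult) auto
  ultimately have "y j - ?r * \<gamma> j = 0" by (simp add: add_nonneg_eq_0_iff)
  then show ?thesis by simp
qed


section \<open>Truncated powers and B-splines\<close>

definition nabla :: "(real \<Rightarrow> real) \<Rightarrow> real \<Rightarrow> real" where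
  "nabla f x = f x - f (x - 1)"

text \<open>The \<open>c r\<close> are the signed binomial coefficients.\<close>

lemma nabla_iterate_eq_sum: "\<exists>c. \<forall>f x. (nabla ^^ k) f x = (\<Sum>r\<le>k. c r * f (x - real r))"
proof (induction k)
  case 0
  show ?case by (intro exI[of _ "\<lambda>_. 1"]) simp
next
  case (Suc k)
  then obtain c where c: "\<And>f x. (nabla ^^ k) f x = (\<Sum>r\<le>k. c r * f (x - real r))" by auto
  let ?c = "\<lambda>r. (if r \<le> k then c r else 0) - (case r of 0 \<Rightarrow> 0 | Suc r \<Rightarrow> c r)"
  have "(nabla ^^ Suc k) f x = (\<Sum>r\<le>Suc k. ?c r * f (x - real r))" for f x
  proof -
    have "(\<Sum>r\<le>Suc k. (if r \<le> k then c r else 0) * f (x - real r)) = (\<Sum>r\<le>k. c r * f (x - real r))"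
      by simp
    moreover have "(\<Sum>r\<le>Suc k. (case r of 0 \<Rightarrow> 0 | Suc r \<Rightarrow> c r) * f (x - real r))
        = (\<Sum>r\<le>k. c r * f (x - 1 - real r))"
      unfolding sum.atMost_Suc_shift by (simp add: algebra_simps)
    moreover have "(nabla ^^ Suc k) f x = (\<Sum>r\<le>k. c r * f (x - real r)) - (\<Sum>r\<le>k. c r * f (x - 1 - real r))"
      by (simp add: nabla_def c)
    ultimately show ?thesis by (simp only: left_diff_distrib sum_subtractf)
  qed
  then show ?case by (intro exI[of _ ?c]) simp
qed

lemma nabla_iterate_cong:
  assumes "\<And>y. x - real k \<le> y \<Longrightarrow> y \<le> x \<Longrightarrow> f y = g y"
  shows "(nabla ^^ k) f x = (nabla ^^ k) g x"
proof -
  obtain c where "\<And>f x. (nabla ^^ k) f x = (\<Sum>r\<le>k. c r * f (x - real r))"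
    using nabla_iterate_eq_sum by blast
  then show ?thesis using assms by (auto intro!: sum.cong)
qed

lemma nabla_iterate_const_0: "(nabla ^^ k) (\<lambda>_. 0) x = 0"
  using nabla_iterate_eq_sum[of k] by fastforce

text \<open>By induction on the degree, writing \<open>p(t) = a + t q(t)\<close>, so that
  \<open>p(t) - p(t - 1) = t (q(t) - q(t - 1)) + q(t - 1)\<close>.\<close>

lemma difference_poly:
  fixes p :: "real poly"
  assumes "degree p \<le> Suc n"
  shows "degree (p - pcompose p [:-1, 1:]) \<le> n \<and>
    coeff (p - pcompose p [:-1, 1:]) n = real (Suc n) * coeff p (Suc n)"
  using assms
proof (induction n arbitrary: p)
  case 0
  obtain a q where "p = pCons a q" by (cases p)
  moreover from this 0 have "degree q = 0" by (cases "q = 0") auto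
  then obtain b where "q = [:b:]" by (elim degree_eq_zeroE)
  ultimately have p: "p = [:a, b:]" by simp
  then show ?case by (simp add: pcompose_pCons)
next
  case (Suc n)
  obtain a q where p: "p = pCons a q" by (cases p)
  have q: "degree q \<le> Suc n"
    using Suc.prems unfolding p by (cases "q = 0") auto
  let ?d = "\<lambda>p. p - pcompose p [:-1, 1 :: real:]"
  have IH: "degree (?d q) \<le> n" "coeff (?d q) n = real (Suc n) * coeff q (Suc n)"
    using Suc.IH[OF q] by auto
  have eq: "?d p = pCons 0 (?d q) + (q - ?d q)"
    unfolding p by (simp add: pcompose_pCons)
  have "degree (?d p) \<le> Suc n"
    unfolding eq using IH(1) q
    by (intro degree_add_le degree_diff_le) (auto intro: order.trans[OF degree_pCons_le] simp: degree_pcompose)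
  moreover have "coeff (?d q) (Suc n) = 0" using IH(1) by (intro coeff_eq_0) auto
  moreover have "coeff (?d p) (Suc n) = coeff (?d q) n + (coeff q (Suc n) - coeff (?d q) (Suc n))"
    unfolding eq by simp
  ultimately have "degree (?d p) \<le> Suc n"
    "coeff (?d p) (Suc n) = real (Suc n) * coeff q (Suc n) + coeff q (Suc n)"
    using IH(2) by linarith+
  then show ?case by (simp add: p algebra_simps)
qed

lemma nabla_iterate_poly:
  "degree p \<le> k \<Longrightarrow> (nabla ^^ k) (poly p) x = fact k * coeff p k"
proof (induction k arbitrary: p)
  case 0
  then obtain c where "p = [:c:]" by (meson degree_eq_zeroE le_zero_eq)
  then show ?case by simp
next
  case (Suc k)
  let ?d = "p - pcompose p [:-1, 1:]"
  have "nabla (poly p) = poly ?d"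
    by (rule ext) (simp add: nabla_def poly_pcompose algebra_simps)
  then have "(nabla ^^ Suc k) (poly p) x = (nabla ^^ k) (poly ?d) x"
    by (simp only: funpow_Suc_right o_apply)
  also have "\<dots> = fact k * (real (Suc k) * coeff p (Suc k))"
    using Suc.IH[of ?d] difference_poly[OF Suc.prems] by metis
  finally show ?case by (simp add: algebra_simps)
qed

definition trunc_power :: "nat \<Rightarrow> real \<Rightarrow> real" where
  "trunc_power n x = (max 0 x) ^ n"

lemma nabla_trunc_power_left:
  assumes "n \<ge> 1" "x \<le> 0"
  shows "(nabla ^^ k) (trunc_power n) x = 0"
proof -
  have "(nabla ^^ k) (trunc_power n) x = (nabla ^^ k) (\<lambda>_. 0) x"
    using assms by (intro nabla_iterate_cong) (auto simp: trunc_power_def max_def)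
  then show ?thesis by (simp add: nabla_iterate_const_0)
qed

lemma nabla_trunc_power_right:
  assumes "n \<le> k" "x \<ge> real k"
  shows "(nabla ^^ k) (trunc_power n) x = (if n = k then fact k else 0)"
proof -
  have "(nabla ^^ k) (trunc_power n) x = (nabla ^^ k) (poly (monom 1 n)) x"
    using assms by (intro nabla_iterate_cong) (auto simp: trunc_power_def poly_monom max_def)
  also have "\<dots> = fact k * coeff (monom 1 n) k"
    using assms by (intro nabla_iterate_poly) (auto simp: degree_monom_eq)
  finally show ?thesis by simp
qed

lemma continuous_on_nabla_iterate:
  assumes "continuous_on UNIV f"
  shows "continuous_on S ((nabla ^^ k) f)"
proof -
  obtain c where c: "\<And>f x. (nabla ^^ k) f x = (\<Sum>r\<le>k. c r * f (x - real r))"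
    using nabla_iterate_eq_sum by blast
  have "continuous_on S (\<lambda>x. \<Sum>r\<le>k. c r * f (x - real r))"
    by (intro continuous_intros continuous_on_compose2[OF assms]) auto
  then show ?thesis using c by presburger
qed

definition bspline :: "nat \<Rightarrow> real \<Rightarrow> real" where
  "bspline k = (nabla ^^ k) (trunc_power (k - 1))"

lemma continuous_on_bspline: "continuous_on S (bspline k)"
  unfolding bspline_def trunc_power_def
  by (intro continuous_on_nabla_iterate continuous_intros)

lemma bspline_eq_0:
  assumes "k \<ge> 2" "x \<le> 0 \<or> x \<ge> real k"
  shows "bspline k x = 0"
  using assms nabla_trunc_power_left[of "k - 1" x k] nabla_trunc_power_right[of "k - 1" k x]
  unfolding bspline_def by auto

text \<open>As the B-spline is the backward difference of \<open>\<psi> = \<nabla>\<^bsup>k-1\<^esup> t\<^sub>+\<^bsup>k-1\<^esup>\<close>, its translates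
  telescope, and \<open>\<psi>\<close> is zero left of 0 and \<open>(k - 1)!\<close> right of \<open>k - 1\<close>.\<close>

lemma bspline_partition_of_unity:
  assumes k: "k \<ge> 2" and t: "0 \<le> t" "t \<le> 1"
  shows "(\<Sum>i<k. bspline k (real i + t)) = fact (k - 1)"
proof -
  let ?\<psi> = "(nabla ^^ (k - 1)) (trunc_power (k - 1))"
  let ?g = "\<lambda>i. ?\<psi> (real i + t - 1)"
  have "(nabla ^^ k) f = nabla ((nabla ^^ (k - 1)) f)" for f
    using k by (cases k) simp_all
  then have "(\<Sum>i<k. bspline k (real i + t)) = (\<Sum>i<k. ?g (Suc i) - ?g i)"
    by (simp add: bspline_def nabla_def algebra_simps)
  also have "\<dots> = ?g k - ?g 0" by (rule sum_lessThan_telescope)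
  also have "?g k = fact (k - 1)"
    using k t by (subst nabla_trunc_power_right) (auto simp: of_nat_diff)
  also have "?g 0 = 0"
    using k t by (subst nabla_trunc_power_left) auto
  finally show ?thesis by simp
qed


section \<open>Error patterns on a uniform mesh\<close>

text \<open>The derivative of the function that is \<open>Q i\<close>, in the local coordinate, on the \<open>i\<close>-th element is
  tested with the B-spline supported on the elements \<open>p, \<dots>, p + k - 1\<close>.  The B-spline has unit knot
  spacing, hence the argument \<open>(t + 1) / 2\<close>.  The scaling factors of derivative and integral cancel.\<close>

definition galerkin_moment :: "nat \<Rightarrow> (nat \<Rightarrow> real poly) \<Rightarrow> nat \<Rightarrow> real" where
  "galerkin_moment k Q p = (\<Sum>i<k. integral {-1..1} (\<lambda>t. poly (pderiv (Q (p + i))) t * bspline k (real i + (t + 1) / 2)))"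

lemma integrable_poly_bspline:
  "(\<lambda>t. poly p t * bspline k (real i + (t + 1) / 2)) integrable_on {a..b}"
  by (intro integrable_continuous_real continuous_intros continuous_on_compose2[OF continuous_on_bspline[of UNIV]]) auto

text \<open>Let \<open>P = E'\<close>, and \<open>R i\<close> the derivative of the part of \<open>Q i\<close> of the other parity.  The derivatives
  of \<open>P\<close> that are even functions drop out of the matching conditions, which then say that
  those derivatives of \<open>S i = R i + R (i + 1)\<close> that are odd functions vanish at 1.  So \<open>S i\<close> is a constant \<open>s i\<close>, and the
  sum of the derivatives of two neighbors is \<open>2 P + s i\<close>.  These functions match at the nodes, which
  yields all end conditions for \<open>P\<close> except that on \<open>P\<close> itself, and \<open>s (i + 1) = s i + \<delta>\<close> with \<open>\<delta>\<close>
  twice the difference of the end values of \<open>P\<close>.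

  Adding two consecutive moments gives the moment of \<open>2 P + s i\<close>.  Its values for two consecutive
  B-splines are both zero, and they differ by \<open>\<delta>\<close> times the integral of a B-spline, so \<open>\<delta> = 0\<close>.  Then \<open>2 P + s\<close> is the same on all elements, and by
  the partition of unity its moment is a multiple of its mean value.  If \<open>k\<close> is even, \<open>s = 0\<close> by
  parity, and the integral of \<open>P\<close> is the difference of the end values of \<open>E\<close>; if \<open>k\<close> is odd, \<open>E\<close> is
  an even function, and no condition on its values is required.\<close>

lemma error_pattern_proportional:
  fixes q :: "nat \<Rightarrow> nat \<Rightarrow> real" and k :: nat
  defines "Q \<equiv> \<lambda>i. legendre_sum (k + 1) (q i)"
  assumes k: "k \<ge> 2"
    and match: "\<And>i l. i \<le> k \<Longrightarrow> l < k \<Longrightarrow> poly ((pderiv ^^ l) (Q i)) 1 = poly ((pderiv ^^ l) (Q (i + 1))) (-1)"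
    and invariant: "\<And>i j. i \<le> k \<Longrightarrow> j \<in> \<U> k - {0} \<Longrightarrow> q i j = q (i + 1) j"
    and galerkin: "\<And>p. p \<le> 2 \<Longrightarrow> galerkin_moment k Q p = 0"
    and F: "calF_iterate k = (\<Sum>j\<in>\<U> k - {0}. smult (\<gamma> j) (legendre j))"
    and j: "j \<in> \<U> k - {0}"
  shows "q 0 j = \<gamma> j / \<gamma> (k + 1) * q 0 (k + 1)"
proof (rule proportional_to_calF_iterate[OF F _ j])
  define E where "E = (\<Sum>j\<in>\<U> k - {0}. smult (q 0 j) (legendre j))"
  define P where "P = pderiv E"
  let ?rest = "{..k + 1} - (\<U> k - {0})"
  define R where "R = (\<lambda>i. \<Sum>j\<in>?rest. smult (q i j) (pderiv (legendre j)))"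
  define S where "S = (\<lambda>i. R i + R (i + 1))"
  define s where "s = (\<lambda>i. coeff (S i) 0)"
  have E_parity: "has_parity (k + 1) E" unfolding E_def by (rule U_sum_parity)
  have P_parity: "has_parity k P"
    unfolding P_def by (rule has_parity_cong[OF has_parity_pderiv[OF E_parity]]) simp
  have rest: "j = 0 \<or> (j \<le> k \<and> even (j + k))" if "j \<in> ?rest" for j
    using that by (cases "j = k + 1") (auto simp: mem_U_iff)
  have R_parity: "has_parity (k + 1) (R i)" for i
    unfolding R_def
  proof (intro has_parity_sum has_parity_smult)
    fix j assume "j \<in> ?rest"
    from rest[OF this] show "has_parity (k + 1) (pderiv (legendre j))"
    proof
      assume "j = 0"
      then have "pderiv (legendre j) = 0" by (simp add: pderiv_eq_0_iff)
      then show ?thesis by (simp add: has_parity_def)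
    next
      assume "j \<le> k \<and> even (j + k)"
      then show ?thesis
        by (intro has_parity_cong[OF has_parity_pderiv[OF legendre_parity]]) auto
    qed
  qed
  have R_degree: "degree (R i) \<le> k - 1" for i
    unfolding R_def
  proof (intro degree_sum_le order.trans[OF degree_smult_le])
    fix j assume "j \<in> ?rest"
    from rest[OF this] show "degree (pderiv (legendre j)) \<le> k - 1"
      by (auto simp: degree_pderiv)
  qed auto
  have q_eq: "q i j = q 0 j" if "i \<le> k + 1" "j \<in> \<U> k - {0}" for i j
    using that(1)
  proof (induction i)
    case (Suc i)
    then show ?case using invariant[of i j] that(2) by simp
  qed simp
  have Q_deriv: "pderiv (Q i) = P + R i" if "i \<le> k + 1" for i
  proof -
    have sub: "\<U> k - {0} \<subseteq> {..k + 1}" by (auto simp: \<U>_def)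
    have "pderiv (Q i) = (\<Sum>j\<le>k + 1. smult (q i j) (pderiv (legendre j)))"
      unfolding Q_def legendre_sum_def by (simp only: higher_pderiv_sum[of 1, simplified] pderiv_smult)
    also have "\<dots> = R i + (\<Sum>j\<in>\<U> k - {0}. smult (q i j) (pderiv (legendre j)))"
      unfolding R_def by (rule sum.subset_diff[OF sub]) simp
    also have "(\<Sum>j\<in>\<U> k - {0}. smult (q i j) (pderiv (legendre j))) = P"
      unfolding P_def E_def higher_pderiv_sum[of 1, simplified] pderiv_smult
      using q_eq[OF that] by (intro sum.cong) auto
    finally show ?thesis by simp
  qed
  have deriv_match: "poly ((pderiv ^^ l) (P + R i)) 1 = poly ((pderiv ^^ l) (P + R (i + 1))) (-1)"
    if "i \<le> k" "Suc l < k" for i l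
    using match[OF that] that(1) by (simp del: funpow.simps add: funpow_Suc_right Q_deriv)
  \<comment> \<open>By parity, the matching condition of order \<open>l\<close> with \<open>k + l\<close> even involves \<open>R\<close> alone.\<close>
  have S_const: "S i = [:s i:]" if i: "i \<le> k" for i
  proof -
    have "degree (S i) = 0"
    proof (rule coeffs_eq_0_if_derivs_at_1_eq_0)
      show "has_parity (k + 1) (S i)" unfolding S_def by (intro has_parity_add R_parity)
      fix n assume n: "n \<ge> 1" "n \<le> degree (S i)" "even (n + (k + 1))"
      then obtain l where l: "n = Suc l" by (cases n) auto
      have "n \<le> k - 1"
        using n(2) R_degree unfolding S_def by (meson degree_add_le order.trans)
      with n l k have l': "Suc l < k" "even (k + l)" by auto
      have "poly ((pderiv ^^ l) P) (-1) = poly ((pderiv ^^ l) P) 1"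
        using poly_uminus_if_parity[OF has_parity_higher_pderiv[OF P_parity], of l 1] l'(2) by simp
      moreover have "poly ((pderiv ^^ l) (R (i + 1))) (-1) = - poly ((pderiv ^^ l) (R (i + 1))) 1"
        using poly_uminus_if_parity[OF has_parity_higher_pderiv[OF R_parity], of l "i + 1" 1] l'(2) by simp
      ultimately show "poly ((pderiv ^^ (n - 1)) (S i)) 1 = 0"
        using deriv_match[OF i l'(1)] by (simp add: S_def l higher_pderiv_add)
    qed
    then show ?thesis unfolding s_def by (metis degree_eq_zeroE coeff_pCons_0)
  qed
  have A: "smult 2 P + [:s i:] = (P + R i) + (P + R (i + 1))" if "i \<le> k" for i
  proof -
    have "smult 2 P = P + P" using smult_add_left[of 1 1 P] by simp
    then show ?thesis unfolding S_const[OF that, symmetric] S_def by (simp only: ac_simps)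
  qed
  have A_match: "2 * poly ((pderiv ^^ l) P) 1 + poly ((pderiv ^^ l) [:s i:]) 1
      = 2 * poly ((pderiv ^^ l) P) (-1) + poly ((pderiv ^^ l) [:s (i + 1):]) (-1)"
    if "i < k" "Suc l < k" for i l
  proof -
    have "poly ((pderiv ^^ l) (smult 2 P + [:s i:])) 1 = poly ((pderiv ^^ l) (smult 2 P + [:s (i + 1):])) (-1)"
    proof -
      have A_i: "smult 2 P + [:s i:] = (P + R i) + (P + R (i + 1))"
        and A_Suc: "smult 2 P + [:s (i + 1):] = (P + R (i + 1)) + (P + R (i + 1 + 1))"
        using A[of i] A[of "i + 1"] that by auto
      show ?thesis
        unfolding A_i A_Suc higher_pderiv_add[of _ "P + R i"] higher_pderiv_add[of _ "P + R (i + 1)"] poly_add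
        using deriv_match[of i l] deriv_match[of "i + 1" l] that by simp
    qed
    then show ?thesis by (simp add: higher_pderiv_add higher_pderiv_smult)
  qed
  define \<delta> where "\<delta> = 2 * poly P 1 - 2 * poly P (-1)"
  have s_Suc: "s (i + 1) = s i + \<delta>" if "i < k" for i
    using A_match[OF that, of 0] k by (simp add: \<delta>_def)
  let ?w = "\<lambda>i t. bspline k (real i + (t + 1) / 2)"
  have w_int: "(\<lambda>t. poly p t * ?w i t) integrable_on {-1..1}" for p i
    by (rule integrable_poly_bspline)
  have w_int': "?w i integrable_on {-1..1}" for i
    using w_int[of 1 i] by simp
  have unity: "(\<Sum>i<k. integral {-1..1} (\<lambda>t. poly p t * ?w i t)) = fact (k - 1) * defint p" for p
  proof -
    have "(\<Sum>i<k. integral {-1..1} (\<lambda>t. poly p t * ?w i t)) = integral {-1..1} (\<lambda>t. \<Sum>i<k. poly p t * ?w i t)"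
      by (rule integral_sum[symmetric]) (auto intro: w_int)
    also have "\<dots> = integral {-1..1} (\<lambda>t. poly p t * fact (k - 1))"
      using bspline_partition_of_unity[OF k]
      by (intro integral_cong) (simp flip: sum_distrib_left)
    finally show ?thesis by (simp add: defint_def)
  qed
  have moment: "(\<Sum>i<k. integral {-1..1} (\<lambda>t. poly (smult 2 P + [:s (p + i):]) t * ?w i t)) = 0" if "p \<le> 1" for p
  proof -
    have "integral {-1..1} (\<lambda>t. poly (smult 2 P + [:s (p + i):]) t * ?w i t)
        = integral {-1..1} (\<lambda>t. poly (pderiv (Q (p + i))) t * ?w i t)
        + integral {-1..1} (\<lambda>t. poly (pderiv (Q (p + 1 + i))) t * ?w i t)" if "i < k" for i
    proof -
      have "p + i \<le> k" using \<open>p \<le> 1\<close> that by simp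
      then have "smult 2 P + [:s (p + i):] = pderiv (Q (p + i)) + pderiv (Q (p + 1 + i))"
        using A[of "p + i"] by (simp only: Q_deriv) (simp add: Q_deriv)
      then show ?thesis
        by (simp only: poly_add distrib_right) (rule integral_add[OF w_int w_int])
    qed
    then have "(\<Sum>i<k. integral {-1..1} (\<lambda>t. poly (smult 2 P + [:s (p + i):]) t * ?w i t))
        = galerkin_moment k Q p + galerkin_moment k Q (p + 1)"
      by (simp add: galerkin_moment_def sum.distrib)
    then show ?thesis using galerkin[of p] galerkin[of "p + 1"] that by simp
  qed
  \<comment> \<open>Both moments vanish, and their summands differ by those of the constant \<open>\<delta>\<close>.\<close>
  have "\<delta> = 0"
  proof -
    have "integral {-1..1} (\<lambda>t. poly (smult 2 P + [:s (1 + i):]) t * ?w i t)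
        = integral {-1..1} (\<lambda>t. poly (smult 2 P + [:s (0 + i):]) t * ?w i t)
        + integral {-1..1} (\<lambda>t. poly [:\<delta>:] t * ?w i t)" if "i < k" for i
    proof -
      have "smult 2 P + [:s (1 + i):] = (smult 2 P + [:s (0 + i):]) + [:\<delta>:]"
        using s_Suc[OF that] by simp
      then show ?thesis
        by (simp only: poly_add[of _ "[:\<delta>:]"] distrib_right) (rule integral_add[OF w_int w_int])
    qed
    then have "fact (k - 1) * defint [:\<delta>:] = 0"
      using moment[of 0] moment[of 1] unfolding unity[symmetric] by (simp add: sum.distrib)
    then show ?thesis by (simp add: defint_const)
  qed
  have s_eq: "s i = s 0" if "i \<le> k" for i
    using that
  proof (induction i)
    case (Suc i)
    then show ?case using s_Suc[of i] \<open>\<delta> = 0\<close> by simp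
  qed simp
  have "(\<Sum>i<k. integral {-1..1} (\<lambda>t. poly (smult 2 P + [:s 0:]) t * ?w i t)) = 0"
  proof -
    have const: "smult 2 P + [:s (0 + i):] = smult 2 P + [:s 0:]" if "i < k" for i
      using s_eq[of i] that by simp
    have "(\<Sum>i<k. integral {-1..1} (\<lambda>t. poly (smult 2 P + [:s (0 + i):]) t * ?w i t))
        = (\<Sum>i<k. integral {-1..1} (\<lambda>t. poly (smult 2 P + [:s 0:]) t * ?w i t))"
      by (intro sum.cong refl) (simp only: const lessThan_iff)
    then show ?thesis using moment[of 0] by simp
  qed
  then have mean: "defint P + s 0 = 0"
    unfolding unity by (simp add: defint_add defint_smult defint_const)
  show "poly ((pderiv ^^ l) (\<Sum>j\<in>\<U> k - {0}. smult (q 0 j) (legendre j))) 1 = 0"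
    if l: "l < k" "even (k + l)" for l
    unfolding E_def[symmetric]
  proof -
    have "poly ((pderiv ^^ l) E) 1 = poly ((pderiv ^^ l) E) (-1)"
    proof (cases l)
      case 0
      then have "even k" using l by simp
      then have "coeff (R i) 0 = 0" for i
        using R_parity[of i, unfolded has_parity_def, rule_format, of 0] by auto
      then have "s 0 = 0" by (simp add: s_def S_def)
      then show ?thesis using mean defint_pderiv[of E] by (simp add: 0 P_def)
    next
      case (Suc l')
      have "poly ((pderiv ^^ l') P) 1 = poly ((pderiv ^^ l') P) (-1)"
      proof (cases l')
        case 0
        then show ?thesis using \<open>\<delta> = 0\<close> by (simp add: \<delta>_def)
      next
        case (Suc l'')
        then show ?thesis
          using A_match[of 0 l'] l k \<open>l = Suc l'\<close>
          by (simp del: funpow.simps add: funpow_Suc_right)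
      qed
      then show ?thesis by (simp del: funpow.simps add: Suc funpow_Suc_right P_def)
    qed
    then show "poly ((pderiv ^^ l) E) 1 = 0"
      using poly_uminus_if_parity[OF has_parity_higher_pderiv[OF E_parity], of l 1] l(2) by simp
  qed
qed

lemma linear_functional_poly_legendre_sum:
  "linear_functional (\<lambda>y. poly ((pderiv ^^ l) (legendre_sum n (\<lambda>j. y (i, j)))) t)"
  unfolding linear_functional_def legendre_sum_def
  by (simp add: higher_pderiv_sum higher_pderiv_add higher_pderiv_smult poly_sum sum.distrib sum_distrib_left algebra_simps smult_add_left)

lemma linear_functional_galerkin_moment:
  "linear_functional (\<lambda>y. galerkin_moment k (\<lambda>i. legendre_sum n (\<lambda>j. y (i, j))) p)"
  unfolding galerkin_moment_def
proof (intro linear_functional_sum)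
  fix i
  let ?Q = "\<lambda>y. legendre_sum n (\<lambda>j. y (p + i, j))"
  let ?I = "\<lambda>y. integral {-1..1} (\<lambda>t. poly (pderiv (?Q y)) t * bspline k (real i + (t + 1) / 2))"
  have *: "poly (pderiv (?Q (\<lambda>a. y a + c * z a))) t = poly (pderiv (?Q y) + smult c (pderiv (?Q z))) t" for y z c t
    using linear_functionalD[OF linear_functional_poly_legendre_sum[of 1 n "p + i" t], of y c z] by simp
  have "?I (\<lambda>a. y a + c * z a) = ?I y + c * ?I z" for y z c
  proof -
    have "?I (\<lambda>a. y a + c * z a) = integral {-1..1} (\<lambda>t. poly (pderiv (?Q y)) t * bspline k (real i + (t + 1) / 2)
        + c * (poly (pderiv (?Q z)) t * bspline k (real i + (t + 1) / 2)))"
      unfolding * by (simp add: algebra_simps)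
    then show ?thesis
      by (simp add: integral_add integrable_poly_bspline integrable_on_mult_right del: mult_cancel_left)
  qed
  then show "linear_functional ?I" unfolding linear_functional_def by blast
qed

text \<open>The coefficients of the \<open>Q i\<close> are coordinates of one vector, in which all hypotheses of
  \<open>error_pattern_proportional\<close> are finitely many linear equations; the constant comes from
  \<open>functional_in_span_if_kernel_subset\<close> and depends on \<open>k\<close>, \<open>\<gamma>\<close> and \<open>j\<close> alone.\<close>

lemma error_pattern_almost_proportional:
  fixes k :: nat
  assumes k: "k \<ge> 2"
    and F: "calF_iterate k = (\<Sum>j\<in>\<U> k - {0}. smult (\<gamma> j) (legendre j))"
    and j: "j \<in> \<U> k - {0}"
  shows "\<exists>C\<ge>0. \<forall>q \<epsilon>.
    (\<forall>i\<le>k. \<forall>l<k. poly ((pderiv ^^ l) (legendre_sum (k + 1) (q i))) 1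
        = poly ((pderiv ^^ l) (legendre_sum (k + 1) (q (i + 1)))) (-1)) \<longrightarrow>
    (\<forall>i\<le>k. \<forall>j\<in>\<U> k - {0}. \<bar>q i j - q (i + 1) j\<bar> \<le> \<epsilon>) \<longrightarrow>
    (\<forall>p\<le>2. \<bar>galerkin_moment k (\<lambda>i. legendre_sum (k + 1) (q i)) p\<bar> \<le> \<epsilon>) \<longrightarrow>
    \<epsilon> \<ge> 0 \<longrightarrow>
    \<bar>q 0 j - \<gamma> j / \<gamma> (k + 1) * q 0 (k + 1)\<bar> \<le> C * \<epsilon>"
proof -
  let ?Q = "\<lambda>y i. legendre_sum (k + 1) (\<lambda>j. y (i, j))"
  let ?m = "\<lambda>(i, l) y. poly ((pderiv ^^ l) (?Q y i)) 1 - poly ((pderiv ^^ l) (?Q y (i + 1))) (-1)"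
  let ?v = "\<lambda>(i, j) y. y (i, j) - y (i + 1, j :: nat)"
  let ?g = "\<lambda>p y. galerkin_moment k (?Q y) p"
  let ?A = "?m ` ({..k} \<times> {..<k}) \<union> ?v ` ({..k} \<times> (\<U> k - {0})) \<union> ?g ` {..2}"
  let ?\<phi> = "\<lambda>y. y (0 :: nat, j) + (- (\<gamma> j / \<gamma> (k + 1))) * y (0, k + 1)"
  have "\<exists>\<alpha>. \<forall>y. ?\<phi> y = (\<Sum>a\<in>?A. \<alpha> a * a y)"
  proof (rule functional_in_span_if_kernel_subset)
    show "finite ?A" by auto
    show "linear_functional a" if "a \<in> ?A" for a
      using that
      by (auto intro!: linear_functional_diff linear_functional_poly_legendre_sum linear_functional_coord
          linear_functional_galerkin_moment)
    show "linear_functional ?\<phi>" by (intro linear_functional_add_mult linear_functional_coord)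
    fix y assume y: "\<And>a. a \<in> ?A \<Longrightarrow> a y = 0"
    have "y (0, j) = \<gamma> j / \<gamma> (k + 1) * y (0, k + 1)"
    proof (rule error_pattern_proportional[OF k _ _ _ F j, of "\<lambda>i j. y (i, j)"])
      show "poly ((pderiv ^^ l) (?Q y i)) 1 = poly ((pderiv ^^ l) (?Q y (i + 1))) (-1)" if "i \<le> k" "l < k" for i l
      proof -
        have "?m (i, l) \<in> ?A" using that by (intro UnI1 imageI) auto
        from y[OF this] show ?thesis by simp
      qed
      show "y (i, j) = y (i + 1, j)" if "i \<le> k" "j \<in> \<U> k - {0}" for i j
      proof -
        have "?v (i, j) \<in> ?A" using that by (intro UnI1[OF UnI2] imageI) auto
        from y[OF this] show ?thesis by simp
      qed
      show "galerkin_moment k (?Q y) p = 0" if "p \<le> 2" for p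
      proof -
        have "?g p \<in> ?A" using that by (intro UnI2 imageI) auto
        from y[OF this] show ?thesis by simp
      qed
    qed
    then show "?\<phi> y = 0" by simp
  qed
  then obtain \<alpha> where \<alpha>: "\<And>y. ?\<phi> y = (\<Sum>a\<in>?A. \<alpha> a * a y)" by blast
  show ?thesis
  proof (intro exI[of _ "\<Sum>a\<in>?A. \<bar>\<alpha> a\<bar>"] conjI allI impI)
    show "0 \<le> (\<Sum>a\<in>?A. \<bar>\<alpha> a\<bar>)" by (intro sum_nonneg) auto
    fix q :: "nat \<Rightarrow> nat \<Rightarrow> real" and \<epsilon> :: real
    assume *: "\<forall>i\<le>k. \<forall>l<k. poly ((pderiv ^^ l) (legendre_sum (k + 1) (q i))) 1
        = poly ((pderiv ^^ l) (legendre_sum (k + 1) (q (i + 1)))) (-1)"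
      "\<forall>i\<le>k. \<forall>j\<in>\<U> k - {0}. \<bar>q i j - q (i + 1) j\<bar> \<le> \<epsilon>"
      "\<forall>p\<le>2. \<bar>galerkin_moment k (\<lambda>i. legendre_sum (k + 1) (q i)) p\<bar> \<le> \<epsilon>" "\<epsilon> \<ge> 0"
    let ?y = "\<lambda>(i, j). q i j"
    have bound: "\<bar>a ?y\<bar> \<le> \<epsilon>" if "a \<in> ?A" for a
      using that * by auto
    have "\<bar>?\<phi> ?y\<bar> \<le> (\<Sum>a\<in>?A. \<bar>\<alpha> a * a ?y\<bar>)"
      unfolding \<alpha> by (rule sum_abs)
    also have "\<dots> \<le> (\<Sum>a\<in>?A. \<bar>\<alpha> a\<bar> * \<epsilon>)"
      unfolding abs_mult by (intro sum_mono mult_left_mono bound) auto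
    finally show "\<bar>q 0 j - \<gamma> j / \<gamma> (k + 1) * q 0 (k + 1)\<bar> \<le> (\<Sum>a\<in>?A. \<bar>\<alpha> a\<bar>) * \<epsilon>"
      by (simp add: sum_distrib_right)
  qed
qed


section \<open>Meshes\<close>

lemma mesh_strict_mono:
  assumes "is_mesh a b N x" "1 \<le> i" "i < j" "j \<le> N + 1"
  shows "x i < x j"
  using assms(3,4)
proof (induction j)
  case (Suc j)
  have "x j < x (Suc j)"
    using assms(1,2) Suc.prems by (auto simp: is_mesh_def)
  with Suc show ?case by (cases "i = j") auto
qed simp

lemma mesh_mono:
  assumes "is_mesh a b N x" "1 \<le> i" "i \<le> j" "j \<le> N + 1"
  shows "x i \<le> x j"
  using mesh_strict_mono[OF assms(1,2), of j] assms by (cases "i = j") auto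

lemma mesh_bounds:
  assumes "is_mesh a b N x" "1 \<le> i" "i \<le> N + 1"
  shows "a \<le> x i" "x i \<le> b"
  using mesh_mono[OF assms(1), of 1 i] mesh_mono[OF assms(1), of i "N + 1"] assms
  by (auto simp: is_mesh_def)

lemma elem_subset:
  assumes "is_mesh a b N x" "i \<in> {1..N}"
  shows "elem x i \<subseteq> {a..b}"
  using mesh_bounds[OF assms(1), of i] mesh_bounds[OF assms(1), of "i + 1"] assms(2)
  by (auto simp: elem_def)

lemma mesh_cover:
  assumes "is_mesh a b N x"
  shows "{a..b} = (\<Union>i\<in>{1..N}. elem x i)"
proof
  show "(\<Union>i\<in>{1..N}. elem x i) \<subseteq> {a..b}" using elem_subset[OF assms] by blast
  have "\<exists>i\<in>{1..n}. s \<in> elem x i" if "n \<ge> 1" "x 1 \<le> s" "s \<le> x (n + 1)" for s n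
    using that
  proof (induction n rule: dec_induct)
    case base
    then show ?case by (auto simp: elem_def numeral_2_eq_2)
  next
    case (step n)
    show ?case
    proof (cases "s \<le> x (n + 1)")
      case True
      then show ?thesis using step by fastforce
    next
      case False
      then show ?thesis using step.prems by (intro bexI[of _ "Suc n"]) (auto simp: elem_def)
    qed
  qed
  then show "{a..b} \<subseteq> (\<Union>i\<in>{1..N}. elem x i)"
    using assms unfolding is_mesh_def by fastforce
qed

lemma meshsize_pos:
  assumes "is_mesh a b N x"
  shows "meshsize N x > 0"
proof -
  have "0 < x (1 + 1) - x 1" using assms by (auto simp: is_mesh_def)
  also have "\<dots> \<le> meshsize N x"
    unfolding meshsize_def using assms by (intro Max_ge) (auto simp: is_mesh_def)
  finally show ?thesis .
qed

lemma integrable_on_mesh: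
  fixes f :: "real \<Rightarrow> real"
  assumes "is_mesh a b N x" and f: "\<And>i. i \<in> {1..N} \<Longrightarrow> f integrable_on elem x i"
  shows "f integrable_on {a..b}"
proof -
  have "f integrable_on {x 1..x (n + 1)}" if "n \<ge> 1" "n \<le> N" for n
    using that
  proof (induction n rule: dec_induct)
    case base
    then show ?case using f[of 1] by (auto simp: elem_def numeral_2_eq_2)
  next
    case (step n)
    have "f integrable_on {x 1..x (Suc (Suc n))}"
    proof (rule Henstock_Kurzweil_Integration.integrable_combine)
      show "x 1 \<le> x (Suc n)" "x (Suc n) \<le> x (Suc (Suc n))"
        using step by (auto intro!: mesh_mono[OF assms(1)])
      show "f integrable_on {x 1..x (Suc n)}" using step by simp
      show "f integrable_on {x (Suc n)..x (Suc (Suc n))}"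
        using step f[of "Suc n"] by (simp add: elem_def)
    qed
    then show ?case by simp
  qed
  from this[of N] show ?thesis using assms(1) by (auto simp: is_mesh_def)
qed


section \<open>Spaces of smooth functions and splines\<close>

lemma C_spaceI:
  assumes "\<And>s. s \<in> S \<Longrightarrow> D 0 s = f s"
    and "\<And>i s. i < n \<Longrightarrow> s \<in> S \<Longrightarrow> (D i has_real_derivative D (Suc i) s) (at s within S)"
    and "\<And>i. i \<le> n \<Longrightarrow> continuous_on S (D i)"
  shows "f \<in> C_space n S"
  using assms unfolding C_space_def by blast

lemma C_spaceE:
  assumes "f \<in> C_space n S"
  obtains D where "\<And>s. s \<in> S \<Longrightarrow> D 0 s = f s"
    and "\<And>i s. i < n \<Longrightarrow> s \<in> S \<Longrightarrow> (D i has_real_derivative D (Suc i) s) (at s within S)"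
    and "\<And>i. i \<le> n \<Longrightarrow> continuous_on S (D i)"
  using assms unfolding C_space_def by blast

lemma C_space_add_mult:
  assumes "f \<in> C_space n S" "g \<in> C_space n S"
  shows "(\<lambda>s. f s + c * g s) \<in> C_space n S"
proof -
  from assms(1) obtain D where D: "\<And>s. s \<in> S \<Longrightarrow> D 0 s = f s"
    "\<And>i s. i < n \<Longrightarrow> s \<in> S \<Longrightarrow> (D i has_real_derivative D (Suc i) s) (at s within S)"
    "\<And>i. i \<le> n \<Longrightarrow> continuous_on S (D i)" by (rule C_spaceE) blast
  from assms(2) obtain E where E: "\<And>s. s \<in> S \<Longrightarrow> E 0 s = g s"
    "\<And>i s. i < n \<Longrightarrow> s \<in> S \<Longrightarrow> (E i has_real_derivative E (Suc i) s) (at s within S)"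
    "\<And>i. i \<le> n \<Longrightarrow> continuous_on S (E i)" by (rule C_spaceE) blast
  show ?thesis
    by (rule C_spaceI[of _ "\<lambda>i s. D i s + c * E i s"])
      (auto intro!: DERIV_add DERIV_cmult D E continuous_intros simp: D(1) E(1))
qed

lemma C_space_poly: "poly p \<in> C_space n S"
  by (rule C_spaceI[of _ "\<lambda>i. poly ((pderiv ^^ i) p)"])
    (auto intro!: DERIV_subset[OF poly_DERIV] continuous_intros)

lemma C_space_sum:
  assumes "finite A" "\<And>r. r \<in> A \<Longrightarrow> f r \<in> C_space n S"
  shows "(\<lambda>s. \<Sum>r\<in>A. c r * f r s) \<in> C_space n S"
  using assms
proof (induction A rule: finite_induct)
  case empty
  have "poly 0 = (\<lambda>_. 0 :: real)" by auto
  then show ?case using C_space_poly[of 0 n S] by simp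
next
  case (insert b A)
  then have "(\<lambda>s. (\<Sum>r\<in>A. c r * f r s) + c b * f b s) \<in> C_space n S"
    by (intro C_space_add_mult) auto
  then show ?case using insert by (simp add: add.commute)
qed

lemma DERIV_trunc_power:
  "(trunc_power (Suc (Suc n)) has_real_derivative real (Suc (Suc n)) * trunc_power (Suc n) x) (at x)"
proof -
  consider "x < 0" | "x > 0" | "x = 0" by linarith
  then show ?thesis
  proof cases
    case 1
    have "((\<lambda>_. 0) has_real_derivative 0) (at x)" by simp
    then have "(trunc_power (Suc (Suc n)) has_real_derivative 0) (at x)"
      by (rule has_field_derivative_transform_within_open[of _ _ _ "{..<0}"])
        (use 1 in \<open>auto simp: trunc_power_def max_def\<close>)
    then show ?thesis using 1 by (simp add: trunc_power_def max_def)
  next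
    case 2
    have "((\<lambda>x. x ^ Suc (Suc n)) has_real_derivative real (Suc (Suc n)) * x ^ Suc n) (at x)"
      by (rule DERIV_cong[OF DERIV_pow]) simp
    then have "(trunc_power (Suc (Suc n)) has_real_derivative real (Suc (Suc n)) * x ^ Suc n) (at x)"
      by (rule has_field_derivative_transform_within_open[of _ _ _ "{0<..}"])
        (use 2 in \<open>auto simp: trunc_power_def max_def\<close>)
    then show ?thesis using 2 by (simp add: trunc_power_def max_def)
  next
    case 3
    \<comment> \<open>At the kink the difference quotient is \<open>trunc_power (Suc n)\<close> itself.\<close>
    have "(trunc_power (Suc n) \<longlongrightarrow> trunc_power (Suc n) 0) (at 0)"
    proof -
      have "isCont (\<lambda>x :: real. (max 0 x) ^ Suc n) 0" by (intro continuous_intros)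
      then show ?thesis unfolding trunc_power_def isCont_def .
    qed
    moreover have "\<forall>\<^sub>F h in at 0. trunc_power (Suc n) h
        = (trunc_power (Suc (Suc n)) (0 + h) - trunc_power (Suc (Suc n)) 0) / h"
      by (auto simp: eventually_at_filter trunc_power_def max_def)
    ultimately have "((\<lambda>h. (trunc_power (Suc (Suc n)) (0 + h) - trunc_power (Suc (Suc n)) 0) / h) \<longlongrightarrow> trunc_power (Suc n) 0) (at 0)"
      by (rule Lim_transform_eventually)
    moreover have "trunc_power (Suc n) 0 = 0" by (simp add: trunc_power_def)
    ultimately show ?thesis using 3 by (simp add: DERIV_def)
  qed
qed

lemma C_space_trunc_power:
  assumes "n < k"
  shows "(\<lambda>s. trunc_power k (s - c)) \<in> C_space n S"
proof (rule C_spaceI[of _ "\<lambda>i s. fact k / fact (k - i) * trunc_power (k - i) (s - c)"])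
  fix i s assume i: "i < n"
  then have "i + 2 \<le> k" using assms by simp
  then obtain l where "k = i + 2 + l" using le_Suc_ex by blast
  then have l: "k - i = Suc (Suc l)" "k - Suc i = Suc l" by auto
  have "((\<lambda>s. trunc_power (Suc (Suc l)) (s - c)) has_real_derivative
      real (Suc (Suc l)) * trunc_power (Suc l) (s - c)) (at s)"
  proof -
    have "((\<lambda>s. s - c) has_real_derivative 1) (at s)" by (auto intro!: derivative_eq_intros)
    from DERIV_chain2[OF DERIV_trunc_power this] show ?thesis by simp
  qed
  moreover have "fact k / fact (Suc (Suc l)) * (real (Suc (Suc l)) * t) = fact k / fact (Suc l) * t" for t :: real
    by (subst fact_Suc) (simp del: of_nat_Suc fact_Suc)
  ultimately have "((\<lambda>s. fact k / fact (Suc (Suc l)) * trunc_power (Suc (Suc l)) (s - c)) has_real_derivative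
      fact k / fact (Suc l) * trunc_power (Suc l) (s - c)) (at s)"
    using DERIV_cmult[of _ _ s UNIV "fact k / fact (Suc (Suc l))"] by metis
  then
  show "((\<lambda>s. fact k / fact (k - i) * trunc_power (k - i) (s - c)) has_real_derivative
      fact k / fact (k - Suc i) * trunc_power (k - Suc i) (s - c)) (at s within S)"
    unfolding l by (rule has_field_derivative_at_within)
next
  show "continuous_on S (\<lambda>s. fact k / fact (k - i) * trunc_power (k - i) (s - c))" for i
    unfolding trunc_power_def by (intro continuous_intros)
qed simp

lemma C_space_derivative:
  assumes "f \<in> C_space n S" "n \<ge> 1"
  obtains f' where "continuous_on S f'"
    "\<And>s. s \<in> S \<Longrightarrow> (f has_real_derivative f' s) (at s within S)"
proof -
  from assms(1) obtain D where D: "\<And>s. s \<in> S \<Longrightarrow> D 0 s = f s"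
    "\<And>i s. i < n \<Longrightarrow> s \<in> S \<Longrightarrow> (D i has_real_derivative D (Suc i) s) (at s within S)"
    "\<And>i. i \<le> n \<Longrightarrow> continuous_on S (D i)" by (rule C_spaceE) blast
  have "(f has_real_derivative D 1 s) (at s within S)" if "s \<in> S" for s
    using D(2)[of 0 s] assms(2) that
    by (intro has_field_derivative_transform_within[of "D 0" "D 1 s" s S 1 f]) (auto simp: D(1))
  with D(3)[of 1] assms(2) that show ?thesis by blast
qed

text \<open>If a function of class \<open>C\<^sup>n\<close> is polynomial on both sides of a point, then its derivatives there
  are limits of the derivatives of either polynomial, so the two agree to order \<open>n\<close>.\<close>

lemma C_space_poly_match:
  assumes f: "f \<in> C_space n S" and S: "open S" "{l<..<r} \<subseteq> S" and lr: "l < m" "m < r"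
    and p: "\<And>s. l < s \<Longrightarrow> s < m \<Longrightarrow> f s = poly p s"
    and q: "\<And>s. m < s \<Longrightarrow> s < r \<Longrightarrow> f s = poly q s"
    and i: "i \<le> n"
  shows "poly ((pderiv ^^ i) p) m = poly ((pderiv ^^ i) q) m"
proof -
  from f obtain D where D: "\<And>s. s \<in> S \<Longrightarrow> D 0 s = f s"
    "\<And>i s. i < n \<Longrightarrow> s \<in> S \<Longrightarrow> (D i has_real_derivative D (Suc i) s) (at s within S)"
    "\<And>i. i \<le> n \<Longrightarrow> continuous_on S (D i)" by (rule C_spaceE) blast
  have eq: "D i s = poly ((pderiv ^^ i) t) s"
    if "\<And>s. l' < s \<Longrightarrow> s < r' \<Longrightarrow> f s = poly t s" "{l'<..<r'} \<subseteq> S" "i \<le> n" "l' < s" "s < r'" for l' r' t i s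
    using that(3-5)
  proof (induction i arbitrary: s)
    case 0
    then show ?case using that D(1)[of s] by auto
  next
    case (Suc i)
    have mem: "s \<in> {l'<..<r'}" using Suc.prems(2,3) by simp
    then have "s \<in> S" using that(2) by (rule subsetD[rotated])
    have "(D i has_real_derivative D (Suc i) s) (at s within S)"
      using Suc.prems(1) \<open>s \<in> S\<close> by (intro D(2)) auto
    then have "(D i has_real_derivative D (Suc i) s) (at s)"
      by (simp only: at_within_open[OF \<open>s \<in> S\<close> S(1)])
    moreover have "(D i has_real_derivative poly (pderiv ((pderiv ^^ i) t)) s) (at s)"
    proof (rule has_field_derivative_transform_within_open[OF poly_DERIV])
      fix y assume "y \<in> {l'<..<r'}"
      then show "poly ((pderiv ^^ i) t) y = D i y"
        using Suc.prems(1) by (intro Suc.IH[symmetric]) auto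
    qed (use mem in auto)
    ultimately have "D (Suc i) s = poly (pderiv ((pderiv ^^ i) t)) s" by (rule DERIV_unique)
    then show ?case by simp
  qed
  have m: "m \<in> S" using lr S(2) by auto
  then have cont: "isCont (D i) m"
    using D(3)[OF i] S(1) by (simp add: continuous_on_eq_continuous_at)
  have sub: "{l<..<m} \<subseteq> S" "{m<..<r} \<subseteq> S"
    using S(2) lr by (auto simp: subset_iff)
  have left: "poly ((pderiv ^^ i) p) s = D i s" if "l < s" "s < m" for s
    by (rule eq[OF p sub(1) i that, symmetric])
  have right: "poly ((pderiv ^^ i) q) s = D i s" if "m < s" "s < r" for s
    by (rule eq[OF q sub(2) i that, symmetric])
  have "D i m = poly ((pderiv ^^ i) p) m"
  proof (rule tendsto_unique[of "at_left m"])
    show "(D i \<longlongrightarrow> D i m) (at_left m)"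
      using cont by (simp add: isCont_def filterlim_at_split)
    have "isCont (poly ((pderiv ^^ i) p)) m" by (intro continuous_intros)
    then have "(poly ((pderiv ^^ i) p) \<longlongrightarrow> poly ((pderiv ^^ i) p) m) (at_left m)"
      by (simp add: isCont_def filterlim_at_split)
    then show "(D i \<longlongrightarrow> poly ((pderiv ^^ i) p) m) (at_left m)"
      by (rule Lim_transform_eventually)
        (use left lr in \<open>auto simp: eventually_at_left\<close>)
  qed simp
  moreover have "D i m = poly ((pderiv ^^ i) q) m"
  proof (rule tendsto_unique[of "at_right m"])
    show "(D i \<longlongrightarrow> D i m) (at_right m)"
      using cont by (simp add: isCont_def filterlim_at_split)
    have "isCont (poly ((pderiv ^^ i) q)) m" by (intro continuous_intros)
    then have "(poly ((pderiv ^^ i) q) \<longlongrightarrow> poly ((pderiv ^^ i) q) m) (at_right m)"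
      by (simp add: isCont_def filterlim_at_split)
    then show "(D i \<longlongrightarrow> poly ((pderiv ^^ i) q) m) (at_right m)"
      by (rule Lim_transform_eventually)
        (use right lr in \<open>auto simp: eventually_at_right\<close>)
  qed simp
  ultimately show ?thesis by simp
qed

lemma H10_if_C1:
  assumes ab: "a < b" and g: "continuous_on UNIV g" and v: "\<And>s. (v has_real_derivative g s) (at s)"
    and "v a = 0" "v b = 0"
  shows "v \<in> H10 a b"
  unfolding H10_def
proof (intro CollectI conjI exI[of _ g] ballI)
  have g': "continuous_on S g" for S using g continuous_on_subset by blast
  show "g \<in> borel_measurable (lebesgue_on {a..b})"
    by (intro continuous_imp_measurable_on_sets_lebesgue g') simp
  show "(\<lambda>s. (g s)\<^sup>2) integrable_on {a..b}"
    by (intro integrable_continuous_real continuous_intros g')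
  fix s assume s: "s \<in> {a..b}"
  have "(g has_integral v s - v a) {a..s}"
    using s v by (intro fundamental_theorem_of_calculus)
      (auto intro: has_field_derivative_at_within simp flip: has_real_derivative_iff_has_vector_derivative)
  then show "v s = integral {a..s} g" using assms(4) by (simp add: integral_unique)
qed (rule assms(5))


section \<open>B-splines as derivatives of test functions\<close>

lemma DERIV_nabla_iterate:
  assumes "\<And>x. (f has_real_derivative f' x) (at x)"
  shows "((nabla ^^ k) f has_real_derivative (nabla ^^ k) f' x) (at x)"
  using assms
proof (induction k arbitrary: f f')
  case (Suc k)
  have "(nabla f has_real_derivative nabla f' x) (at x)" for x
  proof -
    have "((\<lambda>x. x - 1) has_real_derivative 1) (at x)" by (auto intro!: derivative_eq_intros)
    from DERIV_diff[OF Suc.prems DERIV_chain2[OF Suc.prems this]] show ?thesis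
      unfolding nabla_def by simp
  qed
  from Suc.IH[OF this] show ?case by (simp only: funpow_Suc_right o_apply)
qed simp

text \<open>A primitive of a B-spline, corrected by a linear function such that it vanishes at both ends
  of the interval.  The correction is harmless because the derivative of the error is orthogonal
  to constants.\<close>

definition test_fun :: "real \<Rightarrow> real \<Rightarrow> nat \<Rightarrow> real \<Rightarrow> real \<Rightarrow> real \<Rightarrow> real" where
  "test_fun a b k h y s = (nabla ^^ k) (trunc_power k) ((s - y) / h) - fact k * (s - a) / (b - a)"

lemma DERIV_test_fun:
  assumes "k \<ge> 2" "h > 0"
  shows "(test_fun a b k h y has_real_derivative (real k / h * bspline k ((s - y) / h) - fact k / (b - a))) (at s)"
proof -
  obtain n where n: "k = Suc (Suc n)" using le_Suc_ex[OF assms(1)] by auto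
  obtain c where c: "\<And>f x. (nabla ^^ k) f x = (\<Sum>r\<le>k. c r * f (x - real r))"
    using nabla_iterate_eq_sum by blast
  have "((nabla ^^ k) (trunc_power k) has_real_derivative (nabla ^^ k) (\<lambda>x. real k * trunc_power (k - 1) x) t) (at t)" for t
    by (intro DERIV_nabla_iterate) (use DERIV_trunc_power[of n] in \<open>simp add: n\<close>)
  moreover have "(nabla ^^ k) (\<lambda>x. real k * trunc_power (k - 1) x) t = real k * bspline k t" for t
    unfolding bspline_def c by (simp add: sum_distrib_left algebra_simps)
  ultimately have *: "((nabla ^^ k) (trunc_power k) has_real_derivative real k * bspline k t) (at t)" for t
    by simp
  have "((\<lambda>s. (nabla ^^ k) (trunc_power k) ((s - y) / h)) has_real_derivative
      real k * bspline k ((s - y) / h) * (1 / h)) (at s)"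
    by (rule DERIV_chain2[OF *]) (use assms in \<open>auto intro!: derivative_eq_intros\<close>)
  moreover have "((\<lambda>s. fact k * (s - a) / (b - a)) has_real_derivative fact k / (b - a)) (at s)"
    by (cases "b = a") (auto intro!: derivative_eq_intros)
  ultimately show ?thesis
    unfolding test_fun_def using DERIV_diff by fastforce
qed

lemma test_fun_in_V_space:
  assumes k: "k \<ge> 2" and mesh: "is_mesh a b N x" and ab: "a < b" and h: "h > 0"
    and p: "p \<ge> 1" "p + k \<le> N + 1"
    and uniform: "\<And>r. r \<le> k \<Longrightarrow> x (p + r) = x p + real r * h"
  shows "test_fun a b k h (x p) \<in> V_space a b N x k (k - 1)"
proof -
  obtain c where c: "\<And>f x. (nabla ^^ k) f x = (\<Sum>r\<le>k. c r * f (x - real r))"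
    using nabla_iterate_eq_sum by blast
  let ?L = "[:- (fact k * a / (b - a)), fact k / (b - a):]"
  have scale: "trunc_power k ((s - x p) / h - real r) = (1 / h ^ k) * trunc_power k (s - x (p + r))" if "r \<le> k" for r s
  proof -
    have "max 0 ((s - x p) / h - real r) = max 0 (s - x (p + r)) / h"
      unfolding uniform[OF that] using h by (auto simp: max_def field_simps)
    then show ?thesis by (simp add: trunc_power_def power_divide)
  qed
  have rep: "test_fun a b k h (x p) s = (\<Sum>r\<le>k. (c r / h ^ k) * trunc_power k (s - x (p + r))) + (-1) * poly ?L s" for s
  proof -
    have "(\<Sum>r\<le>k. c r * trunc_power k ((s - x p) / h - real r))
        = (\<Sum>r\<le>k. (c r / h ^ k) * trunc_power k (s - x (p + r)))"
      by (intro sum.cong refl) (simp add: scale)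
    moreover have "poly ?L s = fact k * (s - a) / (b - a)"
      by (simp add: diff_divide_distrib right_diff_distrib)
    ultimately show ?thesis unfolding test_fun_def c by simp
  qed
  have "test_fun a b k h (x p) = (\<lambda>s. (\<Sum>r\<le>k. (c r / h ^ k) * trunc_power k (s - x (p + r))) + (-1) * poly ?L s)"
    using rep by (rule ext)
  also have "\<dots> \<in> C_space (k - 1) {a<..<b}"
    using k by (intro C_space_add_mult C_space_sum C_space_trunc_power C_space_poly) auto
  finally have smooth: "test_fun a b k h (x p) \<in> C_space (k - 1) {a<..<b}" .
  have piecewise: "\<exists>q :: real poly. degree q \<le> k \<and> (\<forall>s\<in>elem x i. test_fun a b k h (x p) s = poly q s)"
    if i: "i \<in> {1..N}" for i
  proof (intro exI conjI ballI)
    let ?t = "\<lambda>r. if p + r \<le> i then [:- x (p + r), 1:] ^ k else 0"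
    let ?q = "(\<Sum>r\<le>k. smult (c r / h ^ k) (?t r)) - ?L"
    show "degree ?q \<le> k"
      using k by (intro degree_diff_le degree_sum_le order.trans[OF degree_smult_le])
        (auto simp: degree_linear_power)
    fix s assume s: "s \<in> elem x i"
    have "trunc_power k (s - x (p + r)) = poly (?t r) s" if "r \<le> k" for r
    proof (cases "p + r \<le> i")
      case True
      then have "x (p + r) \<le> s"
        using mesh_mono[OF mesh, of "p + r" i] s i p by (auto simp: elem_def)
      then show ?thesis using True by (simp add: trunc_power_def)
    next
      case False
      then have "s \<le> x (p + r)"
        using mesh_mono[OF mesh, of "i + 1" "p + r"] s i p that by (auto simp: elem_def)
      then show ?thesis using False k by (simp add: trunc_power_def max_def)
    qed
    then show "test_fun a b k h (x p) s = poly ?q s"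
      unfolding rep by (simp add: poly_sum)
  qed
  have "a \<le> x p" "x p + real k * h \<le> b"
    using mesh_bounds[OF mesh, of p] mesh_bounds[OF mesh, of "p + k"] p uniform[of k] by auto
  then have "(a - x p) / h \<le> 0" "(b - x p) / h \<ge> real k"
    using h by (auto simp: field_simps)
  then have "test_fun a b k h (x p) a = 0" "test_fun a b k h (x p) b = 0"
    using k ab by (auto simp: test_fun_def nabla_trunc_power_left nabla_trunc_power_right)
  then have "test_fun a b k h (x p) \<in> H10 a b"
    using DERIV_test_fun[OF k h] ab
    by (intro H10_if_C1[where g = "\<lambda>s. real k / h * bspline k ((s - x p) / h) - fact k / (b - a)"]
        continuous_intros continuous_on_compose2[OF continuous_on_bspline[of UNIV]]) (use h in auto)
  with smooth piecewise show ?thesis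
    unfolding V_space_def spline_space_def by blast
qed


section \<open>The Galerkin error\<close>

lemma integral_affine_change:
  fixes g :: "real \<Rightarrow> real"
  assumes h: "h > 0" and g: "continuous_on {m - h / 2..m + h / 2} g"
  shows "integral {-1..1} (\<lambda>t. h / 2 * g (m + h * t / 2)) = integral {m - h / 2..m + h / 2} g"
proof -
  let ?I = "integral {m - h / 2..m + h / 2} g"
  have "(g has_integral ?I) (cbox (m - h / 2) (m + h / 2))"
    using integrable_continuous_real[OF g] by (simp add: has_integral_integral)
  from has_integral_affinity'[OF this, of "h / 2" m]
  have "((\<lambda>t. g (h / 2 * t + m)) has_integral ?I / (h / 2)) {-1..1}"
    using h by (simp add: field_simps)
  from has_integral_mult_right[OF this, of "h / 2"]
  have "((\<lambda>t. h / 2 * g (m + h * t / 2)) has_integral ?I) {-1..1}"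
    using h by (simp add: algebra_simps)
  then show ?thesis by (rule integral_unique)
qed

lemma sum_integral_elems:
  fixes f :: "real \<Rightarrow> real"
  assumes "\<And>i. i < n \<Longrightarrow> x (q + i) \<le> x (q + i + 1)" "f integrable_on {x q..x (q + n)}"
  shows "(\<Sum>i<n. integral (elem x (q + i)) f) = integral {x q..x (q + n)} f"
  using assms
proof (induction n)
  case (Suc n)
  have "x q \<le> x (q + n)"
    using Suc.prems(1)
  proof (induction n)
    case (Suc n)
    have "x (q + n) \<le> x (q + n + 1)" using Suc.prems[of n] by simp
    with Suc show ?case by fastforce
  qed simp
  moreover have step: "x (q + n) \<le> x (q + Suc n)" using Suc.prems(1)[of n] by simp
  ultimately have "integral {x q..x (q + n)} f + integral {x (q + n)..x (q + Suc n)} f = integral {x q..x (q + Suc n)} f"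
    using Suc.prems(2) by (intro Henstock_Kurzweil_Integration.integral_combine)
  moreover have "f integrable_on {x q..x (q + n)}"
    using Suc.prems(2) by (rule integrable_on_subinterval) (use step in auto)
  ultimately show ?case using Suc by (simp add: elem_def)
qed simp

text \<open>\<open>U\<close> and \<open>H\<close> are the derivatives of \<open>u\<close> and \<open>uh\<close>, and \<open>P i\<close> is the polynomial that \<open>uh\<close> is on the
  \<open>i\<close>-th element.\<close>

locale galerkin_error =
  fixes a b :: real and N :: nat and x :: "nat \<Rightarrow> real" and k :: nat
    and u uh U H :: "real \<Rightarrow> real" and P :: "nat \<Rightarrow> real poly"
  assumes ab: "a < b" and k: "k \<ge> 2" and mesh: "is_mesh a b N x"
    and U_cont: "continuous_on {a..b} U"
    and U: "\<And>s. s \<in> {a..b} \<Longrightarrow> (u has_real_derivative U s) (at s within {a..b})"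
    and u_boundary: "u a = 0" "u b = 0"
    and galerkin: "galerkin_solution a b N x k (k - 1) u uh"
    and H_cont: "continuous_on {a<..<b} H"
    and H: "\<And>s. s \<in> {a<..<b} \<Longrightarrow> (uh has_real_derivative H s) (at s)"
    and P_degree: "\<And>i. i \<in> {1..N} \<Longrightarrow> degree (P i) \<le> k"
    and P: "\<And>i s. i \<in> {1..N} \<Longrightarrow> s \<in> elem x i \<Longrightarrow> uh s = poly (P i) s"
begin

lemma uh_smooth: "uh \<in> C_space (k - 1) {a<..<b}"
  using galerkin by (simp add: galerkin_solution_def V_space_def spline_space_def)

lemma uh_boundary: "uh a = 0" "uh b = 0"
proof -
  have "uh \<in> H10 a b" using galerkin by (simp add: galerkin_solution_def V_space_def)
  then obtain g where "\<forall>s\<in>{a..b}. uh s = integral {a..s} g" "uh b = 0"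
    unfolding H10_def by blast
  moreover have "integral {a..a} g = 0" for g :: "real \<Rightarrow> real" using integral_refl[of a g] by simp
  ultimately show "uh a = 0" "uh b = 0" using ab by auto
qed

lemma u_cont: "continuous_on {a..b} u"
  using U by (intro DERIV_continuous_on)

lemma uh_cont: "continuous_on {a..b} uh"
  unfolding mesh_cover[OF mesh]
proof (rule continuous_on_closed_Union)
  fix i assume i: "i \<in> {1..N}"
  show "closed (elem x i)" by (simp add: elem_def)
  have "continuous_on (elem x i) (poly (P i))" by (intro continuous_intros)
  then show "continuous_on (elem x i) uh"
    using P[OF i] by (simp cong: continuous_on_cong)
qed simp

lemma e_deriv:
  assumes "s \<in> {a<..<b}"
  shows "((\<lambda>y. u y - uh y) has_real_derivative U s - H s) (at s)"
proof -
  have "(u has_real_derivative U s) (at s)"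
    using U[of s] assms by (simp add: at_within_Icc_at)
  from DERIV_diff[OF this H[OF assms]] show ?thesis .
qed

lemma H_eq_poly:
  assumes i: "i \<in> {1..N}" and s: "x i < s" "s < x (i + 1)"
  shows "H s = poly (pderiv (P i)) s"
proof -
  have "a \<le> x i" "x (i + 1) \<le> b"
    using mesh_bounds[OF mesh, of i] mesh_bounds[OF mesh, of "i + 1"] i by auto
  then have "(uh has_real_derivative H s) (at s)" using s by (intro H) auto
  moreover have "(uh has_real_derivative poly (pderiv (P i)) s) (at s)"
  proof (rule has_field_derivative_transform_within_open[OF poly_DERIV])
    fix y assume "y \<in> {x i<..<x (i + 1)}"
    then show "poly (P i) y = uh y" using P[OF i, of y] by (simp add: elem_def)
  qed (use s in auto)
  ultimately show ?thesis by (rule DERIV_unique)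
qed

lemma e_has_integral:
  assumes "s \<in> {a..b}"
  shows "((\<lambda>s. U s - H s) has_integral (u s - uh s)) {a..s}"
proof -
  have "((\<lambda>s. U s - H s) has_integral ((u s - uh s) - (u a - uh a))) {a..s}"
  proof (rule fundamental_theorem_of_calculus_interior)
    show "continuous_on {a..s} (\<lambda>y. u y - uh y)"
      using assms by (intro continuous_on_diff continuous_on_subset[OF u_cont] continuous_on_subset[OF uh_cont]) auto
    fix y assume "y \<in> {a<..<s}"
    then show "((\<lambda>y. u y - uh y) has_vector_derivative U y - H y) (at y)"
      using e_deriv[of y] assms by (simp add: has_real_derivative_iff_has_vector_derivative)
  qed (use assms in auto)
  then show ?thesis using u_boundary uh_boundary by simp
qed

lemma galerkin_orthogonality:
  assumes "v \<in> V_space a b N x k (k - 1)"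
    and "\<And>s. s \<in> {a<..<b} \<Longrightarrow> (v has_real_derivative V s) (at s)"
  shows "integral {a<..<b} (\<lambda>s. (U s - H s) * V s) = 0"
proof -
  have "integral {a<..<b} (\<lambda>s. (U s - H s) * V s)
      = integral {a<..<b} (\<lambda>s. deriv (\<lambda>y. u y - uh y) s * deriv v s)"
    by (intro integral_cong) (simp add: DERIV_imp_deriv[OF e_deriv] DERIV_imp_deriv[OF assms(2)])
  also have "\<dots> = 0" using galerkin assms(1) by (simp add: galerkin_solution_def)
  finally show ?thesis .
qed

lemma integrable_piecewise:
  fixes f :: "real \<Rightarrow> real" and g :: "nat \<Rightarrow> real \<Rightarrow> real"
  assumes "\<And>i. i \<in> {1..N} \<Longrightarrow> continuous_on (elem x i) (g i)"
    and "\<And>i s. i \<in> {1..N} \<Longrightarrow> x i < s \<Longrightarrow> s < x (i + 1) \<Longrightarrow> f s = g i s"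
  shows "f integrable_on {a..b}"
proof (rule integrable_on_mesh[OF mesh])
  fix i assume i: "i \<in> {1..N}"
  have "g i integrable_on cbox (x i) (x (i + 1))"
    using assms(1)[OF i] by (simp add: elem_def integrable_continuous_real)
  then have "f integrable_on cbox (x i) (x (i + 1))"
    by (rule integrable_spike_interior[rotated]) (use assms(2)[OF i] in auto)
  then show "f integrable_on elem x i" by (simp add: elem_def)
qed

text \<open>As \<open>uh\<close> itself is a test function, \<open>U = (U - H) + H\<close> is an orthogonal decomposition, so the norm
  of \<open>U - H\<close> is at most that of \<open>U\<close>; and \<open>u - uh\<close> is a primitive of \<open>U - H\<close>.\<close>

lemma energy_bound:
  assumes s: "s \<in> {a..b}"
  shows "\<bar>u s - uh s\<bar> \<le> ((b - a) + integral {a..b} (\<lambda>s. (U s)\<^sup>2)) / 2"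
proof -
  have U_elem: "continuous_on (elem x i) U" if "i \<in> {1..N}" for i
    using U_cont elem_subset[OF mesh that] by (rule continuous_on_subset)
  have int_ee: "(\<lambda>s. (U s - H s)\<^sup>2) integrable_on {a..b}"
    by (rule integrable_piecewise[of "\<lambda>i s. (U s - poly (pderiv (P i)) s)\<^sup>2"])
      (auto simp: H_eq_poly intro!: continuous_intros U_elem)
  have int_eH: "(\<lambda>s. (U s - H s) * H s) integrable_on {a..b}"
    by (rule integrable_piecewise[of "\<lambda>i s. (U s - poly (pderiv (P i)) s) * poly (pderiv (P i)) s"])
      (auto simp: H_eq_poly intro!: continuous_intros U_elem)
  have int_HH: "(\<lambda>s. (H s)\<^sup>2) integrable_on {a..b}"
    by (rule integrable_piecewise[of "\<lambda>i s. (poly (pderiv (P i)) s)\<^sup>2"])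
      (auto simp: H_eq_poly intro!: continuous_intros)
  have "uh \<in> V_space a b N x k (k - 1)" using galerkin by (simp add: galerkin_solution_def)
  from galerkin_orthogonality[OF this H]
  have orth: "integral {a..b} (\<lambda>s. (U s - H s) * H s) = 0"
    by (simp add: integral_open_interval_real)
  have "(\<lambda>s. (U s)\<^sup>2) = (\<lambda>s. (U s - H s)\<^sup>2 + (2 * ((U s - H s) * H s) + (H s)\<^sup>2))"
    by (rule ext) (simp add: power2_eq_square algebra_simps)
  then have "integral {a..b} (\<lambda>s. (U s)\<^sup>2) = integral {a..b} (\<lambda>s. (U s - H s)\<^sup>2)
      + (2 * integral {a..b} (\<lambda>s. (U s - H s) * H s) + integral {a..b} (\<lambda>s. (H s)\<^sup>2))"
    using int_ee int_eH int_HH by (simp add: integral_add integrable_add integrable_on_mult_right)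
  moreover have "integral {a..b} (\<lambda>s. (H s)\<^sup>2) \<ge> 0" by (intro integral_nonneg int_HH) auto
  ultimately have le: "integral {a..b} (\<lambda>s. (U s - H s)\<^sup>2) \<le> integral {a..b} (\<lambda>s. (U s)\<^sup>2)"
    using orth by simp
  let ?g = "\<lambda>s. (1 + (U s - H s)\<^sup>2) / 2"
  have int_g: "?g integrable_on {a..b}"
    by (intro integrable_on_divide integrable_add int_ee) auto
  then have int_g_s: "?g integrable_on {a..s}"
    by (rule integrable_on_subinterval) (use s in auto)
  have "\<bar>y\<bar> \<le> (1 + y\<^sup>2) / 2" for y :: real
    using sum_squares_bound[of "\<bar>y\<bar>" 1] by simp
  then have "norm (integral {a..s} (\<lambda>s. U s - H s)) \<le> integral {a..s} ?g"
    using e_has_integral[OF s] int_g_s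
    by (intro Henstock_Kurzweil_Integration.integral_norm_bound_integral) (auto simp: has_integral_iff)
  also have "\<dots> \<le> integral {a..b} ?g"
    using s by (intro integral_subset_le int_g int_g_s) auto
  also have "\<dots> = integral {a..b} (\<lambda>s. 1 + (U s - H s)\<^sup>2) / 2" by (rule integral_divide)
  also have "integral {a..b} (\<lambda>s. 1 + (U s - H s)\<^sup>2)
      = integral {a..b} (\<lambda>_. 1) + integral {a..b} (\<lambda>s. (U s - H s)\<^sup>2)"
    by (intro integral_add int_ee) auto
  also have "integral {a..b} (\<lambda>_. 1 :: real) = b - a" using ab by simp
  finally have "norm (integral {a..s} (\<lambda>s. U s - H s))
      \<le> ((b - a) + integral {a..b} (\<lambda>s. (U s - H s)\<^sup>2)) / 2" .
  then show ?thesis using le e_has_integral[OF s] by (simp add: integral_unique)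
qed

text \<open>The derivative of the test function is a multiple of the B-spline plus a constant, and the constant
  contributes nothing because the error vanishes at \<open>a\<close> and \<open>b\<close>.\<close>

lemma galerkin_bspline:
  assumes h: "h > 0" and p: "p \<ge> 1" "p + k \<le> N + 1"
    and uniform: "\<And>r. r \<le> k \<Longrightarrow> x (p + r) = x p + real r * h"
    and inside: "a < x p" "x (p + k) < b"
  shows "integral {x p..x (p + k)} (\<lambda>s. (U s - H s) * bspline k ((s - x p) / h)) = 0"
proof -
  let ?B = "\<lambda>s. bspline k ((s - x p) / h)" and ?I = "{x p..x (p + k)}"
  let ?i = "integral ?I (\<lambda>s. (U s - H s) * ?B s)"
  have sub: "?I \<subseteq> {a<..<b}" "?I \<subseteq> {a..b}" using inside by auto
  have B_cont: "continuous_on S ?B" for S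
    by (intro continuous_on_compose2[OF continuous_on_bspline[of UNIV]] continuous_intros) (use h in auto)
  have "(\<lambda>s. (U s - H s) * ?B s) integrable_on ?I"
    by (intro integrable_continuous_real continuous_intros B_cont
        continuous_on_subset[OF U_cont] continuous_on_subset[OF H_cont] sub)
  then have "((\<lambda>s. (U s - H s) * ?B s) has_integral ?i) ?I" by (rule integrable_integral)
  then have *: "((\<lambda>s. (U s - H s) * ?B s) has_integral ?i) {a..b}"
  proof (rule has_integral_on_superset)
    fix s assume "s \<notin> ?I"
    then have "(s - x p) / h \<le> 0 \<or> (s - x p) / h \<ge> real k"
      using h uniform[of k] by (auto simp: field_simps)
    then show "(U s - H s) * ?B s = 0" using bspline_eq_0[OF k] by simp
  qed (rule sub)
  have "((\<lambda>s. U s - H s) has_integral 0) {a..b}"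
    using e_has_integral[of b] ab u_boundary uh_boundary by simp
  from has_integral_diff[OF has_integral_mult_right[OF *, of "real k / h"]
      has_integral_mult_right[OF this, of "fact k / (b - a)"]]
  have "((\<lambda>s. real k / h * ((U s - H s) * ?B s) - fact k / (b - a) * (U s - H s)) has_integral real k / h * ?i) {a<..<b}"
    unfolding has_integral_Icc_iff_Ioo by (simp only: mult_zero_right diff_zero)
  moreover have "l * (y * z) - c * y = y * (l * z - c)" for l y z c :: real
    by (simp add: algebra_simps)
  ultimately have "((\<lambda>s. (U s - H s) * (real k / h * ?B s - fact k / (b - a))) has_integral real k / h * ?i) {a<..<b}"
    by (simp only:)
  moreover have "integral {a<..<b} (\<lambda>s. (U s - H s) * (real k / h * ?B s - fact k / (b - a))) = 0"
    by (rule galerkin_orthogonality[OF test_fun_in_V_space[OF k mesh ab h p uniform] DERIV_test_fun[OF k h]])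
  ultimately have "real k / h * ?i = 0" by (simp add: integral_unique)
  then show ?thesis using k h by simp
qed

end


lemma higher_pderiv_pcompose_linear:
  fixes p :: "real poly"
  shows "(pderiv ^^ l) (pcompose p [:c, w:]) = smult (w ^ l) (pcompose ((pderiv ^^ l) p) [:c, w:])"
proof (induction l)
  case (Suc l)
  then show ?case
    by (simp add: pderiv_smult pderiv_pcompose pderiv_pCons mult.commute)
qed simp

lemma elem_coeff_bound:
  assumes h: "meshsize N x > 0" and len: "x (i + 1) - x i = meshsize N x"
    and e: "continuous_on (elem x i) e" "\<And>s. s \<in> elem x i \<Longrightarrow> \<bar>e s\<bar> \<le> K"
    and \<Lambda>: "\<And>t. t \<in> {-1..1} \<Longrightarrow> \<bar>poly (legendre j) t\<bar> \<le> \<Lambda>"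
  shows "(\<lambda>t. e (midpt x i + meshsize N x * t / 2) * poly (legendre j) t) integrable_on {-1..1}"
    and "\<bar>elem_coeff e N x j i\<bar> \<le> (2 * real j + 1) * (K * \<Lambda>)"
proof -
  let ?s = "\<lambda>t. midpt x i + meshsize N x * t / 2"
  let ?f = "\<lambda>t. e (?s t) * poly (legendre j) t"
  have s: "?s t \<in> elem x i" if "t \<in> {-1..1}" for t
  proof -
    have "meshsize N x * t \<le> meshsize N x * 1" "meshsize N x * (-1) \<le> meshsize N x * t"
      using that h mult_left_mono[of t 1 "meshsize N x"] mult_left_mono[of "-1" t "meshsize N x"] by auto
    then show ?thesis using len by (simp add: elem_def midpt_def field_simps)
  qed
  have cont: "continuous_on {-1..1} ?f"
    by (intro continuous_intros continuous_on_compose2[OF e(1)]) (use s in auto)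
  then show "?f integrable_on {-1..1}" by (rule integrable_continuous_real)
  have K: "K \<ge> 0" using e(2)[OF s[of 0]] by simp
  have "norm (integral {-1..1} ?f) \<le> (K * \<Lambda>) * (1 - (-1))"
    using cont e(2)[OF s] \<Lambda> K by (intro integral_bound) (auto simp: abs_mult intro!: mult_mono)
  then have "\<bar>(2 * real j + 1) / 2\<bar> * \<bar>integral {-1..1} ?f\<bar> \<le> (2 * real j + 1) / 2 * ((K * \<Lambda>) * (1 - (-1)))"
    by (intro mult_mono) auto
  then show "\<bar>elem_coeff e N x j i\<bar> \<le> (2 * real j + 1) * (K * \<Lambda>)"
    unfolding elem_coeff_def abs_mult by simp
qed

context galerkin_error
begin

text \<open>On each element the error is \<open>T - P i\<close> plus the Taylor remainder \<open>u - T\<close>, and \<open>q i\<close> are the Legendre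
  coefficients of the former in the local coordinate.  As \<open>T\<close> is one polynomial for all elements, it
  cancels in the jumps at the nodes, and the matching conditions hold exactly.  The remainder
  enters the coefficients with \<open>h\<^bsup>k+2\<^esup>\<close>, and its derivative the moments with \<open>h\<^bsup>k+1\<^esup>\<close> times
  the length of the support of the B-spline.\<close>

lemma local_error_pattern:
  fixes i0 :: nat and h M x0 \<beta> \<Lambda> :: real and T :: "real poly"
  defines "h \<equiv> meshsize N x"
  assumes i0: "i0 \<ge> 1" "i0 + k + 1 \<le> N"
    and uniform: "\<And>r. r \<le> k + 2 \<Longrightarrow> x (i0 + r) = x i0 + real r * h"
    and inside: "a < x i0" "x (i0 + k + 2) < b"
    and near: "\<And>s. s \<in> {x i0..x (i0 + k + 2)} \<Longrightarrow> \<bar>s - x0\<bar> \<le> (real k + 3) * h"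
    and T_degree: "degree T \<le> k + 1" and M: "M \<ge> 0"
    and T: "\<And>s. s \<in> {a..b} \<Longrightarrow> \<bar>u s - poly T s\<bar> \<le> M * \<bar>s - x0\<bar> ^ (k + 2)"
    and T': "\<And>s. s \<in> {a..b} \<Longrightarrow> \<bar>U s - poly (pderiv T) s\<bar> \<le> M * \<bar>s - x0\<bar> ^ (k + 1)"
    and \<Lambda>: "\<And>j t. j \<le> k + 1 \<Longrightarrow> t \<in> {-1..1} \<Longrightarrow> \<bar>poly (legendre j) t\<bar> \<le> \<Lambda>"
    and \<beta>: "\<And>y. y \<in> {0..real k} \<Longrightarrow> \<bar>bspline k y\<bar> \<le> \<beta>"
  obtains q where
    "\<And>i l. i \<le> k \<Longrightarrow> l < k \<Longrightarrow> poly ((pderiv ^^ l) (legendre_sum (k + 1) (q i))) 1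
        = poly ((pderiv ^^ l) (legendre_sum (k + 1) (q (i + 1)))) (-1)"
    "\<And>i j. i \<le> k + 1 \<Longrightarrow> j \<le> k + 1 \<Longrightarrow>
      \<bar>elem_coeff (\<lambda>s. u s - uh s) N x j (i0 + i) - q i j\<bar>
        \<le> (2 * real j + 1) * (M * (real k + 3) ^ (k + 2) * \<Lambda>) * h ^ (k + 2)"
    "\<And>p. p \<le> 2 \<Longrightarrow> \<bar>galerkin_moment k (\<lambda>i. legendre_sum (k + 1) (q i)) p\<bar>
        \<le> (M * (real k + 3) ^ (k + 1) * \<beta> * real k) * h ^ (k + 2)"
proof -
  have h: "h > 0" unfolding h_def by (rule meshsize_pos[OF mesh])
  define Q where "Q i = pcompose (T - P (i0 + i)) [:midpt x (i0 + i), h / 2:]" for i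
  have idx: "i0 + i \<in> {1..N}" if "i \<le> k + 1" for i using i0 that by auto
  have mid: "midpt x (i0 + i) = x i0 + (real i + 1 / 2) * h"
    and right: "x (i0 + i + 1) = x i0 + (real i + 1) * h" and left: "x (i0 + i) = x i0 + real i * h"
    if "i \<le> k + 1" for i
    using uniform[of i] uniform[of "i + 1"] that by (auto simp: midpt_def algebra_simps)
  have elem_eq: "elem x (i0 + i) = {midpt x (i0 + i) - h / 2..midpt x (i0 + i) + h / 2}" if "i \<le> k + 1" for i
    using mid[OF that] right[OF that] left[OF that] by (simp add: elem_def algebra_simps)
  have elem_sub: "elem x (i0 + i) \<subseteq> {x i0..x (i0 + k + 2)}" if "i \<le> k + 1" for i
  proof -
    have "0 \<le> real i * h" "(real i + 1) * h \<le> real (k + 2) * h"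
      using h that by (auto intro!: mult_right_mono)
    then show ?thesis
      using right[OF that] left[OF that] uniform[of "k + 2"] by (auto simp: elem_def add.assoc)
  qed
  have in_ab: "{x i0..x (i0 + k + 2)} \<subseteq> {a..b}" using inside by auto
  have "degree (Q i) \<le> k + 1" if "i \<le> k + 1" for i
    using T_degree P_degree[OF idx[OF that]] h unfolding Q_def degree_pcompose
    by (auto intro!: degree_diff_le)
  then have "\<exists>y. i \<le> k + 1 \<longrightarrow> Q i = legendre_sum (k + 1) y" for i
    using legendre_expansion by blast
  then obtain q where q: "\<And>i. i \<le> k + 1 \<Longrightarrow> Q i = legendre_sum (k + 1) (q i)" by metis
  show thesis
  proof (rule that[of q])
    fix i l assume il: "i \<le> k" "l < k"
    have node: "poly ((pderiv ^^ l) (P (i0 + i))) (x (i0 + i + 1))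
        = poly ((pderiv ^^ l) (P (i0 + (i + 1)))) (x (i0 + i + 1))"
    proof (rule C_space_poly_match[OF uh_smooth open_greaterThanLessThan])
      show "{x (i0 + i)<..<x (i0 + (i + 1) + 1)} \<subseteq> {a<..<b}"
        using mesh_bounds[OF mesh, of "i0 + i"] mesh_bounds[OF mesh, of "i0 + (i + 1) + 1"] i0 il by auto
      show "x (i0 + i) < x (i0 + i + 1)" "x (i0 + i + 1) < x (i0 + (i + 1) + 1)"
        using i0 il by (auto intro!: mesh_strict_mono[OF mesh])
      show "uh s = poly (P (i0 + i)) s" if "x (i0 + i) < s" "s < x (i0 + i + 1)" for s
        using that il by (intro P idx) (auto simp: elem_def)
      show "uh s = poly (P (i0 + (i + 1))) s" if "x (i0 + i + 1) < s" "s < x (i0 + (i + 1) + 1)" for s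
        using that il by (intro P idx) (auto simp: elem_def)
      show "l \<le> k - 1" using il by simp
    qed
    have "poly [:midpt x (i0 + i), h / 2:] 1 = x (i0 + i + 1)"
      "poly [:midpt x (i0 + (i + 1)), h / 2:] (- 1) = x (i0 + i + 1)"
      using mid[of i] mid[of "i + 1"] right[of i] il by (auto simp: algebra_simps)
    then have "poly ((pderiv ^^ l) (Q i)) 1 = poly ((pderiv ^^ l) (Q (i + 1))) (-1)"
      using node unfolding Q_def higher_pderiv_pcompose_linear poly_smult poly_pcompose higher_pderiv_diff
      by (simp only: poly_diff)
    then show "poly ((pderiv ^^ l) (legendre_sum (k + 1) (q i))) 1
        = poly ((pderiv ^^ l) (legendre_sum (k + 1) (q (i + 1)))) (-1)"
      using q[of i] q[of "i + 1"] il by simp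
  next
    fix i j assume ij: "i \<le> k + 1" "j \<le> k + 1"
    let ?s = "\<lambda>t. midpt x (i0 + i) + meshsize N x * t / 2"
    let ?\<rho> = "\<lambda>s. u s - poly T s" and ?L = "poly (legendre j)"
    let ?K = "M * ((real k + 3) * h) ^ (k + 2)"
    have sub: "elem x (i0 + i) \<subseteq> {a..b}" using elem_sub[OF ij(1)] in_ab by blast
    have \<rho>_cont: "continuous_on (elem x (i0 + i)) ?\<rho>"
      by (intro continuous_intros continuous_on_subset[OF u_cont sub])
    have \<rho>_le: "\<bar>?\<rho> s\<bar> \<le> ?K" if "s \<in> elem x (i0 + i)" for s
    proof -
      have "s \<in> {a..b}" "s \<in> {x i0..x (i0 + k + 2)}" using that sub elem_sub[OF ij(1)] by blast+
      then show ?thesis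
        by (intro order.trans[OF T] mult_left_mono power_mono near M) auto
    qed
    have len: "x (i0 + i + 1) - x (i0 + i) = meshsize N x"
      using left[OF ij(1)] right[OF ij(1)] by (simp add: h_def algebra_simps)
    note bound = elem_coeff_bound[OF meshsize_pos[OF mesh] len \<rho>_cont \<rho>_le \<Lambda>[OF ij(2)]]
    have split: "(u (?s t) - uh (?s t)) * ?L t = poly (Q i * legendre j) t + ?\<rho> (?s t) * ?L t"
      if "t \<in> {-1..1}" for t
    proof -
      have "h * t \<le> h * 1" "h * (-1) \<le> h * t"
        using that h mult_left_mono[of t 1 h] mult_left_mono[of "-1" t h] by auto
      then have "?s t \<in> elem x (i0 + i)"
        unfolding elem_eq[OF ij(1)] by (simp add: h_def)
      then have "uh (?s t) = poly (P (i0 + i)) (?s t)" by (rule P[OF idx[OF ij(1)]])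
      moreover have "poly (Q i) t = poly T (?s t) - poly (P (i0 + i)) (?s t)"
        by (simp add: Q_def poly_pcompose h_def mult.commute)
      ultimately show ?thesis unfolding poly_mult distrib_right[symmetric] by simp
    qed
    have "integral {-1..1} (\<lambda>t. (u (?s t) - uh (?s t)) * ?L t)
        = integral {-1..1} (\<lambda>t. poly (Q i * legendre j) t + ?\<rho> (?s t) * ?L t)"
      by (intro integral_cong split)
    also have "\<dots> = defint (Q i * legendre j) + integral {-1..1} (\<lambda>t. ?\<rho> (?s t) * ?L t)"
      unfolding defint_def using bound(1) by (intro integral_add poly_integrable)
    also have "defint (Q i * legendre j) = 2 / (2 * real j + 1) * q i j"
      unfolding q[OF ij(1)] legendre_sum_def using ij(2) by (intro defint_legendre_sum_mult) auto
    finally have "elem_coeff (\<lambda>s. u s - uh s) N x j (i0 + i) = q i j + elem_coeff ?\<rho> N x j (i0 + i)"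
      unfolding elem_coeff_def by (simp add: distrib_left add_nonneg_eq_0_iff)
    then have "\<bar>elem_coeff (\<lambda>s. u s - uh s) N x j (i0 + i) - q i j\<bar> \<le> (2 * real j + 1) * (?K * \<Lambda>)"
      using bound(2) by simp
    then show "\<bar>elem_coeff (\<lambda>s. u s - uh s) N x j (i0 + i) - q i j\<bar>
        \<le> (2 * real j + 1) * (M * (real k + 3) ^ (k + 2) * \<Lambda>) * h ^ (k + 2)"
      by (simp only: power_mult_distrib mult_ac)
  next
    fix p :: nat assume p: "p \<le> 2"
    let ?y = "x (i0 + p)"
    let ?B = "\<lambda>s. bspline k ((s - ?y) / h)" and ?\<rho> = "\<lambda>s. U s - poly (pderiv T) s"
    let ?I = "{x (i0 + p)..x (i0 + p + k)}"
    have y: "?y = x i0 + real p * h" using uniform[of p] p k by auto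
    have y_right: "x (i0 + p + k) = ?y + real k * h"
      using uniform[of "p + k"] y p by (auto simp: algebra_simps add.assoc)
    have I_sub: "?I \<subseteq> {x i0..x (i0 + k + 2)}"
    proof -
      have "0 \<le> real p * h" "real (p + k) * h \<le> real (k + 2) * h"
        using h p by (auto intro!: mult_right_mono)
      then show ?thesis
        using y uniform[of "p + k"] uniform[of "k + 2"] p by (auto simp: add.assoc)
    qed
    have I_ab: "?I \<subseteq> {a..b}" "?I \<subseteq> {a<..<b}" using I_sub inside by auto
    have B_cont: "continuous_on S ?B" for S
      by (intro continuous_on_compose2[OF continuous_on_bspline[of UNIV]] continuous_intros) (use h in auto)
    have int_e: "(\<lambda>s. (U s - H s) * ?B s) integrable_on S" and int_\<rho>: "(\<lambda>s. ?\<rho> s * ?B s) integrable_on S"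
      if "S = {l..r}" "S \<subseteq> ?I" for S l r
    proof -
      have "S \<subseteq> {a..b}" "S \<subseteq> {a<..<b}" using that I_ab by auto
      then show "(\<lambda>s. (U s - H s) * ?B s) integrable_on S" "(\<lambda>s. ?\<rho> s * ?B s) integrable_on S"
        unfolding that(1)
        by (intro integrable_continuous_real continuous_intros B_cont
            continuous_on_subset[OF U_cont] continuous_on_subset[OF H_cont]; simp)+
    qed
    have piece: "integral {-1..1} (\<lambda>t. poly (pderiv (Q (p + i))) t * bspline k (real i + (t + 1) / 2))
        = integral (elem x (i0 + p + i)) (\<lambda>s. (U s - H s) * ?B s) - integral (elem x (i0 + p + i)) (\<lambda>s. ?\<rho> s * ?B s)"
      if i: "i < k" for i
    proof -
      have pi: "p + i \<le> k + 1" using p i by simp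
      let ?j = "i0 + (p + i)"
      let ?m = "midpt x ?j"
      let ?g = "\<lambda>s. poly (pderiv (T - P ?j)) s * ?B s"
      have j: "i0 + p + i = ?j" by simp
      have arg: "bspline k (real i + (t + 1) / 2) = ?B (?m + h * t / 2)" for t
        using h unfolding mid[OF pi] y by (intro arg_cong[where f = "bspline k"]) (simp add: field_simps)
      have "integral {-1..1} (\<lambda>t. poly (pderiv (Q (p + i))) t * bspline k (real i + (t + 1) / 2))
          = integral {-1..1} (\<lambda>t. h / 2 * ?g (?m + h * t / 2))"
        unfolding arg by (intro integral_cong) (simp add: Q_def pderiv_pcompose poly_pcompose pderiv_pCons mult_ac)
      also have "\<dots> = integral (elem x ?j) ?g"
        unfolding elem_eq[OF pi] by (intro integral_affine_change h continuous_intros B_cont)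
      also have "\<dots> = integral (elem x ?j) (\<lambda>s. (U s - H s) * ?B s - ?\<rho> s * ?B s)"
      proof (rule integral_spike[of "{x ?j, x (?j + 1)}"])
        fix s assume "s \<in> elem x ?j - {x ?j, x (?j + 1)}"
        then have "H s = poly (pderiv (P ?j)) s"
          by (intro H_eq_poly idx pi) (auto simp: elem_def)
        then show "(U s - H s) * ?B s - ?\<rho> s * ?B s = ?g s"
          by (simp add: pderiv_diff algebra_simps)
      qed simp
      also have "\<dots> = integral (elem x ?j) (\<lambda>s. (U s - H s) * ?B s) - integral (elem x ?j) (\<lambda>s. ?\<rho> s * ?B s)"
      proof -
        have "elem x ?j \<subseteq> ?I"
        proof -
          have "real p * h \<le> real (p + i) * h" "(real (p + i) + 1) * h \<le> real (p + k) * h"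
            using h i by (auto intro!: mult_right_mono)
          then show ?thesis
            using left[OF pi] right[OF pi] y y_right by (auto simp: elem_def algebra_simps)
        qed
        then show ?thesis
          by (intro integral_diff int_e int_\<rho>) (auto simp: elem_def)
      qed
      finally show ?thesis unfolding j .
    qed
    have step: "x (i0 + p + i) \<le> x (i0 + p + i + 1)" if "i < k" for i
      using i0 p that by (intro mesh_mono[OF mesh]) auto
    have "galerkin_moment k (\<lambda>i. legendre_sum (k + 1) (q i)) p
        = (\<Sum>i<k. integral {-1..1} (\<lambda>t. poly (pderiv (Q (p + i))) t * bspline k (real i + (t + 1) / 2)))"
      unfolding galerkin_moment_def using q p by (intro sum.cong) auto
    also have "\<dots> = (\<Sum>i<k. integral (elem x (i0 + p + i)) (\<lambda>s. (U s - H s) * ?B s))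
        - (\<Sum>i<k. integral (elem x (i0 + p + i)) (\<lambda>s. ?\<rho> s * ?B s))"
      using piece by (simp add: sum_subtractf)
    also have "\<dots> = integral ?I (\<lambda>s. (U s - H s) * ?B s) - integral ?I (\<lambda>s. ?\<rho> s * ?B s)"
      using step by (simp only: sum_integral_elems int_e int_\<rho> subset_refl)
    also have "integral ?I (\<lambda>s. (U s - H s) * ?B s) = 0"
    proof (rule galerkin_bspline[OF h])
      show "x (i0 + p + r) = ?y + real r * h" if "r \<le> k" for r
        using uniform[of "p + r"] y p that by (simp add: algebra_simps add.assoc)
      have "?y \<in> ?I" "x (i0 + p + k) \<in> ?I" using y_right h by auto
      then show "a < ?y" "x (i0 + p + k) < b" using I_ab by auto
    qed (use i0 p in auto)
    finally have "\<bar>galerkin_moment k (\<lambda>i. legendre_sum (k + 1) (q i)) p\<bar> = norm (integral ?I (\<lambda>s. ?\<rho> s * ?B s))"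
      by simp
    also have "\<dots> \<le> (M * ((real k + 3) * h) ^ (k + 1) * \<beta>) * (x (i0 + p + k) - x (i0 + p))"
    proof (rule integral_bound)
      show "x (i0 + p) \<le> x (i0 + p + k)" using y_right h by simp
      show "continuous_on ?I (\<lambda>s. ?\<rho> s * ?B s)"
        by (intro continuous_intros B_cont continuous_on_subset[OF U_cont I_ab(1)])
      fix s assume s: "s \<in> ?I"
      have "(s - ?y) / h \<in> {0..real k}" using s y_right h by (auto simp: field_simps)
      moreover have "\<bar>?\<rho> s\<bar> \<le> M * ((real k + 3) * h) ^ (k + 1)"
      proof -
        have "s \<in> {a..b}" "s \<in> {x i0..x (i0 + k + 2)}" using s I_sub I_ab(1) by blast+
        then show ?thesis
          by (intro order.trans[OF T'] mult_left_mono power_mono near M) auto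
      qed
      ultimately show "norm (?\<rho> s * ?B s) \<le> M * ((real k + 3) * h) ^ (k + 1) * \<beta>"
        using \<beta> h M by (auto simp: abs_mult intro!: mult_mono)
    qed
    also have "\<dots> = (M * (real k + 3) ^ (k + 1) * \<beta> * real k) * h ^ (k + 2)"
      unfolding y_right by (simp add: power_mult_distrib)
    finally show "\<bar>galerkin_moment k (\<lambda>i. legendre_sum (k + 1) (q i)) p\<bar>
        \<le> (M * (real k + 3) ^ (k + 1) * \<beta> * real k) * h ^ (k + 2)" .
  qed
qed

end


section \<open>Elements near the center\<close>

lemma locally_uniform_central_elem:
  assumes mesh: "is_mesh a b N x" and "locally_uniform a b N x x0 d" and d: "d \<ge> 0"
  obtains J i0 where "J \<subseteq> {1..N}" "cball x0 d = (\<Union>i\<in>J. elem x i)"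
    "\<And>i. i \<in> J \<Longrightarrow> x (i + 1) - x i = meshsize N x" "i0 \<in> J" "x0 \<in> elem x i0"
proof -
  obtain J where J: "J \<subseteq> {1..N}" "cball x0 d = (\<Union>i\<in>J. elem x i)"
    "\<forall>i\<in>J. x (i + 1) - x i = meshsize N x"
    using assms(2) by (auto simp: locally_uniform_def)
  moreover have "x0 \<in> cball x0 d" using d by simp
  ultimately show thesis using that by auto
qed

text \<open>If \<open>q\<close> belongs to the uniform part and its right end lies strictly inside the ball, then the
  points just to the right of it must be covered as well, which only the next element can do.\<close>

lemma elements_right_of_center:
  assumes mesh: "is_mesh a b N x" and ball: "ball x0 d \<subseteq> {a<..<b}"
    and J: "J \<subseteq> {1..N}" "cball x0 d = (\<Union>i\<in>J. elem x i)"
    and len: "\<And>i. i \<in> J \<Longrightarrow> x (i + 1) - x i = h"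
    and i0: "i0 \<in> J" "x0 \<in> elem x i0" and h: "h > 0" and d: "d \<ge> (real n + 2) * h"
  shows "\<And>r. r \<le> n \<Longrightarrow> i0 + r \<in> J"
    and "\<And>r. r \<le> n + 1 \<Longrightarrow> x (i0 + r) = x i0 + real r * h"
    and "a < x i0" and "x (i0 + n + 1) < b"
proof -
  have d_gt: "real r * h < d" if "r \<le> n + 1" for r
  proof -
    have "real r * h < (real n + 2) * h" using that h by (intro mult_strict_right_mono) auto
    then show ?thesis using d by simp
  qed
  have d_pos: "d > 0" using d_gt[of 0] by simp
  have "x0 \<in> ball x0 d" using d_pos by simp
  then have "x0 \<in> {a<..<b}" using ball by blast
  then have x0_ab: "a < x0" "x0 < b" by auto
  have right: "x0 + d \<le> b"
  proof (rule ccontr)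
    assume "\<not> x0 + d \<le> b"
    then have "b \<in> ball x0 d" using x0_ab by (auto simp: dist_real_def)
    then show False using ball by auto
  qed
  have left: "a \<le> x0 - d"
  proof (rule ccontr)
    assume "\<not> a \<le> x0 - d"
    then have "a \<in> ball x0 d" using x0_ab by (auto simp: dist_real_def)
    then show False using ball by auto
  qed
  have x0: "x i0 \<le> x0" "x0 \<le> x i0 + h" using i0 len[OF i0(1)] by (auto simp: elem_def)
  have main: "i0 + r \<in> J \<and> x (i0 + r) = x i0 + real r * h" if "r \<le> n" for r
    using that
  proof (induction r)
    case 0
    then show ?case using i0 by simp
  next
    case (Suc r)
    let ?q = "i0 + r"
    have q: "?q \<in> J" "x ?q = x i0 + real r * h" using Suc by auto
    have xq: "x (?q + 1) = x i0 + real (Suc r) * h"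
      using len[OF q(1)] q(2) by (simp add: algebra_simps)
    then have lt: "x (?q + 1) < x0 + d" using d_gt[of "Suc r"] Suc.prems x0 by simp
    have "?q \<in> {1..N}" using q(1) J(1) by blast
    moreover have "?q \<noteq> N" using lt right mesh by (auto simp: is_mesh_def)
    ultimately have qN: "1 \<le> ?q" "?q + 1 \<le> N" by auto
    have "x (?q + 1) < x (?q + 2)" using qN by (intro mesh_strict_mono[OF mesh]) auto
    then obtain y where y: "x (?q + 1) < y" "y < x (?q + 2)" "y < x0 + d"
      using dense[of "x (?q + 1)" "min (x (?q + 2)) (x0 + d)"] lt by auto
    have "x (?q + 1) \<in> elem x ?q" using len[OF q(1)] h by (simp add: elem_def)
    then have "x (?q + 1) \<in> cball x0 d" unfolding J(2) using q(1) by blast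
    then have "y \<in> cball x0 d" using y by (auto simp: dist_real_def)
    then obtain j where j: "j \<in> J" "y \<in> elem x j" unfolding J(2) by blast
    then have jN: "1 \<le> j" "j \<le> N" using J(1) by auto
    have "\<not> j + 1 \<le> ?q + 1"
      using mesh_mono[OF mesh, of "j + 1" "?q + 1"] j(2) y(1) jN qN by (auto simp: elem_def)
    moreover have "\<not> ?q + 2 \<le> j"
      using mesh_mono[OF mesh, of "?q + 2" j] j(2) y(2) jN qN by (auto simp: elem_def)
    ultimately have "j = ?q + 1" by simp
    then show ?case using j(1) xq by simp
  qed
  then show "i0 + r \<in> J" if "r \<le> n" for r using that by blast
  show uniform: "x (i0 + r) = x i0 + real r * h" if r: "r \<le> n + 1" for r
  proof (cases "r \<le> n")
    case True
    then show ?thesis using main by blast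
  next
    case False
    then have "r = Suc n" using r by simp
    then show ?thesis using main[of n] len[of "i0 + n"] by (simp add: algebra_simps)
  qed
  show "a < x i0" using left d_gt[of 1] x0 by simp
  show "x (i0 + n + 1) < b"
    using uniform[of "n + 1"] d_gt[of "n + 1"] x0 right by (simp add: add.assoc)
qed


section \<open>Taylor polynomials\<close>

lemma taylor_polynomial:
  assumes u: "u \<in> C_space (n + 1) {a..b}" and n: "n \<ge> 1" and x0: "x0 \<in> {a..b}"
  obtains U M and T :: "real poly" where "continuous_on {a..b} U"
    "\<And>s. s \<in> {a..b} \<Longrightarrow> (u has_real_derivative U s) (at s within {a..b})"
    "degree T \<le> n" "M \<ge> 0"
    "\<And>s. s \<in> {a..b} \<Longrightarrow> \<bar>u s - poly T s\<bar> \<le> M * \<bar>s - x0\<bar> ^ (n + 1)"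
    "\<And>s. s \<in> {a..b} \<Longrightarrow> \<bar>U s - poly (pderiv T) s\<bar> \<le> M * \<bar>s - x0\<bar> ^ n"
proof -
  from u obtain D where D: "\<And>s. s \<in> {a..b} \<Longrightarrow> D 0 s = u s"
    "\<And>i s. i < n + 1 \<Longrightarrow> s \<in> {a..b} \<Longrightarrow> (D i has_real_derivative D (Suc i) s) (at s within {a..b})"
    "\<And>i. i \<le> n + 1 \<Longrightarrow> continuous_on {a..b} (D i)" by (rule C_spaceE) blast
  have "bounded (D (n + 1) ` {a..b})"
    by (intro compact_imp_bounded compact_continuous_image D(3)) auto
  then obtain B where B: "\<And>s. s \<in> {a..b} \<Longrightarrow> norm (D (n + 1) s) \<le> B"
    unfolding bounded_iff by blast
  have B0: "B \<ge> 0" using B[OF x0] by (meson norm_ge_zero order.trans)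
  have le: "B * y / fact m \<le> B * y" if "y \<ge> 0" for y m
  proof -
    have "B * y * 1 \<le> B * y * fact m" using B0 that by (intro mult_left_mono fact_ge_1) auto
    then show ?thesis by (simp add: divide_le_eq)
  qed
  define T where "T = (\<Sum>i\<le>n. smult (D i x0 / fact i) ([:- x0, 1:] ^ i))"
  have T: "poly T s = (\<Sum>i\<le>n. D i x0 * (s - x0) ^ i / fact i)" for s
    by (simp add: T_def poly_sum)
  obtain n' where n': "n = Suc n'" using n by (cases n) auto
  have T': "poly (pderiv T) s = (\<Sum>i\<le>n'. D (Suc i) x0 * (s - x0) ^ i / fact i)" for s
  proof -
    have "poly (pderiv T) s = (\<Sum>i\<le>n. D i x0 / fact i * (real i * (s - x0) ^ (i - 1)))"
      unfolding T_def higher_pderiv_sum[of 1, simplified] pderiv_smult pderiv_power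
      by (simp add: poly_sum pderiv_pCons mult.assoc)
    also have "\<dots> = (\<Sum>i\<le>n'. D (Suc i) x0 / fact (Suc i) * (real (Suc i) * (s - x0) ^ i))"
      unfolding n' sum.atMost_Suc_shift by simp
    also have "\<dots> = (\<Sum>i\<le>n'. D (Suc i) x0 * (s - x0) ^ i / fact i)"
      by (intro sum.cong refl) (simp add: divide_simps)
    finally show ?thesis .
  qed
  show thesis
  proof (rule that[of "D 1" T B])
    show "continuous_on {a..b} (D 1)" by (intro D(3)) simp
    show "(u has_real_derivative D 1 s) (at s within {a..b})" if "s \<in> {a..b}" for s
      using D(2)[of 0 s] that
      by (intro has_field_derivative_transform_within[of "D 0" "D 1 s" s "{a..b}" 1 u]) (auto simp: D(1))
    show "degree T \<le> n"
      unfolding T_def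
      by (intro degree_sum_le order.trans[OF degree_smult_le]) (auto simp: degree_linear_power)
    show "B \<ge> 0" by (rule B0)
    fix s assume s: "s \<in> {a..b}"
    have "norm (D 0 s - (\<Sum>i\<le>n. D i x0 * (s - x0) ^ i / fact i)) \<le> B * norm (s - x0) ^ Suc n / fact n"
      by (rule field_Taylor[of "{a..b}" n D B x0 s]) (use D B x0 s in auto)
    also have "\<dots> \<le> B * norm (s - x0) ^ Suc n" by (rule le) simp
    finally show "\<bar>u s - poly T s\<bar> \<le> B * \<bar>s - x0\<bar> ^ (n + 1)" using D(1)[OF s] T by simp
    have "norm (D (Suc 0) s - (\<Sum>i\<le>n'. D (Suc i) x0 * (s - x0) ^ i / fact i)) \<le> B * norm (s - x0) ^ Suc n' / fact n'"
      by (rule field_Taylor[of "{a..b}" n' "\<lambda>i. D (Suc i)" B x0 s]) (use D B x0 s n' in auto)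
    also have "\<dots> \<le> B * norm (s - x0) ^ Suc n'" by (rule le) simp
    finally show "\<bar>D 1 s - poly (pderiv T) s\<bar> \<le> B * \<bar>s - x0\<bar> ^ n" using T' by (simp add: n')
  qed
qed

lemma bspline_bounded: "\<exists>\<beta>. \<forall>y\<in>{0..real k}. \<bar>bspline k y\<bar> \<le> \<beta>"
proof -
  have "bounded (bspline k ` {0..real k})"
    by (intro compact_imp_bounded compact_continuous_image continuous_on_bspline) auto
  then show ?thesis unfolding bounded_iff by auto
qed

lemma legendre_bounded: "\<exists>\<Lambda>. \<forall>j\<le>n. \<forall>t\<in>{-1..1}. \<bar>poly (legendre j) t\<bar> \<le> \<Lambda>"
proof -
  have "bounded (\<Union>j\<le>n. poly (legendre j) ` {-1..1})"
    by (intro bounded_UN ballI compact_imp_bounded compact_continuous_image continuous_intros) auto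
  then show ?thesis unfolding bounded_iff by auto
qed

section \<open>The ratio of the leading-order coefficients\<close>

lemma galerkin_error_exists:
  assumes "a < b" "k \<ge> 2" and mesh: "is_mesh a b N x"
    and "continuous_on {a..b} U"
    and "\<And>s. s \<in> {a..b} \<Longrightarrow> (u has_real_derivative U s) (at s within {a..b})"
    and "u a = 0" "u b = 0" and galerkin: "galerkin_solution a b N x k (k - 1) u uh"
  shows "\<exists>H P. galerkin_error a b N x k u uh U H P"
proof -
  have spline: "uh \<in> spline_space a b N x k (k - 1)"
    using galerkin by (simp add: galerkin_solution_def V_space_def)
  then have "uh \<in> C_space (k - 1) {a<..<b}" by (simp add: spline_space_def)
  then obtain H where H: "continuous_on {a<..<b} H"
    "\<And>s. s \<in> {a<..<b} \<Longrightarrow> (uh has_real_derivative H s) (at s within {a<..<b})"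
    by (rule C_space_derivative) (use \<open>k \<ge> 2\<close> in auto)
  have "\<forall>i\<in>{1..N}. \<exists>p :: real poly. degree p \<le> k \<and> (\<forall>s\<in>elem x i. uh s = poly p s)"
    using spline by (simp add: spline_space_def)
  then obtain P :: "nat \<Rightarrow> real poly" where P: "\<forall>i\<in>{1..N}. degree (P i) \<le> k \<and> (\<forall>s\<in>elem x i. uh s = poly (P i) s)"
    by metis
  have "galerkin_error a b N x k u uh U H P"
  proof
    show "(uh has_real_derivative H s) (at s)" if "s \<in> {a<..<b}" for s
      using H(2)[OF that] by (simp only: at_within_open[OF that open_greaterThanLessThan])
    show "degree (P i) \<le> k" if "i \<in> {1..N}" for i using P that by blast
    show "uh s = poly (P i) s" if "i \<in> {1..N}" "s \<in> elem x i" for i s using P that by blast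
  qed (fact assms H(1))+
  then show ?thesis by blast
qed

text \<open>Both the \<open>c j\<close> and the \<open>q i j\<close> of \<open>local_error_pattern\<close> are close to the coefficients of the error
  on the \<open>i\<close>-th element.  Hence the \<open>q i j\<close> hardly depend on \<open>i\<close>, the linear algebra applies to them, and its
  conclusion carries over to \<open>c\<close>.\<close>

lemma (in galerkin_error) fine_mesh_bound:
  fixes \<gamma> c :: "nat \<Rightarrow> real" and x0 d M Lc \<beta> \<Lambda> Ca :: real and T :: "real poly"
  defines "h \<equiv> meshsize N x"
  defines "K1 \<equiv> (2 * real k + 3) * (M * (real k + 3) ^ (k + 2) * \<Lambda>)"
  defines "K2 \<equiv> M * (real k + 3) ^ (k + 1) * \<beta> * real k"
  assumes loc: "locally_uniform a b N x x0 d" and d: "d \<ge> (real k + 3) * h"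
    and T_degree: "degree T \<le> k + 1" and M: "M \<ge> 0"
    and T: "\<And>s. s \<in> {a..b} \<Longrightarrow> \<bar>u s - poly T s\<bar> \<le> M * \<bar>s - x0\<bar> ^ (k + 2)"
    and T': "\<And>s. s \<in> {a..b} \<Longrightarrow> \<bar>U s - poly (pderiv T) s\<bar> \<le> M * \<bar>s - x0\<bar> ^ (k + 1)"
    and \<Lambda>: "\<And>j t. j \<le> k + 1 \<Longrightarrow> t \<in> {-1..1} \<Longrightarrow> \<bar>poly (legendre j) t\<bar> \<le> \<Lambda>"
    and \<beta>: "\<And>y. y \<in> {0..real k} \<Longrightarrow> \<bar>bspline k y\<bar> \<le> \<beta>"
    and lead: "\<And>i j. i \<in> {1..N} \<Longrightarrow> j \<in> \<U> k - {0} \<Longrightarrow> elem x i \<subseteq> cball x0 d \<Longrightarrow>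
      \<bar>midpt x i - x0\<bar> \<le> (real k + 3) * h \<Longrightarrow>
      \<bar>elem_coeff (\<lambda>s. u s - uh s) N x j i - c j\<bar> \<le> Lc * h ^ (k + 2)"
    and j: "j \<in> \<U> k - {0}"
    and pattern: "\<And>q \<epsilon>.
      \<forall>i\<le>k. \<forall>l<k. poly ((pderiv ^^ l) (legendre_sum (k + 1) (q i))) 1
        = poly ((pderiv ^^ l) (legendre_sum (k + 1) (q (i + 1)))) (-1) \<Longrightarrow>
      \<forall>i\<le>k. \<forall>j\<in>\<U> k - {0}. \<bar>q i j - q (i + 1) j\<bar> \<le> \<epsilon> \<Longrightarrow>
      \<forall>p\<le>2. \<bar>galerkin_moment k (\<lambda>i. legendre_sum (k + 1) (q i)) p\<bar> \<le> \<epsilon> \<Longrightarrow>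
      \<epsilon> \<ge> 0 \<Longrightarrow> \<bar>q 0 j - \<rho> * q 0 (k + 1)\<bar> \<le> Ca * \<epsilon>"
  shows "\<bar>c j - \<rho> * c (k + 1)\<bar> \<le> (Ca * (2 * (\<bar>K1\<bar> + \<bar>Lc\<bar>) + \<bar>K2\<bar>) + (1 + \<bar>\<rho>\<bar>) * (\<bar>K1\<bar> + \<bar>Lc\<bar>)) * h ^ (k + 2)"
proof -
  have h: "h > 0" unfolding h_def by (rule meshsize_pos[OF mesh])
  have "0 \<le> (real k + 3) * h" using h by simp
  then have "d \<ge> 0" using d by simp
  from locally_uniform_central_elem[OF mesh loc this] obtain J i0 where
    J: "J \<subseteq> {1..N}" "cball x0 d = (\<Union>i\<in>J. elem x i)"
    and len: "\<And>i. i \<in> J \<Longrightarrow> x (i + 1) - x i = h" and i0: "i0 \<in> J" "x0 \<in> elem x i0"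
    unfolding h_def by metis
  have ball: "ball x0 d \<subseteq> {a<..<b}" using loc by (simp add: locally_uniform_def)
  have "real (k + 1) + 2 = real k + 3" by simp
  then have d': "d \<ge> (real (k + 1) + 2) * h" using d by (simp only:)
  note right = elements_right_of_center[OF mesh ball J len i0 h d']
  have in_J: "i0 + i \<in> J" if "i \<le> k + 1" for i using right(1) that by blast
  have uniform: "x (i0 + r) = x i0 + real r * h" if "r \<le> k + 2" for r using right(2) that by simp
  have inside: "a < x i0" "x (i0 + k + 2) < b" using right(3,4) by (simp_all add: add.assoc)
  have x0: "x i0 \<le> x0" "x0 \<le> x i0 + h" using i0 len[OF i0(1)] by (auto simp: elem_def)
  have near: "\<bar>s - x0\<bar> \<le> (real k + 3) * h" if "s \<in> {x i0..x (i0 + k + 2)}" for s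
  proof -
    have "x (i0 + k + 2) = x i0 + (real k + 2) * h" using uniform[of "k + 2"] by (simp add: add.assoc)
    then have "s - x0 \<le> (real k + 2) * h" "x0 - s \<le> h" using that x0 by auto
    moreover have "(real k + 2) * h \<le> (real k + 3) * h" "1 * h \<le> (real k + 3) * h"
      using h by (auto intro!: mult_right_mono)
    ultimately show ?thesis by simp
  qed
  have "i0 + (k + 1) \<in> {1..N}" "i0 \<in> {1..N}" using in_J[of "k + 1"] J(1) i0(1) by blast+
  then have i0N: "i0 \<ge> 1" "i0 + k + 1 \<le> N" by auto
  obtain q where
    match: "\<And>i l. i \<le> k \<Longrightarrow> l < k \<Longrightarrow> poly ((pderiv ^^ l) (legendre_sum (k + 1) (q i))) 1
        = poly ((pderiv ^^ l) (legendre_sum (k + 1) (q (i + 1)))) (-1)"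
    and coeff: "\<And>i j. i \<le> k + 1 \<Longrightarrow> j \<le> k + 1 \<Longrightarrow>
      \<bar>elem_coeff (\<lambda>s. u s - uh s) N x j (i0 + i) - q i j\<bar>
        \<le> (2 * real j + 1) * (M * (real k + 3) ^ (k + 2) * \<Lambda>) * h ^ (k + 2)"
    and moment: "\<And>p. p \<le> 2 \<Longrightarrow> \<bar>galerkin_moment k (\<lambda>i. legendre_sum (k + 1) (q i)) p\<bar> \<le> K2 * h ^ (k + 2)"
    unfolding K2_def h_def
    by (rule local_error_pattern[OF i0N uniform[unfolded h_def] inside near[unfolded h_def] T_degree M T T' \<Lambda> \<beta>])
      blast+
  have \<Lambda>0: "\<Lambda> \<ge> 0" by (rule order.trans[OF abs_ge_zero \<Lambda>[of 0 0]]) auto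
  let ?D = "(\<bar>K1\<bar> + \<bar>Lc\<bar>) * h ^ (k + 2)"
  have q_c: "\<bar>q i j - c j\<bar> \<le> ?D" if "i \<le> k + 1" "j \<in> \<U> k - {0}" for i j
  proof -
    have jk: "j \<le> k + 1" using that(2) by (auto simp: \<U>_def)
    have "midpt x (i0 + i) \<in> {x i0..x (i0 + k + 2)}"
    proof -
      have "midpt x (i0 + i) = x i0 + (real i + 1 / 2) * h"
        using uniform[of i] uniform[of "i + 1"] that(1) by (simp add: midpt_def algebra_simps)
      moreover have "0 \<le> (real i + 1 / 2) * h" "(real i + 1 / 2) * h \<le> real (k + 2) * h"
        using h that(1) by (auto intro!: mult_right_mono)
      ultimately show ?thesis using uniform[of "k + 2"] by (simp add: add.assoc)
    qed
    moreover have "elem x (i0 + i) \<subseteq> cball x0 d" unfolding J(2) using in_J[OF that(1)] by blast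
    moreover have "i0 + i \<in> {1..N}" using in_J[OF that(1)] J(1) by blast
    ultimately have "\<bar>elem_coeff (\<lambda>s. u s - uh s) N x j (i0 + i) - c j\<bar> \<le> Lc * h ^ (k + 2)"
      using that(2) by (intro lead near)
    moreover have "(2 * real j + 1) * (M * (real k + 3) ^ (k + 2) * \<Lambda>) \<le> K1"
      unfolding K1_def using jk M \<Lambda>0 by (intro mult_right_mono) auto
    then have "(2 * real j + 1) * (M * (real k + 3) ^ (k + 2) * \<Lambda>) * h ^ (k + 2) \<le> K1 * h ^ (k + 2)"
      using h by (intro mult_right_mono) auto
    ultimately have "\<bar>q i j - c j\<bar> \<le> K1 * h ^ (k + 2) + Lc * h ^ (k + 2)"
      using coeff[OF that(1) jk] by linarith
    also have "\<dots> = (K1 + Lc) * h ^ (k + 2)" by (simp add: distrib_right)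
    also have "\<dots> \<le> ?D" using h by (intro mult_right_mono) auto
    finally show ?thesis .
  qed
  let ?\<epsilon> = "(2 * (\<bar>K1\<bar> + \<bar>Lc\<bar>) + \<bar>K2\<bar>) * h ^ (k + 2)"
  have \<epsilon>: "?\<epsilon> = 2 * ?D + \<bar>K2\<bar> * h ^ (k + 2)" by (simp add: algebra_simps)
  have nonneg: "0 \<le> \<bar>K2\<bar> * h ^ (k + 2)" "0 \<le> ?D" using h by auto
  have "\<bar>q 0 j - \<rho> * q 0 (k + 1)\<bar> \<le> Ca * ?\<epsilon>"
  proof (rule pattern)
    show "\<forall>i\<le>k. \<forall>j\<in>\<U> k - {0}. \<bar>q i j - q (i + 1) j\<bar> \<le> ?\<epsilon>"
    proof (intro allI impI ballI)
      fix i j assume "i \<le> k" "j \<in> \<U> k - {0}"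
      then have "\<bar>q i j - c j\<bar> \<le> ?D" "\<bar>q (i + 1) j - c j\<bar> \<le> ?D" by - (rule q_c; simp)+
      then show "\<bar>q i j - q (i + 1) j\<bar> \<le> ?\<epsilon>"
        unfolding \<epsilon> using nonneg(1) by linarith
    qed
    show "\<forall>p\<le>2. \<bar>galerkin_moment k (\<lambda>i. legendre_sum (k + 1) (q i)) p\<bar> \<le> ?\<epsilon>"
    proof (intro allI impI)
      fix p :: nat assume "p \<le> 2"
      moreover have "K2 * h ^ (k + 2) \<le> \<bar>K2\<bar> * h ^ (k + 2)" using h by (intro mult_right_mono) auto
      ultimately show "\<bar>galerkin_moment k (\<lambda>i. legendre_sum (k + 1) (q i)) p\<bar> \<le> ?\<epsilon>"
        unfolding \<epsilon> using moment[of p] nonneg by linarith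
    qed
    show "?\<epsilon> \<ge> 0" unfolding \<epsilon> using nonneg by linarith
  qed (use match in auto)
  moreover have "\<bar>c j - q 0 j\<bar> \<le> ?D" using q_c[of 0 j] j by simp
  moreover have "\<bar>\<rho> * q 0 (k + 1) - \<rho> * c (k + 1)\<bar> \<le> \<bar>\<rho>\<bar> * ?D"
  proof -
    have "k + 1 \<in> \<U> k - {0}" by (simp add: \<U>_def)
    then have "\<bar>\<rho>\<bar> * \<bar>q 0 (k + 1) - c (k + 1)\<bar> \<le> \<bar>\<rho>\<bar> * ?D" by (intro mult_left_mono q_c) auto
    then show ?thesis by (simp only: abs_mult[symmetric] right_diff_distrib)
  qed
  ultimately have "\<bar>c j - \<rho> * c (k + 1)\<bar> \<le> Ca * ?\<epsilon> + ?D + \<bar>\<rho>\<bar> * ?D" by linarith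
  also have "\<dots> = (Ca * (2 * (\<bar>K1\<bar> + \<bar>Lc\<bar>) + \<bar>K2\<bar>) + (1 + \<bar>\<rho>\<bar>) * (\<bar>K1\<bar> + \<bar>Lc\<bar>)) * h ^ (k + 2)"
    by (simp only: distrib_right mult_1_left mult.assoc add.assoc)
  finally show ?thesis .
qed

text \<open>If \<open>h\<close> is bounded below, then \<open>O(h\<^bsup>k+2\<^esup>)\<close> means no more than bounded.  The element that
  contains \<open>x0\<close> is enough to bound the \<open>c j\<close>, as the error itself is bounded.\<close>

lemma (in galerkin_error) coarse_mesh_bound:
  fixes c :: "nat \<Rightarrow> real" and x0 d Lc \<Lambda> \<rho> :: real
  defines "h \<equiv> meshsize N x"
  defines "K \<equiv> ((b - a) + integral {a..b} (\<lambda>s. (U s)\<^sup>2)) / 2"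
  assumes loc: "locally_uniform a b N x x0 d" and d: "d \<ge> 0" and coarse: "h \<ge> exp (-1)"
    and \<Lambda>: "\<And>j t. j \<le> k + 1 \<Longrightarrow> t \<in> {-1..1} \<Longrightarrow> \<bar>poly (legendre j) t\<bar> \<le> \<Lambda>"
    and lead: "\<And>i j. i \<in> {1..N} \<Longrightarrow> j \<in> \<U> k - {0} \<Longrightarrow> elem x i \<subseteq> cball x0 d \<Longrightarrow>
      \<bar>midpt x i - x0\<bar> \<le> (real k + 3) * h \<Longrightarrow>
      \<bar>elem_coeff (\<lambda>s. u s - uh s) N x j i - c j\<bar> \<le> Lc * h ^ (k + 2)"
    and j: "j \<in> \<U> k - {0}"
  shows "\<bar>c j - \<rho> * c (k + 1)\<bar> \<le> (1 + \<bar>\<rho>\<bar>) * ((2 * real k + 3) * (K * \<Lambda>) * exp 1 ^ (k + 2) + Lc) * h ^ (k + 2)"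
proof -
  have h: "h > 0" unfolding h_def by (rule meshsize_pos[OF mesh])
  from locally_uniform_central_elem[OF mesh loc d] obtain J i0 where
    J: "J \<subseteq> {1..N}" "cball x0 d = (\<Union>i\<in>J. elem x i)"
    and len: "\<And>i. i \<in> J \<Longrightarrow> x (i + 1) - x i = h" and i0: "i0 \<in> J" "x0 \<in> elem x i0"
    unfolding h_def by metis
  have i0N: "i0 \<in> {1..N}" using i0 J by blast
  have sub: "elem x i0 \<subseteq> cball x0 d" unfolding J(2) using i0 by blast
  have "\<bar>midpt x i0 - x0\<bar> \<le> h"
    using i0(2) len[OF i0(1)] h by (auto simp: elem_def midpt_def field_simps abs_le_iff)
  also have "1 * h \<le> (real k + 3) * h" using h by (intro mult_right_mono) auto
  finally have mid: "\<bar>midpt x i0 - x0\<bar> \<le> (real k + 3) * h" by simp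
  have ab': "elem x i0 \<subseteq> {a..b}" by (rule elem_subset[OF mesh i0N])
  have e_cont: "continuous_on (elem x i0) (\<lambda>s. u s - uh s)"
    by (intro continuous_on_diff continuous_on_subset[OF u_cont] continuous_on_subset[OF uh_cont] ab')
  have e_le: "\<bar>u s - uh s\<bar> \<le> K" if "s \<in> elem x i0" for s
    unfolding K_def using that ab' by (intro energy_bound) auto
  have K: "K \<ge> 0" using e_le[OF i0(2)] by linarith
  have \<Lambda>0: "\<Lambda> \<ge> 0" by (rule order.trans[OF abs_ge_zero \<Lambda>[of 0 0]]) auto
  have len0: "x (i0 + 1) - x i0 = meshsize N x" using len[OF i0(1)] by (simp add: h_def)
  let ?S = "(2 * real k + 3) * (K * \<Lambda>)"
  have "exp 1 * exp (- 1) = (1 :: real)" by (simp flip: exp_add)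
  then have "1 = (exp 1 * exp (- 1) :: real) ^ (k + 2)" by (simp only: power_one)
  also have "\<dots> \<le> (exp 1 * h) ^ (k + 2)" using coarse by (intro power_mono mult_left_mono) auto
  finally have big: "1 \<le> exp 1 ^ (k + 2) * h ^ (k + 2)" by (simp only: power_mult_distrib)
  let ?C = "(?S * exp 1 ^ (k + 2) + Lc) * h ^ (k + 2)"
  have c: "\<bar>c j\<bar> \<le> ?C" if "j \<in> \<U> k - {0}" for j
  proof -
    have jk: "j \<le> k + 1" using that by (auto simp: \<U>_def)
    have "\<bar>elem_coeff (\<lambda>s. u s - uh s) N x j i0\<bar> \<le> (2 * real j + 1) * (K * \<Lambda>)"
      by (rule elem_coeff_bound(2)[OF meshsize_pos[OF mesh] len0 e_cont e_le \<Lambda>[OF jk]])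
    also have "\<dots> \<le> ?S" using jk K \<Lambda>0 by (intro mult_right_mono) auto
    also have "\<dots> \<le> ?S * (exp 1 ^ (k + 2) * h ^ (k + 2))"
      using mult_left_mono[OF big, of ?S] K \<Lambda>0 by simp
    finally have "\<bar>c j\<bar> \<le> ?S * (exp 1 ^ (k + 2) * h ^ (k + 2)) + Lc * h ^ (k + 2)"
      using lead[OF i0N that sub mid] by linarith
    then show ?thesis by (simp only: distrib_right mult.assoc)
  qed
  have "k + 1 \<in> \<U> k - {0}" by (simp add: \<U>_def)
  then have "\<bar>\<rho>\<bar> * \<bar>c (k + 1)\<bar> \<le> \<bar>\<rho>\<bar> * ?C" by (intro mult_left_mono c) auto
  then have "\<bar>c j - \<rho> * c (k + 1)\<bar> \<le> ?C + \<bar>\<rho>\<bar> * ?C"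
    using c[OF j] abs_triangle_ineq4[of "c j" "\<rho> * c (k + 1)"] by (simp add: abs_mult)
  then show ?thesis by (simp only: distrib_right mult_1_left mult.assoc)
qed

theorem lemma4p10:
  fixes k :: nat and \<gamma> :: "nat \<Rightarrow> real" and \<sigma> :: real
  assumes "k \<ge> 2"
    and "(calF ^^ k) (legendre 1) = (\<Sum>j\<in>\<U> k - {0}. smult (\<gamma> j) (legendre j))"
  shows "\<exists>C0>0. \<forall>Cstar\<ge>C0.
    \<forall>(a :: real) b u f x0 (N :: 'm \<Rightarrow> nat) (x :: 'm \<Rightarrow> nat \<Rightarrow> real) (d :: 'm \<Rightarrow> real)
      (uh :: 'm \<Rightarrow> real \<Rightarrow> real) (c :: 'm \<Rightarrow> nat \<Rightarrow> real).
      a < b \<longrightarrow>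
      u \<in> C_space (k + 2) {a..b} \<longrightarrow>
      (\<forall>s\<in>{a<..<b}. - deriv (deriv u) s = f s) \<longrightarrow>
      u a = 0 \<longrightarrow> u b = 0 \<longrightarrow>
      (\<forall>m. is_mesh a b (N m) (x m)) \<longrightarrow>
      (\<forall>m. quasi_uniform \<sigma> (N m) (x m)) \<longrightarrow>
      x0 \<in> {a<..<b} \<longrightarrow>
      (\<forall>m. d m \<ge> Cstar * meshsize (N m) (x m) * \<bar>ln (meshsize (N m) (x m))\<bar>) \<longrightarrow>
      (\<forall>m. locally_uniform a b (N m) (x m) x0 (d m)) \<longrightarrow>
      (\<forall>m. galerkin_solution a b (N m) (x m) k (k - 1) u (uh m)) \<longrightarrow>
      (\<forall>j\<in>\<U> k - {0}.
         leading_coeff N x x0 d (\<lambda>m s. u s - uh m s) k j (\<lambda>m. c m j)) \<longrightarrow>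
      (\<forall>j\<in>\<U> k - {0, k + 1}. \<exists>C. \<forall>m.
         \<bar>c m j - \<gamma> j / \<gamma> (k + 1) * c m (k + 1)\<bar> \<le> C * meshsize (N m) (x m) ^ (k + 2))"
  \<comment> \<open>The \<open>k + 2\<close> elements begin with the one that contains \<open>x0\<close>, so they end at most \<open>(k + 2) h\<close> to the
  right of \<open>x0\<close>; the additional \<open>h\<close> keeps them inside the open interval.\<close>
proof (rule exI[of _ "real k + 3"], intro conjI allI impI ballI)
  fix Cstar a b x0 :: real and u f :: "real \<Rightarrow> real" and N :: "'m \<Rightarrow> nat" and x :: "'m \<Rightarrow> nat \<Rightarrow> real"
    and d :: "'m \<Rightarrow> real" and uh :: "'m \<Rightarrow> real \<Rightarrow> real" and c :: "'m \<Rightarrow> nat \<Rightarrow> real" and j :: nat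
  assume Cstar: "Cstar \<ge> real k + 3" and ab: "a < b" and u: "u \<in> C_space (k + 2) {a..b}"
    and u_boundary: "u a = 0" "u b = 0" and mesh: "\<forall>m. is_mesh a b (N m) (x m)"
    and x0: "x0 \<in> {a<..<b}"
    and d: "\<forall>m. d m \<ge> Cstar * meshsize (N m) (x m) * \<bar>ln (meshsize (N m) (x m))\<bar>"
    and loc: "\<forall>m. locally_uniform a b (N m) (x m) x0 (d m)"
    and galerkin: "\<forall>m. galerkin_solution a b (N m) (x m) k (k - 1) u (uh m)"
    and lead: "\<forall>j\<in>\<U> k - {0}. leading_coeff N x x0 d (\<lambda>m s. u s - uh m s) k j (\<lambda>m. c m j)"
    and j: "j \<in> \<U> k - {0, k + 1}"
  let ?h = "\<lambda>m. meshsize (N m) (x m)" and ?\<rho> = "\<gamma> j / \<gamma> (k + 1)"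
  have j': "j \<in> \<U> k - {0}" using j by auto
  have u': "u \<in> C_space (k + 1 + 1) {a..b}" and n: "k + 1 \<ge> 1" and x0': "x0 \<in> {a..b}" using u x0 by auto
  obtain U M and T :: "real poly" where U: "continuous_on {a..b} U"
    "\<And>s. s \<in> {a..b} \<Longrightarrow> (u has_real_derivative U s) (at s within {a..b})"
    and T: "degree T \<le> k + 1" "M \<ge> 0"
    "\<And>s. s \<in> {a..b} \<Longrightarrow> \<bar>u s - poly T s\<bar> \<le> M * \<bar>s - x0\<bar> ^ (k + 1 + 1)"
    "\<And>s. s \<in> {a..b} \<Longrightarrow> \<bar>U s - poly (pderiv T) s\<bar> \<le> M * \<bar>s - x0\<bar> ^ (k + 1)"
    by (rule taylor_polynomial[OF u' n x0']) blast
  have T3: "\<bar>u s - poly T s\<bar> \<le> M * \<bar>s - x0\<bar> ^ (k + 2)" if "s \<in> {a..b}" for s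
    using T(3)[OF that] by simp
  obtain \<Lambda> where \<Lambda>: "\<And>j t. j \<le> k + 1 \<Longrightarrow> t \<in> {-1..1} \<Longrightarrow> \<bar>poly (legendre j) t\<bar> \<le> \<Lambda>"
    using legendre_bounded[of "k + 1"] by blast
  obtain \<beta> where \<beta>: "\<And>y. y \<in> {0..real k} \<Longrightarrow> \<bar>bspline k y\<bar> \<le> \<beta>"
    using bspline_bounded[of k] by blast
  obtain Ca where Ca: "Ca \<ge> 0" and pattern: "\<And>q \<epsilon>.
      \<forall>i\<le>k. \<forall>l<k. poly ((pderiv ^^ l) (legendre_sum (k + 1) (q i))) 1
        = poly ((pderiv ^^ l) (legendre_sum (k + 1) (q (i + 1)))) (-1) \<Longrightarrow>
      \<forall>i\<le>k. \<forall>j\<in>\<U> k - {0}. \<bar>q i j - q (i + 1) j\<bar> \<le> \<epsilon> \<Longrightarrow>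
      \<forall>p\<le>2. \<bar>galerkin_moment k (\<lambda>i. legendre_sum (k + 1) (q i)) p\<bar> \<le> \<epsilon> \<Longrightarrow>
      \<epsilon> \<ge> 0 \<Longrightarrow> \<bar>q 0 j - ?\<rho> * q 0 (k + 1)\<bar> \<le> Ca * \<epsilon>"
    using error_pattern_almost_proportional[OF assms j'] by blast
  have "\<forall>j\<in>\<U> k - {0}. \<exists>C. \<forall>m. \<forall>i\<in>{1..N m}. elem (x m) i \<subseteq> cball x0 (d m) \<longrightarrow>
      \<bar>midpt (x m) i - x0\<bar> \<le> (real k + 3) * ?h m \<longrightarrow>
      \<bar>elem_coeff (\<lambda>s. u s - uh m s) (N m) (x m) j i - c m j\<bar> \<le> C * ?h m ^ (k + 2)"
  proof
    fix j assume "j \<in> \<U> k - {0}"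
    then have "leading_coeff N x x0 d (\<lambda>m s. u s - uh m s) k j (\<lambda>m. c m j)" using lead by blast
    from this[unfolded leading_coeff_def, THEN spec, of "real k + 3", THEN mp]
    show "\<exists>C. \<forall>m. \<forall>i\<in>{1..N m}. elem (x m) i \<subseteq> cball x0 (d m) \<longrightarrow>
        \<bar>midpt (x m) i - x0\<bar> \<le> (real k + 3) * ?h m \<longrightarrow>
        \<bar>elem_coeff (\<lambda>s. u s - uh m s) (N m) (x m) j i - c m j\<bar> \<le> C * ?h m ^ (k + 2)"
      by simp
  qed
  from bchoice[OF this] obtain L where L': "\<forall>j\<in>\<U> k - {0}. \<forall>m. \<forall>i\<in>{1..N m}. elem (x m) i \<subseteq> cball x0 (d m) \<longrightarrow>
      \<bar>midpt (x m) i - x0\<bar> \<le> (real k + 3) * ?h m \<longrightarrow>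
      \<bar>elem_coeff (\<lambda>s. u s - uh m s) (N m) (x m) j i - c m j\<bar> \<le> L j * ?h m ^ (k + 2)" ..
  have L: "\<And>j m i. j \<in> \<U> k - {0} \<Longrightarrow> i \<in> {1..N m} \<Longrightarrow> elem (x m) i \<subseteq> cball x0 (d m) \<Longrightarrow>
      \<bar>midpt (x m) i - x0\<bar> \<le> (real k + 3) * ?h m \<Longrightarrow>
      \<bar>elem_coeff (\<lambda>s. u s - uh m s) (N m) (x m) j i - c m j\<bar> \<le> L j * ?h m ^ (k + 2)"
    using L' by blast
  define Lc where "Lc = (\<Sum>j\<in>\<U> k - {0}. \<bar>L j\<bar>)"
  have h: "?h m > 0" for m using mesh meshsize_pos by blast
  have Lc: "\<bar>elem_coeff (\<lambda>s. u s - uh m s) (N m) (x m) j i - c m j\<bar> \<le> Lc * ?h m ^ (k + 2)"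
    if "i \<in> {1..N m}" "j \<in> \<U> k - {0}" "elem (x m) i \<subseteq> cball x0 (d m)"
      "\<bar>midpt (x m) i - x0\<bar> \<le> (real k + 3) * ?h m" for j m i
  proof -
    have "L j \<le> \<bar>L j\<bar>" by simp
    also have "\<dots> \<le> Lc" unfolding Lc_def using that(2) by (intro member_le_sum) auto
    finally have "L j * ?h m ^ (k + 2) \<le> Lc * ?h m ^ (k + 2)" using h[of m] by (intro mult_right_mono) auto
    then show ?thesis using L[OF that(2,1,3,4)] by linarith
  qed
  let ?K1 = "(2 * real k + 3) * (M * (real k + 3) ^ (k + 2) * \<Lambda>)"
  let ?K2 = "M * (real k + 3) ^ (k + 1) * \<beta> * real k"
  let ?K = "((b - a) + integral {a..b} (\<lambda>s. (U s)\<^sup>2)) / 2"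
  let ?C1 = "Ca * (2 * (\<bar>?K1\<bar> + \<bar>Lc\<bar>) + \<bar>?K2\<bar>) + (1 + \<bar>?\<rho>\<bar>) * (\<bar>?K1\<bar> + \<bar>Lc\<bar>)"
  let ?C2 = "(1 + \<bar>?\<rho>\<bar>) * ((2 * real k + 3) * (?K * \<Lambda>) * exp 1 ^ (k + 2) + Lc)"
  show "\<exists>C. \<forall>m. \<bar>c m j - ?\<rho> * c m (k + 1)\<bar> \<le> C * ?h m ^ (k + 2)"
  proof (intro exI[of _ "max ?C1 ?C2"] allI)
    fix m
    obtain H P where "galerkin_error a b (N m) (x m) k u (uh m) U H P"
      using galerkin_error_exists[OF ab assms(1) _ U u_boundary, of "N m" "x m" "uh m"] mesh galerkin by blast
    then interpret galerkin_error a b "N m" "x m" k u "uh m" U H P .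
    have mono: "C * ?h m ^ (k + 2) \<le> max ?C1 ?C2 * ?h m ^ (k + 2)" if "C \<le> max ?C1 ?C2" for C
      using that h[of m] by (intro mult_right_mono) auto
    have Ch: "(real k + 3) * ?h m \<le> Cstar * ?h m" using Cstar h[of m] by (intro mult_right_mono) auto
    show "\<bar>c m j - ?\<rho> * c m (k + 1)\<bar> \<le> max ?C1 ?C2 * ?h m ^ (k + 2)"
    \<comment> \<open>The threshold is where \<open>\<bar>ln h\<bar> \<ge> 1\<close>, so that \<open>d\<close> is at least \<open>(k + 3) h\<close>.\<close>
    proof (cases "?h m \<le> exp (- 1)")
      case True
      then have "ln (?h m) \<le> ln (exp (- 1))" using h[of m] by (subst ln_le_cancel_iff) auto
      then have "ln (?h m) \<le> - 1" by simp
      then have "Cstar * ?h m * 1 \<le> Cstar * ?h m * \<bar>ln (?h m)\<bar>"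
        using Cstar h[of m] by (intro mult_left_mono) auto
      then have "d m \<ge> (real k + 3) * ?h m" using d Ch by (smt (verit) mult.right_neutral)
      then have "\<bar>c m j - ?\<rho> * c m (k + 1)\<bar> \<le> ?C1 * ?h m ^ (k + 2)"
        using loc by (intro fine_mesh_bound[of x0 "d m" T M \<Lambda> \<beta> "c m" Lc] T(1,2,4) T3 \<Lambda> \<beta> Lc j' pattern) auto
      also have "\<dots> \<le> max ?C1 ?C2 * ?h m ^ (k + 2)" by (intro mono) simp
      finally show ?thesis .
    next
      case False
      have "0 \<le> Cstar * ?h m * \<bar>ln (?h m)\<bar>" using Cstar h[of m] by simp
      then have "d m \<ge> 0" using d by (meson order.trans)
      then have "\<bar>c m j - ?\<rho> * c m (k + 1)\<bar> \<le> ?C2 * ?h m ^ (k + 2)"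
        using loc False by (intro coarse_mesh_bound[of x0 "d m" \<Lambda> "c m" Lc] \<Lambda> Lc j') auto
      also have "\<dots> \<le> max ?C1 ?C2 * ?h m ^ (k + 2)" by (intro mono) simp
      finally show ?thesis .
    qed
  qed
qed simp

end
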